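(* Let $\mathcal{L}_1,\mathcal{L}_2\in \mathrm{Mat}_d(\mathbb{Z})$ be irreducible and coprime. Then there are constants $D>0$ and $\sigma>0$ such that, for every finite subset $A$ of $\mathbb{R}^d$, $$|\mathcal{L}_1 A+\mathcal{L}_2 A|\geq \left(|\det(\mathcal{L}_1)|^{1/d}+|\det(\mathcal{L}_2)|^{1/d}\right)^d|A|-D|A|^{1-\sigma}.$$
   Context: $\mathcal{L}A=\{\mathcal{L}a:a\in A\}$. Irreducible: there are no non-trivial subspaces $U,V$ of $\mathbb{Q}^d$ of the same dimension (non-trivial meaning neither $\{0\}$ nor $\mathbb{Q}^d$) with $\mathcal{L}_1U\subseteq V$ and $\mathcal{L}_2U\subseteq V$. Coprime: there are no $\mathcal{P},\mathcal{Q}\in \mathrm{GL}_d(\mathbb{Q})$ with $0<|\det(\mathcal{P})\det(\mathcal{Q})|<1$ such that $\mathcal{P}\mathcal{L}_1\mathcal{Q},\mathcal{P}\mathcal{L}_2\mathcal{Q}\in\mathrm{Mat}_d(\mathbb{Z})$. *)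

theory Defs
  imports "HOL-Analysis.Analysis"
begin

definition to_rat_mat :: "int^'n^'n \<Rightarrow> rat^'n^'n" where
  "to_rat_mat L = (\<chi> i j. of_int (L $ i $ j))"

definition to_real_mat :: "int^'n^'n \<Rightarrow> real^'n^'n" where
  "to_real_mat L = (\<chi> i j. of_int (L $ i $ j))"

definition irreducible_pair :: "int^'n^'n \<Rightarrow> int^'n^'n \<Rightarrow> bool" where
  "irreducible_pair L1 L2 \<longleftrightarrow>
     \<not> (\<exists>U V :: (rat^'n) set.
          vec.subspace U \<and> vec.subspace V \<and> vec.dim U = vec.dim V \<and>
          U \<noteq> {0} \<and> U \<noteq> UNIV \<and> V \<noteq> {0} \<and> V \<noteq> UNIV \<and>
          (\<lambda>u. to_rat_mat L1 *v u) ` U \<subseteq> V \<and>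
          (\<lambda>u. to_rat_mat L2 *v u) ` U \<subseteq> V)"

definition is_int_mat :: "rat^'n^'n \<Rightarrow> bool" where
  "is_int_mat M \<longleftrightarrow> (\<forall>i j. M $ i $ j \<in> \<int>)"

definition coprime_pair :: "int^'n^'n \<Rightarrow> int^'n^'n \<Rightarrow> bool" where
  "coprime_pair L1 L2 \<longleftrightarrow>
     \<not> (\<exists>P Q :: rat^'n^'n. invertible P \<and> invertible Q \<and>
          0 < \<bar>det P * det Q\<bar> \<and> \<bar>det P * det Q\<bar> < 1 \<and>
          is_int_mat (P ** to_rat_mat L1 ** Q) \<and> is_int_mat (P ** to_rat_mat L2 ** Q))"

definition sumset :: "('a::plus) set \<Rightarrow> 'a set \<Rightarrow> 'a set" where
  "sumset X Y = {x + y | x y. x \<in> X \<and> y \<in> Y}"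

end

theory Submission
  imports Defs
begin

text \<open>
  After replacing \<open>\<real>\<close> by \<open>\<rat>\<close> through a generic \<open>\<rat>\<close>-linear map, write \<open>G B C = |L1 B + L2 C|\<close>. If
  \<open>G A A = O(|A|)\<close>, then Pluennecke--Ruzsa, Bogolyubov and Dirichlet give a direction \<open>v\<close> along
  which \<open>A\<close> is covered by \<open>O(|A| powr (1 - \<tau>))\<close> lines. The same holds for the directions \<open>T^j v\<close>, where
  \<open>T = L1^-1 L2\<close>, and by irreducibility these contain a basis. Compressing along this basis
  reduces \<open>G B C\<close>, for all \<open>B, C \<subseteq> A\<close>, to the volume of a sum of unions of cubes, so Brunn--Minkowski
  yields \<open>G B C \<ge> (|B|^(1/d) + |C|^(1/d))^d\<close> up to the number of lines.

  The determinants enter through the lattice \<open>\<Gamma>\<close> generated by \<open>A - A\<close>: coprimality forces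
  \<open>{x \<in> \<Gamma>. L2 x \<in> L1 \<Gamma>}\<close> to have index at least \<open>|det L1|\<close> in \<open>\<Gamma>\<close>, and symmetrically for \<open>L2\<close>. Splitting \<open>A\<close> into
  residue classes, either some class contributes a proportional gain, or one can pass to classes \<open>Q\<close>
  meeting at least \<open>|det L2|\<close> classes on the \<open>L1\<close> side and \<open>|det L1|\<close> classes on the \<open>L2\<close> side. The sumset of such a \<open>Q\<close>
  is a disjoint union of sumsets of pairs of classes. If all classes have nearly the same size,
  Brunn--Minkowski on each pair gives the bound; otherwise it gives a surplus on the smallest class,
  which pays for the loss in applying induction to the remaining ones.
\<close>

section \<open>Pluennecke--Ruzsa inequalities\<close>

text \<open>Brunn--Minkowski alone gives only the factor \<open>2^d\<close>; the determinants come
  from its homogeneity. If \<open>A\<close> has \<open>n\<close> points and splits evenly into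
  \<open>p = |det L2|\<close> classes on the \<open>L1\<close> side and \<open>q = |det L1|\<close>
  classes on the \<open>L2\<close> side, the \<open>p q\<close> disjoint pair sumsets contribute
  \<open>p q phi(n/p, n/q) = n phi(q, p)\<close>, which is the main term. The obstacle is that every
  splitting inflates the error. Concavity limits this: over at most \<open>2 K\<close> classes,
  \<open>n^(1-\<sigma>)\<close> grows by a factor at most
  \<open>(2 K)^\<sigma> \<le> 1 + \<epsilon>\<close>. So the bound is proved with error coefficients
  \<open>1\<close>, \<open>1 - \<epsilon>\<close> and \<open>1 - 3 \<epsilon>\<close>, under more
  and more knowledge of the classes of \<open>A\<close>, each weaker bound paying for one splitting
  by means of the next stronger one. A gain proportional to \<open>n\<close> beats all these losses,
  because the claim is empty unless the error is below \<open>2 K n\<close>. If a determinant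
  vanishes, none of this applies: irreducibility then forces \<open>d = 1\<close>, coprimality makes
  the other determinant at most 1 in absolute value, and the bound is trivial.\<close>

lemma sumset_eq_image: "sumset X Y = (\<lambda>(x, y). x + y) ` (X \<times> Y)"
  unfolding sumset_def by auto

lemma sumsetI [intro]: "x \<in> X \<Longrightarrow> y \<in> Y \<Longrightarrow> x + y \<in> sumset X Y"
  unfolding sumset_def by auto

lemma sumsetE [elim]: assumes "z \<in> sumset X Y" obtains x y where "x \<in> X" "y \<in> Y" "z = x + y"
  using assms unfolding sumset_def by auto

lemma finite_sumset [simp, intro]: "finite X \<Longrightarrow> finite Y \<Longrightarrow> finite (sumset X Y)"
  unfolding sumset_eq_image by auto

lemma sumset_mono: "X \<subseteq> X' \<Longrightarrow> Y \<subseteq> Y' \<Longrightarrow> sumset X Y \<subseteq> sumset X' Y'"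
  unfolding sumset_def by auto

lemma sumset_empty [simp]: "sumset {} Y = {}" "sumset X {} = {}"
  unfolding sumset_def by auto

lemma sumset_commute: "sumset X Y = sumset Y (X :: 'a::ab_semigroup_add set)"
  unfolding sumset_def by (metis (no_types, lifting) add.commute)

lemma sumset_assoc: "sumset (sumset X Y) Z = sumset X (sumset Y (Z :: 'a::semigroup_add set))"
proof
  show "sumset (sumset X Y) Z \<subseteq> sumset X (sumset Y Z)"
    by (smt (verit, best) add.assoc subsetI sumsetE sumsetI)
  show "sumset X (sumset Y Z) \<subseteq> sumset (sumset X Y) Z"
    by (smt (verit, best) add.assoc subsetI sumsetE sumsetI)
qed

lemma sumset_insert: "sumset (insert c C) Y = (\<lambda>y. c + y) ` Y \<union> sumset C Y"
  unfolding sumset_def by auto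

lemma card_sumset_ge_right:
  fixes X Y :: "'a::cancel_semigroup_add set"
  assumes "finite X" "finite Y" "X \<noteq> {}" shows "card Y \<le> card (sumset X Y)"
proof -
  obtain x where x: "x \<in> X" using assms by auto
  have "card Y = card ((\<lambda>y. x + y) ` Y)" by (simp add: card_image)
  also have "\<dots> \<le> card (sumset X Y)" using x assms by (intro card_mono) auto
  finally show ?thesis .
qed

lemma card_sumset_ge_left:
  fixes X Y :: "'a::cancel_ab_semigroup_add set"
  assumes "finite X" "finite Y" "Y \<noteq> {}" shows "card X \<le> card (sumset X Y)"
  using card_sumset_ge_right[of Y X] assms by (simp add: sumset_commute)

text \<open>Adding a point \<open>c\<close> to \<open>C\<close> enlarges \<open>C + X + Y\<close> by
  at most \<open>|X + Y| - |Z + Y|\<close>, where \<open>Z\<close> collects the \<open>x\<close>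
  with \<open>c + x + Y\<close> already covered, and enlarges \<open>C + X\<close> by at least
  \<open>|X| - |Z|\<close>. Minimality of the ratio \<open>|X + Y| / |X|\<close> makes these two
  growths comparable.\<close>

lemma petridis:
  fixes X Y C :: "'a::ab_group_add set"
  assumes fin: "finite X" "finite Y" "finite C"
    and min: "\<And>Z. Z \<subseteq> X \<Longrightarrow> card (sumset X Y) * card Z \<le> card (sumset Z Y) * card X"
  shows "card (sumset C (sumset X Y)) * card X \<le> card (sumset C X) * card (sumset X Y)"
  using fin(3)
proof (induction C rule: finite_induct)
  case empty then show ?case by simp
next
  case (insert c C)
  define Z where "Z = {x \<in> X. \<forall>y\<in>Y. c + (x + y) \<in> sumset C (sumset X Y)}"
  define W where "W = {x \<in> X. c + x \<in> sumset C X}"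
  have ZX: "Z \<subseteq> X" and finZ: "finite Z" using fin by (auto simp: Z_def)
  \<comment> \<open>If \<open>c + x\<close> is already in \<open>C + X\<close>, adding any
    \<open>y\<close> stays in \<open>C + X + Y\<close>; hence at least
    \<open>card X - card Z\<close> points of \<open>c + X\<close> are new.\<close>
  have WZ: "W \<subseteq> Z"
    unfolding W_def Z_def sumset_def by (auto, metis add.assoc)
  have sub: "sumset (insert c C) (sumset X Y) \<subseteq>
      sumset C (sumset X Y) \<union> (\<lambda>s. c + s) ` (sumset X Y - sumset Z Y)"
    unfolding sumset_insert by (auto simp: Z_def)
  have "card (sumset (insert c C) (sumset X Y)) \<le> card (sumset C (sumset X Y)) + card (sumset X Y - sumset Z Y)"
  proof -
    have "card (sumset (insert c C) (sumset X Y)) \<le> card (sumset C (sumset X Y) \<union> (\<lambda>s. c + s) ` (sumset X Y - sumset Z Y))"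
      using fin insert by (intro card_mono sub) auto
    also have "\<dots> \<le> card (sumset C (sumset X Y)) + card ((\<lambda>s. c + s) ` (sumset X Y - sumset Z Y))"
      by (rule card_Un_le)
    finally show ?thesis by (simp add: card_image)
  qed
  moreover have "card (sumset X Y - sumset Z Y) = card (sumset X Y) - card (sumset Z Y)"
    using fin finZ by (intro card_Diff_subset sumset_mono ZX) auto
  moreover have ZY: "card (sumset Z Y) \<le> card (sumset X Y)"
    using fin by (intro card_mono sumset_mono ZX) auto
  ultimately have 1: "card (sumset (insert c C) (sumset X Y)) + card (sumset Z Y) \<le> card (sumset C (sumset X Y)) + card (sumset X Y)"
    by linarith
  have eq: "sumset (insert c C) X = sumset C X \<union> (\<lambda>s. c + s) ` (X - W)"
    unfolding sumset_insert by (auto simp: W_def)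
  have "card (sumset (insert c C) X) = card (sumset C X) + card ((\<lambda>s. c + s) ` (X - W))"
    unfolding eq using fin insert by (intro card_Un_disjoint) (auto simp: W_def)
  also have "card ((\<lambda>s. c + s) ` (X - W)) = card X - card W"
    using fin by (subst card_image) (auto simp: W_def intro!: card_Diff_subset)
  finally have 2: "card (sumset C X) + card X \<le> card (sumset (insert c C) X) + card Z"
    using card_mono[OF finZ WZ] by linarith
  have 3: "card (sumset X Y) * card Z \<le> card (sumset Z Y) * card X" by (rule min[OF ZX])
  have "card (sumset (insert c C) (sumset X Y)) * card X + card (sumset Z Y) * card X
      \<le> card (sumset C (sumset X Y)) * card X + card (sumset X Y) * card X"
    using mult_le_mono1[OF 1, of "card X"] by (simp add: algebra_simps)
  also have "\<dots> \<le> card (sumset C X) * card (sumset X Y) + card X * card (sumset X Y)"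
    using insert.IH by simp
  also have "\<dots> \<le> card (sumset (insert c C) X) * card (sumset X Y) + card Z * card (sumset X Y)"
    using mult_le_mono1[OF 2, of "card (sumset X Y)"] by (simp add: algebra_simps)
  also have "\<dots> \<le> card (sumset (insert c C) X) * card (sumset X Y) + card (sumset Z Y) * card X"
    using 3 by (simp add: mult.commute)
  finally show ?case by simp
qed

section \<open>Iterated sumsets and difference sets\<close>

primrec nfold_sum :: "nat \<Rightarrow> 'a::comm_monoid_add set \<Rightarrow> 'a set" where
  "nfold_sum 0 A = {0}"
| "nfold_sum (Suc k) A = sumset A (nfold_sum k A)"

definition diffset :: "'a::ab_group_add set \<Rightarrow> 'a set \<Rightarrow> 'a set" where
  "diffset X Y = {x - y | x y. x \<in> X \<and> y \<in> Y}"

lemma finite_nfold_sum [simp, intro]: "finite A \<Longrightarrow> finite (nfold_sum k A)"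
  by (induction k) auto

lemma finite_diffset [simp, intro]: "finite X \<Longrightarrow> finite Y \<Longrightarrow> finite (diffset X Y)"
proof -
  have "diffset X Y = (\<lambda>(x, y). x - y) ` (X \<times> Y)" by (auto simp: diffset_def)
  then show "finite X \<Longrightarrow> finite Y \<Longrightarrow> finite (diffset X Y)" by simp
qed

text \<open>Fix one representation \<open>e = f e - g e\<close> of each difference. The pair
  \<open>(x + f e, x + g e)\<close> determines \<open>e\<close> by subtraction, and then
  \<open>x\<close>.\<close>

lemma ruzsa_triangle:
  fixes X Y Z :: "'a::ab_group_add set"
  assumes fin: "finite X" "finite Y" "finite Z"
  shows "card X * card (diffset Y Z) \<le> card (sumset X Y) * card (sumset X Z)"
proof -
  have "\<forall>e\<in>diffset Y Z. \<exists>y z. y \<in> Y \<and> z \<in> Z \<and> e = y - z" by (auto simp: diffset_def)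
  then obtain f g where fg: "\<And>e. e \<in> diffset Y Z \<Longrightarrow> f e \<in> Y \<and> g e \<in> Z \<and> e = f e - g e"
    by metis
  define h where "h = (\<lambda>(x, e). (x + f e, x + g e))"
  have "inj_on h (X \<times> diffset Y Z)"
  proof (rule inj_onI, clarsimp simp: h_def)
    fix x e x' e'
    assume e: "e \<in> diffset Y Z" "e' \<in> diffset Y Z"
      and eq: "x + f e = x' + f e'" "x + g e = x' + g e'"
    have "f e - g e = f e' - g e'" using eq
      by (metis add_diff_cancel_left)
    then have "e = e'" using fg e by metis
    then show "x = x' \<and> e = e'" using eq by simp
  qed
  then have "card (X \<times> diffset Y Z) \<le> card (sumset X Y \<times> sumset X Z)"
    using fin fg by (intro card_inj_on_le[of h]) (auto simp: h_def)
  then show ?thesis by (simp add: card_cartesian_product)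
qed

text \<open>The competitors are all subsets of \<open>U\<close>: those inside \<open>X\<close> feed
  \<open>petridis\<close>, and \<open>U\<close> itself shows that the minimal ratio does not exceed
  its own.\<close>

lemma minimal_ratio_subset:
  fixes U V :: "'a::ab_group_add set"
  assumes fin: "finite U" "finite V" and ne: "U \<noteq> {}"
  obtains X where "X \<subseteq> U" "X \<noteq> {}" "finite X"
    "\<And>Z. Z \<subseteq> U \<Longrightarrow> card (sumset X V) * card Z \<le> card (sumset Z V) * card X"
proof -
  define \<F> where "\<F> = {X. X \<subseteq> U \<and> X \<noteq> {}}"
  define r where "r X = real (card (sumset X V)) / real (card X)" for X
  have "finite \<F>" "\<F> \<noteq> {}" using fin ne by (auto simp: \<F>_def)
  then obtain X where X: "X \<in> \<F>" "\<And>Z. Z \<in> \<F> \<Longrightarrow> r X \<le> r Z"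
    using ex_min_if_finite[of "r ` \<F>"] by (metis (no_types, lifting) arg_min_if_finite(1) arg_min_least)
  have finX: "finite X" using X fin by (auto simp: \<F>_def intro: finite_subset)
  have "card (sumset X V) * card Z \<le> card (sumset Z V) * card X" if "Z \<subseteq> U" for Z
  proof (cases "Z = {}")
    case False
    then have "r X \<le> r Z" using X that by (auto simp: \<F>_def)
    moreover have "card Z > 0" "card X > 0" using False that fin X finX by (auto simp: card_gt_0_iff \<F>_def intro: finite_subset)
    ultimately have "real (card (sumset X V)) * real (card Z) \<le> real (card (sumset Z V)) * real (card X)"
      by (simp add: r_def field_simps)
    then show ?thesis by (metis of_nat_le_iff of_nat_mult)
  qed auto
  with that X finX show ?thesis by (auto simp: \<F>_def)
qed

text \<open>By \<open>petridis\<close> with \<open>C = nfold_sum k V\<close>, each further summand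
  \<open>V\<close> costs a factor \<open>K\<close> on the minimizer \<open>X\<close>. The triangle
  inequality with pivot \<open>X\<close> then produces the difference set.\<close>

lemma plunnecke_ruzsa:
  fixes U V :: "'a::ab_group_add set" and K :: real
  assumes fin: "finite U" "finite V" and ne: "U \<noteq> {}"
    and K: "real (card (sumset U V)) \<le> K * real (card U)"
  shows "real (card (diffset (nfold_sum k V) (nfold_sum m V))) \<le> K ^ (k + m) * real (card U)"
proof -
  obtain X where X: "X \<subseteq> U" "X \<noteq> {}" "finite X"
    and min: "\<And>Z. Z \<subseteq> U \<Longrightarrow> card (sumset X V) * card Z \<le> card (sumset Z V) * card X"
    using minimal_ratio_subset[OF fin ne] by metis
  have cX: "card X > 0" and cU: "card U > 0" using X fin ne by (auto simp: card_gt_0_iff)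
  have K0: "K \<ge> 0"
    using K cU by (smt (verit) of_nat_0_le_iff of_nat_0_less_iff zero_less_mult_iff mult_nonneg_nonpos mult_neg_pos)
  have XV: "real (card (sumset X V)) \<le> K * real (card X)"
  proof -
    have "real (card (sumset X V)) * real (card U) \<le> real (card (sumset U V)) * real (card X)"
      using min[of U] by (metis of_nat_le_iff of_nat_mult order_refl)
    also have "\<dots> \<le> K * real (card U) * real (card X)" using K by (intro mult_right_mono) auto
    finally have "real (card (sumset X V)) * real (card U) \<le> (K * real (card X)) * real (card U)"
      by (simp add: algebra_simps)
    then show ?thesis using cU by (simp add: mult_le_cancel_right_pos)
  qed
  have it: "real (card (sumset X (nfold_sum k V))) \<le> K ^ k * real (card X)" for k
  proof (induction k)
    case 0
    have "sumset X {0} = X" by (auto simp: sumset_def)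
    then show ?case by simp
  next
    case (Suc k)
    have "card (sumset (nfold_sum k V) (sumset X V)) * card X \<le> card (sumset (nfold_sum k V) X) * card (sumset X V)"
      using fin X by (intro petridis min) auto
    then have "real (card (sumset (nfold_sum k V) (sumset X V))) * real (card X)
        \<le> real (card (sumset (nfold_sum k V) X)) * real (card (sumset X V))"
      by (metis of_nat_le_iff of_nat_mult)
    also have "\<dots> \<le> (K ^ k * real (card X)) * (K * real (card X))"
      using Suc XV K0 by (intro mult_mono) (auto simp: sumset_commute)
    finally have "real (card (sumset (nfold_sum k V) (sumset X V))) \<le> K ^ Suc k * real (card X)"
      using cX by (simp add: algebra_simps)
    moreover have "sumset X (nfold_sum (Suc k) V) = sumset (nfold_sum k V) (sumset X V)"
      by (metis sumset_assoc sumset_commute nfold_sum.simps(2))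
    ultimately show ?case by simp
  qed
  have "real (card X) * real (card (diffset (nfold_sum k V) (nfold_sum m V)))
      \<le> real (card (sumset X (nfold_sum k V))) * real (card (sumset X (nfold_sum m V)))"
    using ruzsa_triangle[of X "nfold_sum k V" "nfold_sum m V"] X fin by (metis finite_nfold_sum of_nat_le_iff of_nat_mult)
  also have "\<dots> \<le> (K ^ k * real (card X)) * (K ^ m * real (card X))"
    using it K0 by (intro mult_mono) auto
  also have "\<dots> = real (card X) * (K ^ (k + m) * real (card X))" by (simp add: power_add algebra_simps)
  finally have "real (card (diffset (nfold_sum k V) (nfold_sum m V))) \<le> K ^ (k + m) * real (card X)"
    using cX by (simp add: mult_le_cancel_left_pos)
  also have "\<dots> \<le> K ^ (k + m) * real (card U)" using K0 X fin by (intro mult_left_mono) (auto intro: card_mono)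
  finally show ?thesis .
qed

section \<open>Arithmetic progressions in 2A - 2A\<close>

definition unit_char :: "nat \<Rightarrow> nat \<Rightarrow> int \<Rightarrow> complex" where
  "unit_char N r x = cis (2 * pi * real r * real_of_int x / real N)"

lemma unit_char_add: "unit_char N r (x + y) = unit_char N r x * unit_char N r y"
  unfolding unit_char_def by (simp add: cis_mult algebra_simps add_divide_distrib)

lemma unit_char_minus: "unit_char N r (- x) = cnj (unit_char N r x)"
  unfolding unit_char_def by (simp add: cis_cnj)

lemma sum_unit_char:
  assumes "N > 0"
  shows "(\<Sum>r<N. unit_char N r x) = (if int N dvd x then of_nat N else 0)"
proof -
  define z where "z = cis (2 * pi * real_of_int x / real N)"
  have pw: "unit_char N r x = z ^ r" for r
  proof -
    have "2 * pi * real r * real_of_int x / real N = real r * (2 * pi * real_of_int x / real N)" by simp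
    then show ?thesis unfolding unit_char_def z_def Complex.DeMoivre by (rule arg_cong)
  qed
  have zN: "z ^ N = 1"
  proof -
    have "z ^ N = cis (2 * pi * real_of_int x)"
      unfolding z_def Complex.DeMoivre using assms by simp
    also have "\<dots> = 1" by (simp add: complex_eq_iff cos_int_2pin sin_int_2pin)
    finally show ?thesis .
  qed
  show ?thesis
  proof (cases "int N dvd x")
    case True
    then obtain k where "x = int N * k" by auto
    then have "2 * pi * real_of_int x / real N = 2 * pi * real_of_int k" using assms by simp
    then have "z = cis (2 * pi * real_of_int k)" unfolding z_def by (rule arg_cong)
    then have "z = 1" by (simp add: complex_eq_iff cos_int_2pin sin_int_2pin)
    with True show ?thesis by (simp add: pw)
  next
    case False
    have "z \<noteq> 1"
    proof
      assume "z = 1"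
      then have "cos (2 * pi * real_of_int x / real N) = 1" unfolding z_def by (simp add: complex_eq_iff)
      then obtain k :: int where "2 * pi * real_of_int x / real N = real_of_int k * 2 * pi"
        using cos_one_2pi_int by blast
      then have "real_of_int x = real_of_int k * real N" using assms by (simp add: field_simps)
      then have "real_of_int x = real_of_int (k * int N)" by simp
      then have "x = k * int N" by (simp only: of_int_eq_iff)
      with False show False by simp
    qed
    moreover have "(z - 1) * (\<Sum>r<N. z ^ r) = 0" using zN power_diff_1_eq[of z N] by simp
    ultimately show ?thesis using False by (simp add: pw)
  qed
qed

text \<open>Up to a factor \<open>N\<close>, the number of ways to write \<open>t\<close> modulo
  \<open>N\<close> as \<open>b1 + b2 - b3 - b4\<close> is a Fourier sum with weights
  \<open>F r * F r\<close>. On \<open>\<Gamma>\<close>, where \<open>F\<close> is large, the cosines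
  are nonnegative; the remaining terms weigh less than the single one at \<open>r = 0\<close>, so
  the sum cannot vanish.\<close>

lemma bogolyubov_mod:
  fixes B :: "int set" and N :: nat
  assumes N: "N > 0" and B: "B \<subseteq> {0..<int N}" "B \<noteq> {}"
  obtains \<Gamma> :: "nat set" where "finite \<Gamma>" "card \<Gamma> * (card B)\<^sup>2 \<le> N\<^sup>2"
    "\<And>t::int. (\<And>r. r \<in> \<Gamma> \<Longrightarrow> cos (2 * pi * real r * real_of_int t / real N) \<ge> 0) \<Longrightarrow>
      \<exists>b1\<in>B. \<exists>b2\<in>B. \<exists>b3\<in>B. \<exists>b4\<in>B. int N dvd b1 + b2 - b3 - b4 - t"
proof -
  have finB: "finite B" using B by (meson finite_atLeastLessThan_int finite_subset)
  have cB: "card B > 0" using finB B by (simp add: card_gt_0_iff)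
  define f where "f r = (\<Sum>b\<in>B. unit_char N r b)" for r
  define F where "F r = (cmod (f r))\<^sup>2" for r
  have F0: "F r \<ge> 0" for r by (simp add: F_def)
  have Fc: "complex_of_real (F r) = f r * cnj (f r)" for r
    unfolding F_def by (simp only: complex_norm_square)
  have cnjf: "cnj (f r) = (\<Sum>b\<in>B. unit_char N r (- b))" for r
    unfolding f_def by (simp add: unit_char_minus)
  have parseval: "(\<Sum>r<N. F r) = real N * real (card B)"
  proof -
    have "complex_of_real (\<Sum>r<N. F r) = (\<Sum>r<N. \<Sum>b\<in>B. \<Sum>c\<in>B. unit_char N r (b - c))"
      unfolding of_real_sum Fc cnjf unfolding f_def
      by (simp add: sum_product unit_char_add[symmetric])
    also have "\<dots> = (\<Sum>b\<in>B. \<Sum>r<N. \<Sum>c\<in>B. unit_char N r (b - c))" by (rule sum.swap)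
    also have "\<dots> = (\<Sum>b\<in>B. \<Sum>c\<in>B. \<Sum>r<N. unit_char N r (b - c))"
      by (intro sum.cong refl sum.swap)
    also have "\<dots> = (\<Sum>b\<in>B. \<Sum>c\<in>B. if b = c then of_nat N else 0)"
    proof (intro sum.cong refl)
      fix b c assume bc: "b \<in> B" "c \<in> B"
      have "int N dvd b - c \<longleftrightarrow> b = c"
      proof
        assume "int N dvd b - c"
        moreover have "\<bar>b - c\<bar> < int N" using subsetD[OF B(1) bc(1)] subsetD[OF B(1) bc(2)] by auto
        ultimately show "b = c" using zdvd_imp_le[of "int N" "\<bar>b - c\<bar>"] by auto
      qed auto
      then show "(\<Sum>r<N. unit_char N r (b - c)) = (if b = c then of_nat N else 0)"
        by (simp add: sum_unit_char[OF N])
    qed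
    also have "\<dots> = complex_of_real (real N * real (card B))" using finB by simp
    finally show ?thesis by (simp only: of_real_eq_iff)
  qed
  \<comment> \<open>With this threshold the part off \<open>\<Gamma>\<close> is at most
    \<open>\<beta>\<close> times the Parseval mass \<open>N |B|\<close>, which is
    \<open>|B|^4 = (F 0)^2\<close>, and \<open>\<Gamma>\<close> has at most
    \<open>N^2 / |B|^2\<close> elements.\<close>
  define \<beta> where "\<beta> = real (card B) ^ 3 / real N"
  have \<beta>: "\<beta> > 0" using cB N by (simp add: \<beta>_def)
  define \<Gamma> where "\<Gamma> = {r. r < N \<and> F r \<ge> \<beta>}"
  have fin\<Gamma>: "finite \<Gamma>" and \<Gamma>sub: "\<Gamma> \<subseteq> {..<N}" by (auto simp: \<Gamma>_def)
  have "real (card \<Gamma>) * \<beta> \<le> (\<Sum>r\<in>\<Gamma>. F r)"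
    using sum_mono[of \<Gamma> "\<lambda>_. \<beta>" F] by (simp add: \<Gamma>_def)
  also have "\<dots> \<le> (\<Sum>r<N. F r)" using \<Gamma>sub F0 by (intro sum_mono2) auto
  finally have "real (card \<Gamma>) * real (card B) ^ 3 \<le> real N ^ 2 * real (card B)"
    unfolding parseval \<beta>_def using N by (simp add: field_simps power2_eq_square)
  then have "(real (card \<Gamma>) * real (card B) ^ 2) * real (card B) \<le> real N ^ 2 * real (card B)"
    by (simp add: power2_eq_square power3_eq_cube algebra_simps)
  then have "real (card \<Gamma>) * real (card B) ^ 2 \<le> real N ^ 2"
    using cB by (simp add: mult_le_cancel_right_pos)
  then have c\<Gamma>: "card \<Gamma> * (card B)\<^sup>2 \<le> N\<^sup>2"
    by (metis of_nat_le_iff of_nat_mult of_nat_power)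
  have main: "\<exists>b1\<in>B. \<exists>b2\<in>B. \<exists>b3\<in>B. \<exists>b4\<in>B. int N dvd b1 + b2 - b3 - b4 - t"
    if t: "\<And>r. r \<in> \<Gamma> \<Longrightarrow> cos (2 * pi * real r * real_of_int t / real N) \<ge> 0" for t :: int
  proof (rule ccontr)
    assume no: "\<not> ?thesis"
    have "(\<Sum>r<N. complex_of_real (F r * F r) * unit_char N r (- t))
        = (\<Sum>r<N. \<Sum>b1\<in>B. \<Sum>b2\<in>B. \<Sum>b3\<in>B. \<Sum>b4\<in>B. unit_char N r (b1 + b2 - b3 - b4 - t))"
    proof (intro sum.cong refl)
      fix r
      have "(\<Sum>b1\<in>B. \<Sum>b2\<in>B. \<Sum>b3\<in>B. \<Sum>b4\<in>B. unit_char N r (b1 + b2 - b3 - b4 - t))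
          = (\<Sum>b1\<in>B. \<Sum>b2\<in>B. \<Sum>b3\<in>B. \<Sum>b4\<in>B. unit_char N r b1 * (unit_char N r b2 *
              (unit_char N r (- b3) * (unit_char N r (- b4) * unit_char N r (- t)))))"
        by (intro sum.cong refl) (simp add: unit_char_add[symmetric] algebra_simps)
      also have "\<dots> = f r * (f r * (cnj (f r) * (cnj (f r) * unit_char N r (- t))))"
        unfolding cnjf unfolding f_def
        by (simp only: sum_distrib_left[symmetric] sum_distrib_right[symmetric])
      also have "\<dots> = complex_of_real (F r * F r) * unit_char N r (- t)"
        unfolding of_real_mult Fc by (simp add: algebra_simps)
      finally show "complex_of_real (F r * F r) * unit_char N r (- t) =
        (\<Sum>b1\<in>B. \<Sum>b2\<in>B. \<Sum>b3\<in>B. \<Sum>b4\<in>B. unit_char N r (b1 + b2 - b3 - b4 - t))" by simp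
    qed
    also have "\<dots> = (\<Sum>b1\<in>B. \<Sum>b2\<in>B. \<Sum>b3\<in>B. \<Sum>b4\<in>B. \<Sum>r<N. unit_char N r (b1 + b2 - b3 - b4 - t))"
      by (subst sum.swap, intro sum.cong refl, subst sum.swap, intro sum.cong refl,
          subst sum.swap, intro sum.cong refl, rule sum.swap)
    also have "\<dots> = (\<Sum>b1\<in>B. \<Sum>b2\<in>B. \<Sum>b3\<in>B. \<Sum>b4\<in>B. 0)"
      using no by (intro sum.cong refl) (auto simp: sum_unit_char[OF N])
    finally have "Re (\<Sum>r<N. complex_of_real (F r * F r) * unit_char N r (- t)) = 0" by simp
    then have zero: "(\<Sum>r<N. F r * F r * cos (2 * pi * real r * real_of_int t / real N)) = 0"
      by (simp add: unit_char_def)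
    have F_0: "F 0 = real (card B) ^ 2" unfolding F_def f_def unit_char_def by simp
    have "\<beta> \<le> F 0"
    proof -
      have "card B \<le> N" using card_mono[OF _ B(1)] by simp
      then show ?thesis unfolding F_0 \<beta>_def using N
        by (simp add: field_simps power2_eq_square power3_eq_cube mult_right_mono)
    qed
    then have zG: "0 \<in> \<Gamma>" using N by (simp add: \<Gamma>_def)
    have split: "(\<Sum>r<N. h r) = h 0 + (\<Sum>r\<in>\<Gamma>-{0}. h r) + (\<Sum>r\<in>{..<N}-\<Gamma>. h r)" for h :: "nat \<Rightarrow> real"
      using sum.subset_diff[OF \<Gamma>sub, of h] sum.remove[OF fin\<Gamma> zG, of h] by simp
    have "(\<Sum>r\<in>{..<N}-\<Gamma>. F r * F r) \<le> (\<Sum>r\<in>{..<N}-\<Gamma>. \<beta> * F r)"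
      using F0 by (intro sum_mono mult_right_mono) (auto simp: \<Gamma>_def)
    also have "\<dots> = \<beta> * (\<Sum>r\<in>{..<N}-\<Gamma>. F r)" by (simp add: sum_distrib_left)
    \<comment> \<open>Removing the term \<open>F 0\<close>, whose index lies in
      \<open>\<Gamma>\<close>, is what makes the estimate strict.\<close>
    also have "\<dots> \<le> \<beta> * (real N * real (card B) - real (card B) ^ 2)"
      using split[of F] parseval F_0 \<beta> sum_nonneg[of "\<Gamma>-{0}" F] F0 by (intro mult_left_mono) auto
    also have "\<dots> < \<beta> * (real N * real (card B))" using \<beta> cB by (intro mult_strict_left_mono) auto
    also have "\<dots> = real (card B) ^ 4" using N by (simp add: \<beta>_def power3_eq_cube power4_eq_xxxx)
    finally have small: "(\<Sum>r\<in>{..<N}-\<Gamma>. F r * F r) < real (card B) ^ 4" .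
    have "(\<Sum>r\<in>{..<N}-\<Gamma>. F r * F r * cos (2 * pi * real r * real_of_int t / real N))
        \<ge> (\<Sum>r\<in>{..<N}-\<Gamma>. - (F r * F r))"
    proof (intro sum_mono)
      fix r
      have "F r * F r * cos (2 * pi * real r * real_of_int t / real N) \<ge> F r * F r * (-1)"
        using F0 by (intro mult_left_mono) auto
      then show "- (F r * F r) \<le> F r * F r * cos (2 * pi * real r * real_of_int t / real N)" by simp
    qed
    moreover have "(\<Sum>r\<in>\<Gamma>-{0}. F r * F r * cos (2 * pi * real r * real_of_int t / real N)) \<ge> 0"
      using t F0 by (intro sum_nonneg mult_nonneg_nonneg) auto
    moreover have "F 0 * F 0 = real (card B) ^ 4" by (simp add: F_0 power2_eq_square power4_eq_xxxx)
    ultimately show False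
      using split[of "\<lambda>r. F r * F r * cos (2 * pi * real r * real_of_int t / real N)"] zero small
      by (simp add: sum_negf)
  qed
  show ?thesis by (rule that[OF fin\<Gamma> c\<Gamma> main])
qed

text \<open>Pigeonhole: there are more values of \<open>y\<close> than boxes of side
  \<open>1 / m\<close> for the fractional parts, so two values share a box; their difference is the
  required \<open>y\<close>.\<close>

lemma dirichlet_mod:
  fixes \<Gamma> :: "nat set" and m N :: nat
  assumes "finite \<Gamma>" and m: "m > 0" and less: "m ^ card \<Gamma> < N"
  obtains y :: nat where "0 < y" "y < N"
    "\<And>r. r \<in> \<Gamma> \<Longrightarrow> \<exists>k::int. \<bar>real r * real y / real N - real_of_int k\<bar> \<le> 1 / real m"
proof -
  define \<phi> where "\<phi> y = (\<lambda>r\<in>\<Gamma>. nat \<lfloor>real m * frac (real r * real y / real N)\<rfloor>)" for y :: nat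
  have "\<phi> ` {..<N} \<subseteq> \<Gamma> \<rightarrow>\<^sub>E {..<m}"
  proof (clarsimp simp: \<phi>_def)
    fix y r
    have "real m * frac (real r * real y / real N) < real m" using m frac_lt_1 by simp
    then have "\<lfloor>real m * frac (real r * real y / real N)\<rfloor> < int m" by linarith
    then show "nat \<lfloor>real m * frac (real r * real y / real N)\<rfloor> < m"
      using m by linarith
  qed
  moreover have "finite (\<Gamma> \<rightarrow>\<^sub>E {..<m})" using assms by (intro finite_PiE) auto
  moreover have "card (\<Gamma> \<rightarrow>\<^sub>E {..<m}) < card {..<N}" using assms by (simp add: card_PiE)
  ultimately have "\<not> inj_on \<phi> {..<N}"
    by (metis card_inj_on_le leD)
  then obtain y1 y2 where y: "y1 < y2" "y2 < N" "\<phi> y1 = \<phi> y2"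
    unfolding inj_on_def by (metis lessThan_iff linorder_neqE_nat)
  show ?thesis
  proof (rule that[of "y2 - y1"])
    fix r assume r: "r \<in> \<Gamma>"
    define u v where "u = real r * real y1 / real N" and "v = real r * real y2 / real N"
    have "nat \<lfloor>real m * frac u\<rfloor> = nat \<lfloor>real m * frac v\<rfloor>"
      using fun_cong[OF y(3), of r] r by (simp add: \<phi>_def u_def v_def)
    moreover have "\<lfloor>real m * frac u\<rfloor> \<ge> 0" "\<lfloor>real m * frac v\<rfloor> \<ge> 0" by auto
    ultimately have "\<lfloor>real m * frac u\<rfloor> = \<lfloor>real m * frac v\<rfloor>" by linarith
    then have "\<bar>real m * frac u - real m * frac v\<bar> \<le> 1" by linarith
    then have "real m * \<bar>frac u - frac v\<bar> \<le> 1"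
      by (simp add: abs_mult right_diff_distrib[symmetric])
    then have "\<bar>frac v - frac u\<bar> \<le> 1 / real m" using m by (simp add: field_simps abs_minus_commute)
    moreover have "real r * real (y2 - y1) / real N = v - u"
      using y by (simp add: u_def v_def of_nat_diff right_diff_distrib diff_divide_distrib)
    ultimately have "\<bar>real r * real (y2 - y1) / real N - real_of_int (\<lfloor>v\<rfloor> - \<lfloor>u\<rfloor>)\<bar> \<le> 1 / real m"
      by (simp add: frac_def algebra_simps)
    then show "\<exists>k::int. \<bar>real r * real (y2 - y1) / real N - real_of_int k\<bar> \<le> 1 / real m" by blast
  qed (use y in auto)
qed

section \<open>From residues back to integers\<close>

lemma nfold_sum_2I: "a1 \<in> A \<Longrightarrow> a2 \<in> A \<Longrightarrow> a1 + a2 \<in> nfold_sum 2 A"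
  using sumsetI[OF _ sumsetI[of a2 A 0 "{0}"], of a1 A] by (simp add: numeral_eq_Suc)

lemma nfold_sum_2E: assumes "x \<in> nfold_sum 2 A" obtains a1 a2 where "a1 \<in> A" "a2 \<in> A" "x = a1 + a2"
  using assms by (auto simp: numeral_eq_Suc elim!: sumsetE)

text \<open>Six summands per side, because showing that a lifted progression is additive compares
  three elements of \<open>2A - 2A\<close>, twelve terms in all.\<close>

lemma nfold_sum_6I:
  assumes "a1 \<in> A" "a2 \<in> A" "a3 \<in> A" "a4 \<in> A" "a5 \<in> A" "a6 \<in> A"
  shows "a1 + a2 + a3 + a4 + a5 + a6 \<in> nfold_sum 6 A"
proof -
  have "a1 + (a2 + (a3 + (a4 + (a5 + (a6 + 0))))) \<in> nfold_sum 6 A"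
  proof -
    have six: "(6::nat) = Suc (Suc (Suc (Suc (Suc (Suc 0)))))" by simp
    show ?thesis unfolding six nfold_sum.simps by (intro sumsetI assms) simp
  qed
  then show ?thesis by (simp add: add.assoc)
qed

lemma card_multiples_le:
  assumes "N > 0" shows "card {r \<in> {1..int M}. int N dvd r} \<le> M div N"
proof -
  have "{r \<in> {1..int M}. int N dvd r} \<subseteq> (\<lambda>k. int N * int k) ` {1..M div N}"
  proof
    fix r assume "r \<in> {r \<in> {1..int M}. int N dvd r}"
    then obtain k where k: "r = int N * k" "1 \<le> r" "r \<le> int M" by auto
    then have k1: "k \<ge> 1" using assms by (smt (verit) of_nat_0_le_iff mult_nonneg_nonpos)
    have "k \<le> int M div int N" using k assms by (simp add: zdiv_mono1[of "int N * k" "int M" "int N", simplified])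
    then have "nat k \<le> M div N" by (simp add: zdiv_int nat_le_iff)
    with k k1 show "r \<in> (\<lambda>k. int N * int k) ` {1..M div N}" by (intro image_eqI[of _ _ "nat k"]) auto
  qed
  then have "card {r \<in> {1..int M}. int N dvd r} \<le> card ((\<lambda>k. int N * int k) ` {1..M div N})"
    by (intro card_mono) auto
  also have "\<dots> \<le> M div N" using card_image_le[of "{1..M div N}" "\<lambda>k. int N * int k"] by simp
  finally show ?thesis .
qed

text \<open>
  Averaging over the dilations \<open>q\<close> modulo a large prime: for each nonzero \<open>x\<close> the residue \<open>q x mod P\<close> is a
  multiple of \<open>N\<close> for at most a proportion \<open>1/N\<close> of them.
\<close>

lemma exists_good_dilation:
  fixes D :: "int set" and N :: nat
  assumes fin: "finite D" and N: "card D < N" and z: "0 \<in> D"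
  obtains P q :: int where "prime P" "\<And>x. x \<in> D \<Longrightarrow> x \<noteq> 0 \<Longrightarrow> \<not> int N dvd (q * x) mod P"
proof -
  obtain M :: nat where M: "\<And>x. x \<in> D \<Longrightarrow> nat \<bar>x\<bar> \<le> M"
    using finite_nat_set_iff_bounded_le[of "(\<lambda>x. nat \<bar>x\<bar>) ` D"] fin by auto
  obtain P' :: nat where P': "prime P'" "M < P'" using bigger_prime by blast
  define P where "P = int P'"
  have P: "prime P" using P' by (simp add: P_def)
  have P2: "P \<ge> 2" using P prime_ge_2_int by blast
  have notdvd: "\<not> P dvd x" if "x \<in> D" "x \<noteq> 0" for x
  proof
    assume "P dvd x"
    then have "P \<le> \<bar>x\<bar>" using that zdvd_imp_le[of P "\<bar>x\<bar>"] by simp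
    with M[OF that(1)] P'(2) show False by (simp add: P_def nat_le_iff)
  qed
  define bad where "bad x = {q \<in> {1..P-1}. int N dvd (q * x) mod P}" for x
  have cbad: "card (bad x) \<le> (P' - 1) div N" if "x \<in> D" "x \<noteq> 0" for x
  proof -
    have "inj_on (\<lambda>q. (q * x) mod P) (bad x)"
    proof (rule inj_onI)
      fix q q' assume q: "q \<in> bad x" "q' \<in> bad x" "(q * x) mod P = (q' * x) mod P"
      then have "P dvd q * x - q' * x" by (simp add: mod_eq_dvd_iff)
      then have "P dvd (q - q') * x" by (simp add: left_diff_distrib)
      then have "P dvd q - q'" using P notdvd[OF that] prime_dvd_mult_iff by blast
      moreover have "\<bar>q - q'\<bar> < P" using q by (auto simp: bad_def)
      ultimately show "q = q'" using zdvd_imp_le[of P "\<bar>q - q'\<bar>"] by auto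
    qed
    moreover have "(\<lambda>q. (q * x) mod P) ` bad x \<subseteq> {r \<in> {1..int (P' - 1)}. int N dvd r}"
    proof clarify
      fix q assume q: "q \<in> bad x"
      have "\<not> P dvd q" using q zdvd_imp_le[of P q] by (auto simp: bad_def)
      then have "\<not> P dvd q * x" using P notdvd[OF that] prime_dvd_mult_iff by blast
      then have "(q * x) mod P \<noteq> 0" by (simp add: dvd_eq_mod_eq_0)
      moreover have "0 \<le> (q * x) mod P" "(q * x) mod P < P" using P2 by auto
      ultimately have "1 \<le> (q * x) mod P" "(q * x) mod P \<le> P - 1" by linarith+
      moreover have "int (P' - 1) = P - 1" using P2 by (simp add: P_def of_nat_diff)
      ultimately show "(q * x) mod P \<in> {1..int (P' - 1)} \<and> int N dvd (q * x) mod P"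
        using q unfolding bad_def by auto
    qed
    moreover have "finite {r \<in> {1..int (P' - 1)}. int N dvd r}"
      by (rule finite_subset[of _ "{1..int (P' - 1)}"]) auto
    ultimately have "card (bad x) \<le> card {r \<in> {1..int (P' - 1)}. int N dvd r}"
      by (rule card_inj_on_le)
    also have "\<dots> \<le> (P' - 1) div N" using N by (intro card_multiples_le) simp
    finally show ?thesis .
  qed
  have "card (\<Union>x\<in>D-{0}. bad x) \<le> (\<Sum>x\<in>D-{0}. card (bad x))" using fin by (intro card_UN_le) auto
  also have "\<dots> \<le> (\<Sum>x\<in>D-{0}. (P' - 1) div N)" using cbad by (intro sum_mono) auto
  also have "\<dots> = (card D - 1) * ((P' - 1) div N)" using fin z by simp
  also have "\<dots> < P' - 1"
  proof (cases "(P' - 1) div N = 0")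
    case True
    then show ?thesis using P2 by (simp add: P_def)
  next
    case False
    have "(card D - 1) * ((P' - 1) div N) < N * ((P' - 1) div N)" using N False by (intro mult_strict_right_mono) auto
    also have "\<dots> \<le> P' - 1" by simp
    finally show ?thesis .
  qed
  also have "P' - 1 = card {1..P-1}" using P2 by (simp add: P_def)
  finally have lt: "card (\<Union>x\<in>D-{0}. bad x) < card {1..P-1}" .
  have "\<not> {1..P-1} \<subseteq> (\<Union>x\<in>D-{0}. bad x)"
  proof -
    have "finite (\<Union>x\<in>D-{0}. bad x)"
      by (rule finite_subset[of _ "{1..P-1}"]) (auto simp: bad_def)
    with lt show ?thesis
      using card_mono leD by blast
  qed
  then obtain q where q: "q \<in> {1..P-1}" "\<And>x. x \<in> D \<Longrightarrow> x \<noteq> 0 \<Longrightarrow> q \<notin> bad x" by blast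
  with that[of P q] P q show ?thesis by (auto simp: bad_def)
qed

text \<open>Each point excludes at most one value of the coefficient \<open>c\<close>, and
  \<open>rat\<close> is infinite. This turns pointwise separation into one functional, for vectors
  over \<open>rat\<close> and again for real numbers.\<close>

lemma exists_nonvanishing_combination:
  fixes \<F> :: "('a \<Rightarrow> rat) set"
  assumes "finite D" and z: "(\<lambda>_. 0) \<in> \<F>"
    and cl: "\<And>F G c. F \<in> \<F> \<Longrightarrow> G \<in> \<F> \<Longrightarrow> (\<lambda>x. F x + c * G x) \<in> \<F>"
    and sep: "\<And>x. x \<in> D \<Longrightarrow> \<exists>G\<in>\<F>. G x \<noteq> 0"
  shows "\<exists>F\<in>\<F>. \<forall>x\<in>D. F x \<noteq> 0"
  using assms(1) sep
proof (induction D rule: finite_induct)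
  case empty then show ?case using z by auto
next
  case (insert x D)
  then obtain F where F: "F \<in> \<F>" "\<forall>x\<in>D. F x \<noteq> 0" by auto
  obtain G where G: "G \<in> \<F>" "G x \<noteq> 0" using insert by auto
  have "infinite (UNIV :: rat set)" by (rule infinite_UNIV_char_0)
  moreover have "finite (insert 0 ((\<lambda>y. - F y / G y) ` insert x D))" using insert by simp
  ultimately obtain c where "c \<notin> insert 0 ((\<lambda>y. - F y / G y) ` insert x D)"
    by (metis ex_new_if_finite)
  then have c: "c \<notin> (\<lambda>y. - F y / G y) ` insert x D" "c \<noteq> 0" by auto
  have "F y + c * G y \<noteq> 0" if "y \<in> insert x D" for y
  proof (cases "G y = 0")
    case True then show ?thesis using that F G by auto
  next
    case False
    show ?thesis
    proof
      assume "F y + c * G y = 0"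
      then have "c = - F y / G y" using False by (simp add: field_simps eq_neg_iff_add_eq_0 add.commute)
      with c that show False by auto
    qed
  qed
  then show ?case using cl[OF F(1) G(1), of c] by (intro bexI[of _ "\<lambda>x. F x + c * G x"]) auto
qed

text \<open>
  Ruzsa's embedding: dilate modulo \<open>P\<close>, keep the sixth \<open>A'\<close> of \<open>A\<close> whose residues lie in one interval of
  length \<open>P/6\<close>, and reduce modulo \<open>N\<close>. Six-term sums on \<open>A'\<close> then coincide whenever their images do, so the
  progression found modulo \<open>N\<close> inside the image lifts back.
\<close>

lemma ap_in_2A_minus_2A_int:
  fixes A :: "int set" and C :: real
  assumes fin: "finite A" and ne: "A \<noteq> {}" and C: "C \<ge> 1"
    and dbl: "real (card (diffset (nfold_sum 6 A) (nfold_sum 6 A))) \<le> C * real (card A)"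
  obtains v :: int and l :: nat where "v \<noteq> 0"
    "real (card A) powr (1 / real (nat \<lceil>144 * C\<^sup>2\<rceil>)) \<le> 4 * (real l + 1)"
    "\<And>j. j \<le> l \<Longrightarrow> int j * v \<in> diffset (nfold_sum 2 A) (nfold_sum 2 A)"
proof -
  define D where "D = diffset (nfold_sum 6 A) (nfold_sum 6 A)"
  \<comment> \<open>Large enough for a good dilation to exist, yet at most
    \<open>2 * C * card A\<close>, so that the image of \<open>A'\<close> is dense modulo
    \<open>N\<close>.\<close>
  define N where "N = card D + 1"
  have finD: "finite D" using fin by (simp add: D_def)
  have memD: "a1+a2+a3+a4+a5+a6 - (b1+b2+b3+b4+b5+b6) \<in> D"
    if "a1\<in>A" "a2\<in>A" "a3\<in>A" "a4\<in>A" "a5\<in>A" "a6\<in>A" "b1\<in>A" "b2\<in>A" "b3\<in>A" "b4\<in>A" "b5\<in>A" "b6\<in>A"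
    for a1 a2 a3 a4 a5 a6 b1 b2 b3 b4 b5 b6
    unfolding D_def diffset_def using that by (blast intro: nfold_sum_6I)
  have symD: "- x \<in> D" if "x \<in> D" for x
    using that unfolding D_def diffset_def by force
  obtain a0 where a0: "a0 \<in> A" using ne by auto
  have zD: "0 \<in> D" using memD[of a0 a0 a0 a0 a0 a0 a0 a0 a0 a0 a0 a0] a0 by simp
  obtain P q where P: "prime P" "\<And>x. x \<in> D \<Longrightarrow> x \<noteq> 0 \<Longrightarrow> \<not> int N dvd (q * x) mod P"
    using exists_good_dilation[OF finD _ zD, of N] by (metis N_def less_add_one)
  have P2: "P \<ge> 2" using P prime_ge_2_int by blast
  define r where "r a = (q * a) mod P" for a
  have r: "0 \<le> r a" "r a < P" for a using P2 by (auto simp: r_def)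
  define g where "g a = (q * a) div P" for a
  have rg: "r a = q * a - P * g a" for a
    unfolding r_def g_def by (simp add: minus_mult_div_eq_mod)
  have "(\<lambda>a. (6 * r a) div P) ` A \<subseteq> {0..<6}"
  proof clarify
    fix a
    have "6 * r a < 6 * P" using r[of a] by simp
    then have "(6 * r a) div P < 6"
    proof -
      have "6 * r a = P * ((6 * r a) div P) + (6 * r a) mod P" "(6 * r a) mod P \<ge> 0" using P2 by auto
      moreover have "6 \<le> (6 * r a) div P \<Longrightarrow> P * 6 \<le> P * ((6 * r a) div P)" using P2 by (intro mult_left_mono) auto
      ultimately show ?thesis using \<open>6 * r a < 6 * P\<close> by linarith
    qed
    then show "(6 * r a) div P \<in> {0..<6}" using r[of a] P2 by (simp add: pos_imp_zdiv_nonneg_iff)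
  qed
  then have "card A \<le> (\<Sum>s\<in>{0..<6::int}. card {a \<in> A. (6 * r a) div P = s})"
  proof -
    assume sub: "(\<lambda>a. (6 * r a) div P) ` A \<subseteq> {0..<6}"
    then have "A = (\<Union>s\<in>{0..<6::int}. {a \<in> A. (6 * r a) div P = s})" by auto
    then show ?thesis using card_UN_le[of "{0..<6::int}" "\<lambda>s. {a \<in> A. (6 * r a) div P = s}"] by simp
  qed
  then have "\<exists>s\<in>{0..<6::int}. card A \<le> 6 * card {a \<in> A. (6 * r a) div P = s}"
  proof (rule contrapos_pp)
    assume "\<not> (\<exists>s\<in>{0..<6::int}. card A \<le> 6 * card {a \<in> A. (6 * r a) div P = s})"
    then have "(\<Sum>s\<in>{0..<6::int}. 6 * card {a \<in> A. (6 * r a) div P = s}) < (\<Sum>s\<in>{0..<6::int}. card A)"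
      by (intro sum_strict_mono) (auto simp: not_le)
    then show "\<not> card A \<le> (\<Sum>s\<in>{0..<6::int}. card {a \<in> A. (6 * r a) div P = s})"
      by (simp add: sum_distrib_left[symmetric])
  qed
  then obtain s where s: "card A \<le> 6 * card {a \<in> A. (6 * r a) div P = s}" by blast
  define A' where "A' = {a \<in> A. (6 * r a) div P = s}"
  have A'A: "A' \<subseteq> A" by (auto simp: A'_def)
  have cA': "card A \<le> 6 * card A'" using s by (simp add: A'_def)
  have close: "6 * r a < 6 * r b + P" if "a \<in> A'" "b \<in> A'" for a b
  proof -
    have s: "(6 * r a) div P = s" "(6 * r b) div P = s" using that by (simp_all add: A'_def)
    obtain u v where "6 * r a = P * s + u" "6 * r b = P * s + v" "0 \<le> u" "u < P" "0 \<le> v" "v < P"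
      using mult_div_mod_eq[of P "6 * r a"] mult_div_mod_eq[of P "6 * r b"] P2 unfolding s
      by (metis less_le_trans pos_mod_bound pos_mod_sign zero_less_numeral)
    then show ?thesis by linarith
  qed
  have key: "a1+a2+a3+a4+a5+a6 = b1+b2+b3+b4+b5+b6"
    if mem: "a1\<in>A'" "a2\<in>A'" "a3\<in>A'" "a4\<in>A'" "a5\<in>A'" "a6\<in>A'" "b1\<in>A'" "b2\<in>A'" "b3\<in>A'" "b4\<in>A'" "b5\<in>A'" "b6\<in>A'"
      and dvd: "int N dvd r a1+r a2+r a3+r a4+r a5+r a6 - (r b1+r b2+r b3+r b4+r b5+r b6)"
    for a1 a2 a3 a4 a5 a6 b1 b2 b3 b4 b5 b6
  proof (rule ccontr)
    assume neq: "\<not> ?thesis"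
    define x where "x = r a1+r a2+r a3+r a4+r a5+r a6 - (r b1+r b2+r b3+r b4+r b5+r b6)"
    define e where "e = a1+a2+a3+a4+a5+a6 - (b1+b2+b3+b4+b5+b6)"
    have xP: "\<bar>x\<bar> < P"
      using close[OF mem(1) mem(7)] close[OF mem(2) mem(8)] close[OF mem(3) mem(9)]
        close[OF mem(4) mem(10)] close[OF mem(5) mem(11)] close[OF mem(6) mem(12)]
        close[OF mem(7) mem(1)] close[OF mem(8) mem(2)] close[OF mem(9) mem(3)]
        close[OF mem(10) mem(4)] close[OF mem(11) mem(5)] close[OF mem(12) mem(6)]
      unfolding x_def abs_less_iff by (intro conjI) linarith+
    have eD: "e \<in> D" unfolding e_def using mem A'A by (intro memD) auto
    have e0: "e \<noteq> 0" using neq by (simp add: e_def)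
    have "x - q * e = P * (g b1+g b2+g b3+g b4+g b5+g b6 - (g a1+g a2+g a3+g a4+g a5+g a6))"
      unfolding x_def e_def rg by (simp add: algebra_simps)
    then have xmod: "x mod P = (q * e) mod P" by (simp add: mod_eq_dvd_iff)
    \<comment> \<open>Depending on the sign of \<open>x\<close>, the residue of \<open>q * e\<close>
      is \<open>x\<close> or that of \<open>q * (- e)\<close> is \<open>- x\<close>. Either is a
      multiple of \<open>N\<close>, against the choice of \<open>q\<close>.\<close>
    show False
    proof (cases "x \<ge> 0")
      case True
      then have "(q * e) mod P = x" using xmod xP by simp
      then show False using P(2)[OF eD e0] dvd by (simp add: x_def)
    next
      case False
      have "(q * (- e)) mod P = (- x) mod P" using xmod by (metis mod_minus_eq mult_minus_right)
      also have "\<dots> = - x" using False xP by simp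
      finally have "(q * (- e)) mod P = - x" .
      moreover have "int N dvd - x" using dvd unfolding x_def dvd_minus_iff .
      ultimately show False using P(2)[OF symD[OF eD]] e0 by simp
    qed
  qed
  have N0: "N > 0" by (simp add: N_def)
  define B where "B = (\<lambda>a. r a mod int N) ` A'"
  have injB: "inj_on (\<lambda>a. r a mod int N) A'"
  proof (rule inj_onI)
    fix a b assume ab: "a \<in> A'" "b \<in> A'" "r a mod int N = r b mod int N"
    then have "int N dvd r a - r b" by (simp add: mod_eq_dvd_iff)
    then show "a = b" using key[of a a a a a a b a a a a a] ab by simp
  qed
  have cB: "card B = card A'" unfolding B_def using injB by (rule card_image)
  have cA: "card A > 0" using fin ne by (simp add: card_gt_0_iff)
  have A'ne: "card A' > 0" using cA cA' by linarith
  have Bne: "B \<noteq> {}" using A'ne unfolding B_def by auto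
  have Bsub: "B \<subseteq> {0..<int N}" using N0 by (auto simp: B_def)
  obtain \<Gamma> where \<Gamma>: "finite \<Gamma>" "card \<Gamma> * (card B)\<^sup>2 \<le> N\<^sup>2"
    "\<And>t::int. (\<And>r. r \<in> \<Gamma> \<Longrightarrow> cos (2 * pi * real r * real_of_int t / real N) \<ge> 0) \<Longrightarrow>
      \<exists>b1\<in>B. \<exists>b2\<in>B. \<exists>b3\<in>B. \<exists>b4\<in>B. int N dvd b1 + b2 - b3 - b4 - t"
    using bogolyubov_mod[OF N0 Bsub Bne] by metis
  \<comment> \<open>\<open>N \<le> 12 * C * card B\<close> bounds
    \<open>card \<Gamma> \<le> (N / card B)^2\<close> by \<open>144 * C^2\<close>.\<close>
  define k where "k = nat \<lceil>144 * C\<^sup>2\<rceil>"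
  have C2: "C\<^sup>2 \<ge> 1" using C by simp
  have k1: "k \<ge> 1" using C2 unfolding k_def by linarith
  have c\<Gamma>: "card \<Gamma> \<le> k"
  proof -
    have "real N \<le> 2 * C * real (card A)"
    proof -
      have "1 * 1 \<le> C * real (card A)" using C cA by (intro mult_mono) auto
      then show ?thesis using dbl unfolding N_def D_def by simp
    qed
    also have "\<dots> \<le> 2 * C * (6 * real (card B))"
      using cA' C unfolding cB by (intro mult_left_mono) auto
    also have "\<dots> = 12 * C * real (card B)" by simp
    finally have "real N ^ 2 \<le> (12 * C * real (card B)) ^ 2" by (intro power_mono) auto
    moreover have "real (card \<Gamma>) * (real (card B))\<^sup>2 \<le> (real N)\<^sup>2"
      using \<Gamma>(2) by (metis of_nat_le_iff of_nat_mult of_nat_power)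
    ultimately have "real (card \<Gamma>) * (real (card B))\<^sup>2 \<le> (144 * C\<^sup>2) * (real (card B))\<^sup>2"
      by (simp add: power_mult_distrib)
    then have "real (card \<Gamma>) \<le> 144 * C\<^sup>2" using A'ne cB by (simp add: mult_le_cancel_right_pos)
    then show ?thesis unfolding k_def by linarith
  qed
  define z where "z = real (N - 1) powr (1 / real k)"
  \<comment> \<open>The largest integer with \<open>m ^ k \<le> N - 1\<close>, as the box count in
    \<open>dirichlet_mod\<close> requires.\<close>
  define m where "m = nat \<lfloor>z\<rfloor>"
  have AD: "card A \<le> N - 1"
  proof -
    have "card A = card ((\<lambda>a. a - a0) ` A)" by (simp add: card_image inj_on_def)
    also have "\<dots> \<le> card D"
    proof (intro card_mono finD image_subsetI)
      fix a assume "a \<in> A"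
      then show "a - a0 \<in> D" using memD[of a a0 a0 a0 a0 a0 a0 a0 a0 a0 a0 a0] a0 by simp
    qed
    finally show ?thesis by (simp add: N_def)
  qed
  have z1: "z \<ge> 1" unfolding z_def using AD cA by (intro ge_one_powr_ge_zero) auto
  have m1: "m \<ge> 1" using z1 unfolding m_def by linarith
  have mz: "real m \<le> z" "z \<le> real m + 1" using z1 unfolding m_def by linarith+
  have "real m ^ k \<le> z ^ k" using mz by (intro power_mono) auto
  also have "\<dots> = real (N - 1)" unfolding z_def using k1 AD cA by (simp add: powr_realpow[symmetric] powr_powr)
  finally have "m ^ k \<le> N - 1" by (metis of_nat_le_iff of_nat_power)
  then have "m ^ card \<Gamma> < N" using power_increasing[OF c\<Gamma>, of m] m1 N0 by linarith
  then obtain y where y: "0 < y" "y < N"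
    "\<And>r. r \<in> \<Gamma> \<Longrightarrow> \<exists>k::int. \<bar>real r * real y / real N - real_of_int k\<bar> \<le> 1 / real m"
    using dirichlet_mod[OF \<Gamma>(1), of m N] m1 by auto
  \<comment> \<open>For \<open>j \<le> m / 4\<close> the phase of \<open>j * y\<close> stays within
    a quarter period of 0 at every \<open>r \<in> \<Gamma>\<close>, so its cosine is
    nonnegative.\<close>
  define l where "l = m div 4"
  have lm: "4 * l \<le> m" "m \<le> 4 * l + 3" unfolding l_def by linarith+
  have "real (card A) powr (1 / real k) \<le> z" unfolding z_def using AD by (intro powr_mono2) auto
  also have "\<dots> \<le> 4 * (real l + 1)"
  proof -
    have "real m \<le> real (4 * l + 3)" using lm by (simp only: of_nat_le_iff)
    then show ?thesis using mz by simp
  qed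
  finally have bound: "real (card A) powr (1 / real k) \<le> 4 * (real l + 1)" .
  have ex: "\<exists>a1\<in>A'. \<exists>a2\<in>A'. \<exists>a3\<in>A'. \<exists>a4\<in>A'. int N dvd r a1 + r a2 - r a3 - r a4 - int j * int y"
    if j: "j \<le> l" for j :: nat
  proof -
    have "\<exists>b1\<in>B. \<exists>b2\<in>B. \<exists>b3\<in>B. \<exists>b4\<in>B. int N dvd b1 + b2 - b3 - b4 - int j * int y"
    proof (rule \<Gamma>(3))
      fix t assume "t \<in> \<Gamma>"
      then obtain w :: int where w: "\<bar>real t * real y / real N - real_of_int w\<bar> \<le> 1 / real m" using y by blast
      define u where "u = real t * real y / real N - real_of_int w"
      have "\<bar>real j * u\<bar> \<le> real j * (1 / real m)" using w unfolding abs_mult u_def[symmetric] abs_of_nat by (intro mult_left_mono) auto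
      also have "\<dots> \<le> 1 / 4" using j lm m1 by (simp add: field_simps)
      finally have ju: "\<bar>real j * u\<bar> \<le> 1 / 4" .
      have eq: "2 * pi * real t * real_of_int (int j * int y) / real N = 2 * pi * (real j * u) + 2 * pi * real_of_int (int j * w)"
        unfolding u_def by (simp add: algebra_simps)
      have "cos (2 * pi * real t * real_of_int (int j * int y) / real N) = cos (2 * pi * (real j * u))"
        unfolding eq cos_add cos_int_2pin sin_int_2pin by simp
      also have "\<dots> \<ge> 0"
      proof (rule cos_ge_zero)
        have "2 * pi * \<bar>real j * u\<bar> \<le> 2 * pi * (1 / 4)" using ju by (intro mult_left_mono) auto
        then have "\<bar>2 * pi * (real j * u)\<bar> \<le> pi / 2" by (simp add: abs_mult)
        then show "- (pi / 2) \<le> 2 * pi * (real j * u)" "2 * pi * (real j * u) \<le> pi / 2" by linarith+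
      qed
      finally show "cos (2 * pi * real t * real_of_int (int j * int y) / real N) \<ge> 0" .
    qed
    then obtain a1 a2 a3 a4 where a: "a1\<in>A'" "a2\<in>A'" "a3\<in>A'" "a4\<in>A'"
      "int N dvd r a1 mod int N + r a2 mod int N - r a3 mod int N - r a4 mod int N - int j * int y"
      unfolding B_def by blast
    have "(r a1 mod int N + r a2 mod int N - r a3 mod int N - r a4 mod int N - int j * int y) mod int N
        = (r a1 + r a2 - r a3 - r a4 - int j * int y) mod int N"
      by (intro mod_diff_cong mod_add_cong) auto
    then show ?thesis using a by (metis dvd_eq_mod_eq_0)
  qed
  then obtain f1 f2 f3 f4 where f: "\<And>j. j \<le> l \<Longrightarrow> f1 j \<in> A' \<and> f2 j \<in> A' \<and> f3 j \<in> A' \<and> f4 j \<in> A' \<and>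
      int N dvd r (f1 j) + r (f2 j) - r (f3 j) - r (f4 j) - int j * int y"
    by metis
  have fm: "f1 j \<in> A'" "f2 j \<in> A'" "f3 j \<in> A'" "f4 j \<in> A'"
    and fd: "int N dvd r (f1 j) + r (f2 j) - r (f3 j) - r (f4 j) - int j * int y" if "j \<le> l" for j
    by (insert f[OF that], (elim conjE, assumption)+)
  \<comment> \<open>Integer lifts of the residues \<open>j * y\<close>. By \<open>key\<close>,
    congruences between the images force equalities between the lifts, so \<open>e\<close> is linear
    in \<open>j\<close>.\<close>
  define e where "e j = f1 j + f2 j - f3 j - f4 j" for j
  have e_mem: "e j \<in> diffset (nfold_sum 2 A) (nfold_sum 2 A)" if "j \<le> l" for j
  proof -
    have "e j = (f1 j + f2 j) - (f3 j + f4 j)" by (simp add: e_def)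
    moreover have "f1 j + f2 j \<in> nfold_sum 2 A" "f3 j + f4 j \<in> nfold_sum 2 A"
      using fm[OF that] A'A by (auto intro!: nfold_sum_2I)
    ultimately show ?thesis unfolding diffset_def by blast
  qed
  obtain a' where a': "a' \<in> A'" using A'ne by (metis card.empty less_irrefl equals0I)
  show ?thesis
  proof (cases "l = 0")
    \<comment> \<open>Only \<open>j = 0\<close> is claimed here, so any nonzero \<open>v\<close>
      serves; \<open>1\<close> is a default.\<close>
    case True
    have "int 0 * 1 \<in> diffset (nfold_sum 2 A) (nfold_sum 2 A)"
      using a0 unfolding diffset_def by (auto intro: nfold_sum_2I)
    with True show ?thesis using that[of 1 l] bound by (simp add: k_def)
  next
    case False
    \<comment> \<open>If \<open>e 1 = 0\<close>, the combination of residues is a multiple of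
      \<open>P\<close> smaller than \<open>P\<close>, hence 0, and \<open>N\<close> would divide
      \<open>y\<close>, although \<open>0 < y < N\<close>.\<close>
    have e1: "e 1 \<noteq> 0"
    proof
      assume z: "e 1 = 0"
      have f1: "f1 1 \<in> A'" "f2 1 \<in> A'" "f3 1 \<in> A'" "f4 1 \<in> A'"
        and dv: "int N dvd r (f1 1) + r (f2 1) - r (f3 1) - r (f4 1) - int 1 * int y"
        by (insert fm[of 1] fd[of 1] False, (simp only: One_nat_def Suc_le_eq neq0_conv)+)
      define x where "x = r (f1 1) + r (f2 1) - r (f3 1) - r (f4 1)"
      have "x = q * e 1 + P * (g (f3 1) + g (f4 1) - (g (f1 1) + g (f2 1)))"
        unfolding x_def e_def rg by (simp add: algebra_simps)
      then have "P dvd x" using z by simp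
      moreover have "\<bar>x\<bar> < P" using close[OF f1(1) f1(3)] close[OF f1(2) f1(4)] close[OF f1(3) f1(1)] close[OF f1(4) f1(2)] P2
        unfolding x_def abs_less_iff by (intro conjI) linarith+
      ultimately have "x = 0" using zdvd_imp_le[of P "\<bar>x\<bar>"] by auto
      then have "int N dvd int y" using dv by (simp add: x_def)
      then show False using y zdvd_imp_le by fastforce
    qed
    have step: "e (Suc j) = e j + e 1" if "Suc j \<le> l" for j
    proof -
      have j: "j \<le> l" "1 \<le> l" using that by auto
      have "int N dvd (r (f1 (Suc j)) + r (f2 (Suc j)) - r (f3 (Suc j)) - r (f4 (Suc j)) - int (Suc j) * int y)
         - (r (f1 j) + r (f2 j) - r (f3 j) - r (f4 j) - int j * int y)
         - (r (f1 1) + r (f2 1) - r (f3 1) - r (f4 1) - int 1 * int y)"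
        by (rule dvd_diff[OF dvd_diff[OF fd[OF that] fd[OF j(1)]] fd[OF j(2)]])
      also have "\<dots> = r (f1 (Suc j)) + r (f2 (Suc j)) + r (f3 j) + r (f4 j) + r (f3 1) + r (f4 1)
         - (r (f3 (Suc j)) + r (f4 (Suc j)) + r (f1 j) + r (f2 j) + r (f1 1) + r (f2 1))"
        by (simp add: algebra_simps)
      finally have dv: "int N dvd r (f1 (Suc j)) + r (f2 (Suc j)) + r (f3 j) + r (f4 j) + r (f3 1) + r (f4 1)
         - (r (f3 (Suc j)) + r (f4 (Suc j)) + r (f1 j) + r (f2 j) + r (f1 1) + r (f2 1))" .
      have "f1 (Suc j) + f2 (Suc j) + f3 j + f4 j + f3 1 + f4 1
         = f3 (Suc j) + f4 (Suc j) + f1 j + f2 j + f1 1 + f2 1"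
        by (rule key[OF fm(1)[OF that] fm(2)[OF that] fm(3)[OF j(1)] fm(4)[OF j(1)] fm(3)[OF j(2)] fm(4)[OF j(2)]
              fm(3)[OF that] fm(4)[OF that] fm(1)[OF j(1)] fm(2)[OF j(1)] fm(1)[OF j(2)] fm(2)[OF j(2)] dv])
      then show ?thesis by (simp add: e_def)
    qed
    have e0: "e 0 = 0"
    proof -
      have "int N dvd r (f1 0) + r (f2 0) + r a' + r a' + r a' + r a' - (r (f3 0) + r (f4 0) + r a' + r a' + r a' + r a')"
      proof -
        have "r (f1 0) + r (f2 0) + r a' + r a' + r a' + r a' - (r (f3 0) + r (f4 0) + r a' + r a' + r a' + r a')
          = r (f1 0) + r (f2 0) - r (f3 0) - r (f4 0) - int 0 * int y" by simp
        then show ?thesis using fd[OF le0] by (simp only:)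
      qed
      then have "f1 0 + f2 0 + a' + a' + a' + a' = f3 0 + f4 0 + a' + a' + a' + a'"
        by (rule key[OF fm(1)[OF le0] fm(2)[OF le0] a' a' a' a' fm(3)[OF le0] fm(4)[OF le0] a' a' a' a'])
      then show ?thesis by (simp add: e_def)
    qed
    have "e j = int j * e 1" if "j \<le> l" for j using that
    proof (induction j)
      case (Suc j)
      then have "e (Suc j) = int j * e 1 + e 1" using step[OF Suc.prems] by (simp only: Suc_leD)
      then show ?case by (simp only: of_nat_Suc distrib_right mult_1_left add.commute)
    qed (simp add: e0)
    then show ?thesis using that[of "e 1" l] e1 bound e_mem by (simp add: k_def)
  qed
qed

section \<open>The Brunn--Minkowski inequality for unions of boxes\<close>

lemma powr_inverse_power:
  assumes "x \<ge> 0" "d > 0" shows "(x powr (1 / real d)) ^ d = x"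
  using assms by (cases "x = 0") (auto simp: powr_powr powr_realpow[symmetric])

text \<open>Divide by the right side and apply the arithmetic-geometric mean inequality to the
  ratios \<open>u i / (u i + v i)\<close> and \<open>v i / (u i + v i)\<close>; the two arithmetic
  means add up to 1.\<close>

lemma prod_add_ge_power:
  fixes u v :: "'i \<Rightarrow> real"
  assumes I: "finite I" "I \<noteq> {}" and uv: "\<And>i. i \<in> I \<Longrightarrow> u i > 0" "\<And>i. i \<in> I \<Longrightarrow> v i > 0"
  shows "((\<Prod>i\<in>I. u i) powr (1 / real (card I)) + (\<Prod>i\<in>I. v i) powr (1 / real (card I))) ^ card I
    \<le> (\<Prod>i\<in>I. u i + v i)"
proof -
  define d where "d = card I"
  have d: "d > 0" using I by (simp add: d_def card_gt_0_iff)
  define W where "W = (\<Prod>i\<in>I. u i + v i)"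
  have W: "W > 0" unfolding W_def using uv by (intro prod_pos) (auto intro: add_pos_pos)
  have amgm: "(\<Prod>i\<in>I. x i) powr (1 / real d) \<le> (\<Sum>i\<in>I. x i) / real d"
    if "\<And>i. i \<in> I \<Longrightarrow> x i > 0" for x :: "'i \<Rightarrow> real"
  proof -
    show ?thesis using arith_geom_mean[OF I(1) I(2), of x] that
      unfolding d_def by (simp add: less_imp_le sum_divide_distrib)
  qed
  have split: "(\<Prod>i\<in>I. x i) powr (1 / real d) = (\<Prod>i\<in>I. x i / (u i + v i)) powr (1 / real d) * W powr (1 / real d)"
    if "\<And>i. i \<in> I \<Longrightarrow> x i > 0" for x
  proof -
    have "(\<Prod>i\<in>I. x i) = (\<Prod>i\<in>I. x i / (u i + v i)) * W"
      unfolding W_def prod.distrib[symmetric] using uv by (intro prod.cong) (auto simp: add_pos_pos less_imp_neq[symmetric])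
    moreover have "(\<Prod>i\<in>I. x i / (u i + v i)) \<ge> 0" using uv that by (intro prod_nonneg) (auto simp: add_pos_pos less_imp_le)
    ultimately show ?thesis using W by (simp add: powr_mult)
  qed
  have "(\<Prod>i\<in>I. u i / (u i + v i)) powr (1 / real d) + (\<Prod>i\<in>I. v i / (u i + v i)) powr (1 / real d)
      \<le> (\<Sum>i\<in>I. u i / (u i + v i)) / real d + (\<Sum>i\<in>I. v i / (u i + v i)) / real d"
    using uv by (intro add_mono amgm) (auto simp: add_pos_pos)
  also have "\<dots> = (\<Sum>i\<in>I. u i / (u i + v i) + v i / (u i + v i)) / real d"
    by (simp add: sum.distrib add_divide_distrib)
  also have "(\<Sum>i\<in>I. u i / (u i + v i) + v i / (u i + v i)) = (\<Sum>i\<in>I. 1)"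
  proof (intro sum.cong refl)
    fix i assume "i \<in> I"
    then have "u i + v i > 0" using uv by (simp add: add_pos_pos)
    then show "u i / (u i + v i) + v i / (u i + v i) = 1" by (simp add: add_divide_distrib[symmetric])
  qed
  also have "(\<Sum>i\<in>I. 1) / real d = (1::real)" using d by (simp add: d_def)
  finally have "((\<Prod>i\<in>I. u i / (u i + v i)) powr (1 / real d) + (\<Prod>i\<in>I. v i / (u i + v i)) powr (1 / real d)) * W powr (1 / real d)
      \<le> 1 * W powr (1 / real d)" by (intro mult_right_mono) auto
  then have "(\<Prod>i\<in>I. u i) powr (1 / real d) + (\<Prod>i\<in>I. v i) powr (1 / real d) \<le> W powr (1 / real d)"
    using split[of u] split[of v] uv by (simp add: distrib_right)
  then have "((\<Prod>i\<in>I. u i) powr (1 / real d) + (\<Prod>i\<in>I. v i) powr (1 / real d)) ^ d \<le> (W powr (1 / real d)) ^ d"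
    by (intro power_mono) auto
  then show ?thesis using W d unfolding d_def W_def by (simp add: powr_inverse_power less_imp_le)
qed

lemma measure_box_cart:
  fixes a b :: "real^'n" assumes "\<And>i. a $ i \<le> b $ i"
  shows "measure lebesgue (box a b) = (\<Prod>i\<in>UNIV. b $ i - a $ i)"
proof -
  have "measure lebesgue (box a b) = measure lborel (cbox a b)"
    by (simp add: measure_lborel_box_eq measure_lborel_cbox_eq)
  also have "a \<in> cbox a b" using assms by (simp add: mem_box_cart)
  then have "cbox a b \<noteq> {}" by blast
  then have "measure lborel (cbox a b) = (\<Prod>i\<in>UNIV. b $ i - a $ i)" by (rule content_cbox_cart)
  finally show ?thesis .
qed

lemma box_ne_empty_cart: "box a (b::real^'n) \<noteq> {} \<longleftrightarrow> (\<forall>i. a $ i < b $ i)"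
proof
  assume "box a b \<noteq> {}"
  then show "\<forall>i. a $ i < b $ i" by (auto simp: mem_box_cart) (meson less_trans)
next
  assume "\<forall>i. a $ i < b $ i"
  then have "(\<chi> i. (a $ i + b $ i) / 2) \<in> box a b" by (auto simp: mem_box_cart)
  then show "box a b \<noteq> {}" by blast
qed

text \<open>With open boxes a hyperplane cut again leaves open boxes, at the cost of a null set
  only. Excluding \<open>{}\<close> gives every member positive volume and makes the number of boxes
  a meaningful induction measure.\<close>

definition box_family :: "(real^'n) set set \<Rightarrow> bool" where
  "box_family \<A> \<longleftrightarrow> finite \<A> \<and> \<A> \<noteq> {} \<and> {} \<notin> \<A> \<and> pairwise disjnt \<A> \<and> (\<forall>P\<in>\<A>. \<exists>a b. P = box a b)"

lemma box_familyD:
  assumes "box_family \<A>" "P \<in> \<A>" shows "P \<noteq> {}" "\<exists>a b. P = box a b"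
  using assms unfolding box_family_def by blast+

lemma box_family_open_bounded:
  assumes "box_family \<A>" shows "open (\<Union>\<A>)" "bounded (\<Union>\<A>)" "\<Union>\<A> \<in> lmeasurable"
proof -
  show 1: "open (\<Union>\<A>)" using assms unfolding box_family_def by (metis open_Union open_box)
  show 2: "bounded (\<Union>\<A>)" using assms unfolding box_family_def by (metis bounded_Union bounded_box)
  show "\<Union>\<A> \<in> lmeasurable" using 1 2 by (simp add: lmeasurable_open)
qed

lemma measure_box_family:
  assumes "box_family \<A>" shows "measure lebesgue (\<Union>\<A>) = (\<Sum>P\<in>\<A>. measure lebesgue P)"
  using assms unfolding box_family_def
  by (intro measure_Union') (auto simp: lmeasurable_open)

lemma measure_box_family_pos:
  assumes "box_family \<A>" shows "measure lebesgue (\<Union>\<A>) > 0"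
proof -
  have "measure lebesgue P > 0" if P: "P \<in> \<A>" for P
  proof -
    obtain a b where ab: "P = box a b" "P \<noteq> {}" using box_familyD[OF assms P] by blast
    then have "\<forall>i. a $ i < b $ i" using box_ne_empty_cart by blast
    then show ?thesis unfolding ab by (subst measure_box_cart) (auto simp: less_imp_le intro!: prod_pos)
  qed
  then show ?thesis unfolding measure_box_family[OF assms]
    using assms by (intro sum_pos) (auto simp: box_family_def)
qed

text \<open>Empty pieces are discarded so that the count drops whenever some box lies wholly on the
  other side of the cut.\<close>

definition upper_part :: "'n \<Rightarrow> real \<Rightarrow> (real^'n) set set \<Rightarrow> (real^'n) set set" where
  "upper_part k c \<A> = (\<lambda>P. P \<inter> {x. x $ k > c}) ` \<A> - {{}}"

definition lower_part :: "'n \<Rightarrow> real \<Rightarrow> (real^'n) set set \<Rightarrow> (real^'n) set set" where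
  "lower_part k c \<A> = (\<lambda>P. P \<inter> {x. x $ k < c}) ` \<A> - {{}}"

lemma Union_parts:
  "\<Union>(upper_part k c \<A>) = \<Union>\<A> \<inter> {x. x $ k > c}" "\<Union>(lower_part k c \<A>) = \<Union>\<A> \<inter> {x. x $ k < c}"
  unfolding upper_part_def lower_part_def by auto

lemma box_Int_upper:
  "box a b \<inter> {x. x $ k > c} = box (\<chi> i. if i = k then max (a $ i) c else a $ i) (b::real^'n)"
  by (auto simp: mem_box_cart split: if_splits)

lemma box_Int_lower:
  "box a b \<inter> {x. x $ k < c} = box a (\<chi> i. if i = k then min (b $ i) c else b $ i :: real^'n)"
  by (auto simp: mem_box_cart split: if_splits)

lemma box_family_parts:
  assumes "box_family \<A>"
  shows "upper_part k c \<A> \<noteq> {} \<Longrightarrow> box_family (upper_part k c \<A>)"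
    "lower_part k c \<A> \<noteq> {} \<Longrightarrow> box_family (lower_part k c \<A>)"
proof -
  have *: "box_family (f ` \<A> - {{}})" if ne: "f ` \<A> - {{}} \<noteq> {}" and sub: "\<And>P. f P \<subseteq> P"
    and bx: "\<And>a b. \<exists>a' b'. f (box a b) = box a' b'" for f :: "(real^'a) set \<Rightarrow> (real^'a) set"
    unfolding box_family_def
  proof (intro conjI ballI)
    show "finite (f ` \<A> - {{}})" using assms by (simp add: box_family_def)
    show "pairwise disjnt (f ` \<A> - {{}})"
    proof (rule pairwiseI)
      fix P Q assume "P \<in> f ` \<A> - {{}}" "Q \<in> f ` \<A> - {{}}" "P \<noteq> Q"
      then obtain P' Q' where PQ: "P' \<in> \<A>" "Q' \<in> \<A>" "P = f P'" "Q = f Q'" "P' \<noteq> Q'" by blast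
      then have "disjnt P' Q'" using assms unfolding box_family_def by (meson pairwiseD)
      then show "disjnt P Q" using PQ sub by (metis disjnt_subset1 disjnt_subset2)
    qed
    fix P assume "P \<in> f ` \<A> - {{}}"
    then obtain P' where P': "P' \<in> \<A>" "P = f P'" by blast
    then obtain a b where "P' = box a b" using assms unfolding box_family_def by blast
    then show "\<exists>a b. P = box a b" using P' bx by metis
  qed (use ne in auto)
  show "upper_part k c \<A> \<noteq> {} \<Longrightarrow> box_family (upper_part k c \<A>)"
    unfolding upper_part_def by (rule *) (auto simp: box_Int_upper)
  show "lower_part k c \<A> \<noteq> {} \<Longrightarrow> box_family (lower_part k c \<A>)"
    unfolding lower_part_def by (rule *) (auto simp: box_Int_lower)
qed

lemma card_parts_le:
  assumes "finite \<A>"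
  shows "card (upper_part k c \<A>) \<le> card \<A>" "card (lower_part k c \<A>) \<le> card \<A>"
proof -
  have *: "card (f ` \<A> - {{}}) \<le> card \<A>" for f :: "(real^'a) set \<Rightarrow> (real^'a) set"
    by (rule order_trans[OF card_mono[of "f ` \<A>"] card_image_le]) (use assms in auto)
  show "card (upper_part k c \<A>) \<le> card \<A>" "card (lower_part k c \<A>) \<le> card \<A>"
    unfolding upper_part_def lower_part_def by (rule *)+
qed

lemma card_parts_less:
  assumes "finite \<A>" "P \<in> \<A>"
  shows "P \<inter> {x. x $ k > c} = {} \<Longrightarrow> card (upper_part k c \<A>) < card \<A>"
    "P \<inter> {x. x $ k < c} = {} \<Longrightarrow> card (lower_part k c \<A>) < card \<A>"
proof -
  have *: "card (f ` \<A> - {{}}) < card \<A>" if "f P = {}" for f :: "(real^'a) set \<Rightarrow> (real^'a) set"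
  proof -
    have "f ` \<A> - {{}} \<subseteq> f ` (\<A> - {P})" using that by auto
    then have "card (f ` \<A> - {{}}) \<le> card (f ` (\<A> - {P}))" using assms by (intro card_mono) auto
    also have "\<dots> \<le> card (\<A> - {P})" using assms by (intro card_image_le) auto
    also have "\<dots> < card \<A>" using assms by (intro psubset_card_mono) auto
    finally show ?thesis .
  qed
  show "P \<inter> {x. x $ k > c} = {} \<Longrightarrow> card (upper_part k c \<A>) < card \<A>"
    "P \<inter> {x. x $ k < c} = {} \<Longrightarrow> card (lower_part k c \<A>) < card \<A>"
    unfolding upper_part_def lower_part_def by (rule *, simp)+
qed

lemma measure_Un2_disj:
  assumes "S \<in> lmeasurable" "T \<in> lmeasurable" "disjnt S T"
  shows "measure lebesgue (S \<union> T) = measure lebesgue S + measure lebesgue T"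
  using measure_Un3[OF assms(1,2)] assms(3) by (simp add: disjnt_def)

lemma measure_parts:
  fixes S :: "(real^'n) set"
  assumes "open S" "bounded S"
  shows "measure lebesgue S = measure lebesgue (S \<inter> {x. x $ k > c}) + measure lebesgue (S \<inter> {x. x $ k < c})"
proof -
  have op: "open (S \<inter> {x. x $ k > c})" "open (S \<inter> {x. x $ k < c})"
    using assms by (auto intro!: open_Int open_halfspace_component_gt_cart open_halfspace_component_lt_cart)
  have bd: "bounded (S \<inter> {x. x $ k > c})" "bounded (S \<inter> {x. x $ k < c})"
    using assms by (auto intro: bounded_subset)
  have lm: "S \<inter> {x. x $ k > c} \<in> lmeasurable" "S \<inter> {x. x $ k < c} \<in> lmeasurable" "S \<in> lmeasurable"
    using op bd assms by (auto intro: lmeasurable_open)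
  have "negligible {x::real^'n. x $ k = c}"
    using negligible_standard_hyperplane[of "axis k (1::real) :: real^'n" c]
    by (simp add: axis_in_Basis_iff cart_eq_inner_axis inner_commute)
  then have "negligible ((S \<inter> {x. x $ k > c} \<union> S \<inter> {x. x $ k < c}) - S \<union> (S - (S \<inter> {x. x $ k > c} \<union> S \<inter> {x. x $ k < c})))"
    by (rule negligible_subset) auto
  then have "measure lebesgue S = measure lebesgue (S \<inter> {x. x $ k > c} \<union> S \<inter> {x. x $ k < c})"
    using lm by (intro measure_negligible_symdiff) auto
  also have "\<dots> = measure lebesgue (S \<inter> {x. x $ k > c}) + measure lebesgue (S \<inter> {x. x $ k < c})"
    using lm by (intro measure_Un2_disj) (auto simp: disjnt_def)
  finally show ?thesis .
qed

text \<open>Prepares the intermediate value theorem, which finds the cut of the second family with a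
  prescribed volume ratio.\<close>

lemma continuous_measure_upper:
  assumes "box_family \<A>"
  shows "continuous_on UNIV (\<lambda>t. measure lebesgue (\<Union>\<A> \<inter> {x. x $ k > t}))"
proof -
  have fin: "finite \<A>" using assms by (simp add: box_family_def)
  have "measure lebesgue (\<Union>\<A> \<inter> {x. x $ k > t}) = (\<Sum>P\<in>\<A>. measure lebesgue (P \<inter> {x. x $ k > t}))" for t
  proof -
    have "\<Union>\<A> \<inter> {x. x $ k > t} = (\<Union>P\<in>\<A>. P \<inter> {x. x $ k > t})" by auto
    also have "measure lebesgue \<dots> = (\<Sum>P\<in>\<A>. measure lebesgue (P \<inter> {x. x $ k > t}))"
    proof (rule measure_UNION'[OF fin])
      fix P assume "P \<in> \<A>"
      then obtain a b where "P = box a b" using assms unfolding box_family_def by blast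
      then show "P \<inter> {x. x $ k > t} \<in> lmeasurable" by (simp add: box_Int_upper lmeasurable_open)
    next
      have "pairwise disjnt \<A>" using assms by (simp add: box_family_def)
      then show "pairwise (\<lambda>P Q. disjnt (P \<inter> {x. x $ k > t}) (Q \<inter> {x. x $ k > t})) \<A>"
        by (rule pairwise_mono) (auto simp: disjnt_def)
    qed
    finally show ?thesis .
  qed
  moreover have "continuous_on UNIV (\<lambda>t. measure lebesgue (P \<inter> {x. x $ k > t}))" if P: "P \<in> \<A>" for P
  proof -
    obtain a b where ab: "P = box a b" "P \<noteq> {}" using box_familyD[OF assms P] by blast
    then have less: "\<And>i. a $ i < b $ i" using box_ne_empty_cart by blast
    \<comment> \<open>Clamping \<open>t\<close> to the side of the box from both ends gives one
      formula valid for all \<open>t\<close>, visibly continuous.\<close>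
    have "measure lebesgue (P \<inter> {x. x $ k > t}) = (\<Prod>i\<in>UNIV-{k}. b $ i - a $ i) * (b $ k - min (b $ k) (max (a $ k) t))" for t
    proof (cases "max (a $ k) t \<le> b $ k")
      case True
      then have "measure lebesgue (P \<inter> {x. x $ k > t}) = (\<Prod>i\<in>UNIV. b $ i - (if i = k then max (a $ i) t else a $ i))"
      proof -
        have "(\<chi> i. if i = k then max (a $ i) t else a $ i) $ i \<le> b $ i" for i
          using less[of i] True by (simp add: less_imp_le)
        then show ?thesis unfolding ab(1) box_Int_upper by (simp only: measure_box_cart vec_lambda_beta)
      qed
      also have "\<dots> = (b $ k - max (a $ k) t) * (\<Prod>i\<in>UNIV-{k}. b $ i - (if i = k then max (a $ i) t else a $ i))"
        by (subst prod.remove[of _ k]) auto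
      also have "(\<Prod>i\<in>UNIV-{k}. b $ i - (if i = k then max (a $ i) t else a $ i)) = (\<Prod>i\<in>UNIV-{k}. b $ i - a $ i)"
        by (intro prod.cong) auto
      finally show ?thesis using True by (simp only: min_absorb2 mult.commute)
    next
      case False
      have "P \<inter> {x. x $ k > t} = {}"
      proof (rule equals0I)
        fix x assume "x \<in> P \<inter> {x. x $ k > t}"
        then have "a $ k < x $ k" "x $ k < b $ k" "t < x $ k" by (auto simp: ab mem_box_cart)
        then show False using False by simp
      qed
      moreover have "min (b $ k) (max (a $ k) t) = b $ k" using False by (intro min_absorb1) linarith
      ultimately show ?thesis by (simp only: measure_empty diff_self mult_zero_right)
    qed
    moreover have "continuous_on UNIV (\<lambda>t. (\<Prod>i\<in>UNIV-{k}. b $ i - a $ i) * (b $ k - min (b $ k) (max (a $ k) t)))"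
      by (intro continuous_intros)
    ultimately show ?thesis by (simp only:)
  qed
  then have "continuous_on UNIV (\<lambda>t. \<Sum>P\<in>\<A>. measure lebesgue (P \<inter> {x. x $ k > t}))"
    by (intro continuous_on_sum)
  ultimately show ?thesis by (simp only:)
qed

lemma sumset_lmeasurable:
  fixes A B :: "(real^'n) set"
  assumes "open A" "bounded A" "bounded B"
  shows "sumset A B \<in> lmeasurable"
proof -
  have "sumset A B = (\<Union>x\<in>A. \<Union>y\<in>B. {x + y})" by (auto simp: sumset_def)
  then show ?thesis using assms open_sums[of A B] bounded_sums[of A B] by (simp add: lmeasurable_open)
qed

lemma brunn_minkowski_box:
  fixes a b c e :: "real^'n"
  assumes "\<And>i. a $ i < b $ i" "\<And>i. c $ i < e $ i"
  shows "(measure lebesgue (box a b) powr (1 / real CARD('n)) + measure lebesgue (box c e) powr (1 / real CARD('n))) ^ CARD('n)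
    \<le> measure lebesgue (sumset (box a b) (box c e))"
proof -
  have sub: "box (a + c) (b + e) \<subseteq> sumset (box a b) (box c e)"
  proof
    fix x assume x: "x \<in> box (a + c) (b + e)"
    \<comment> \<open>The relative position of \<open>x\<close> in the \<open>i\<close>-th side of
      the sum box; both summands are placed at this same relative position in their own
      boxes.\<close>
    define s where "s i = (x $ i - a $ i - c $ i) / (b $ i + e $ i - a $ i - c $ i)" for i
    define y where "y = (\<chi> i. a $ i + s i * (b $ i - a $ i))"
    define z where "z = (\<chi> i. c $ i + s i * (e $ i - c $ i))"
    have den: "b $ i + e $ i - a $ i - c $ i > 0" for i using assms(1)[of i] assms(2)[of i] by linarith
    have xi: "a $ i + c $ i < x $ i" "x $ i < b $ i + e $ i" for i using x by (auto simp: mem_box_cart)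
    have s0: "0 < s i" for i unfolding s_def using xi[of i] den[of i] by (intro divide_pos_pos) linarith+
    have s1: "s i < 1" for i unfolding s_def divide_less_eq_1_pos[OF den] using xi[of i] by linarith
    have between: "0 < s i * t" "s i * t < t" if "t > 0" for i t
      using mult_pos_pos[OF s0[of i] that] mult_strict_right_mono[OF s1[of i] that] by simp_all
    have "y \<in> box a b" unfolding mem_box_cart y_def vec_lambda_beta
    proof (intro allI conjI)
      fix i
      show "a $ i < a $ i + s i * (b $ i - a $ i)" "a $ i + s i * (b $ i - a $ i) < b $ i"
        using between[of "b $ i - a $ i" i] assms(1)[of i] by linarith+
    qed
    moreover have "z \<in> box c e" unfolding mem_box_cart z_def vec_lambda_beta
    proof (intro allI conjI)
      fix i
      show "c $ i < c $ i + s i * (e $ i - c $ i)" "c $ i + s i * (e $ i - c $ i) < e $ i"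
        using between[of "e $ i - c $ i" i] assms(2)[of i] by linarith+
    qed
    moreover have "x = y + z"
    proof (subst vec_eq_iff, intro allI)
      fix i
      have "s i * (b $ i + e $ i - a $ i - c $ i) = x $ i - a $ i - c $ i"
        unfolding s_def using den[of i] by (intro nonzero_eq_divide_eq[THEN iffD1, OF _ refl]) simp
      moreover have "s i * (b $ i - a $ i) + s i * (e $ i - c $ i) = s i * (b $ i + e $ i - a $ i - c $ i)"
        by (simp add: algebra_simps)
      ultimately show "x $ i = (y + z) $ i" unfolding y_def z_def vector_add_component vec_lambda_beta by linarith
    qed
    ultimately show "x \<in> sumset (box a b) (box c e)" by (metis sumsetI)
  qed
  have "((\<Prod>i\<in>UNIV. b $ i - a $ i) powr (1 / real CARD('n)) + (\<Prod>i\<in>UNIV. e $ i - c $ i) powr (1 / real CARD('n))) ^ CARD('n)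
     \<le> (\<Prod>i\<in>UNIV. (b $ i - a $ i) + (e $ i - c $ i))"
    by (rule prod_add_ge_power) (simp_all add: assms)
  also have "\<dots> = measure lebesgue (box (a + c) (b + e))"
  proof (subst measure_box_cart)
    show "(a + c) $ i \<le> (b + e) $ i" for i using assms[of i] by (simp add: add_mono less_imp_le)
  qed (intro prod.cong refl, simp)
  also have "\<dots> \<le> measure lebesgue (sumset (box a b) (box c e))"
    by (rule measure_mono_fmeasurable[OF sub]) (auto intro!: sumset_lmeasurable open_box bounded_box)
  finally show ?thesis
    using assms by (simp only: measure_box_cart less_imp_le)
qed

text \<open>
  Hadwiger and Ohmann: a coordinate hyperplane separating two boxes of the first family splits it into
  smaller families; cut the second family by a parallel hyperplane in the same volume ratio.
\<close>

lemma brunn_minkowski_split: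
  fixes \<A> \<B> :: "(real^'n) set set"
  assumes A: "box_family \<A>" and B: "box_family \<B>" and c2: "card \<A> \<ge> 2"
    and IH: "\<And>\<A>' \<B>' :: (real^'n) set set. box_family \<A>' \<Longrightarrow> box_family \<B>' \<Longrightarrow>
      card \<A>' < card \<A> \<Longrightarrow> card \<B>' \<le> card \<B> \<Longrightarrow>
      (measure lebesgue (\<Union>\<A>') powr (1 / real CARD('n)) + measure lebesgue (\<Union>\<B>') powr (1 / real CARD('n))) ^ CARD('n)
        \<le> measure lebesgue (sumset (\<Union>\<A>') (\<Union>\<B>'))"
  shows "(measure lebesgue (\<Union>\<A>) powr (1 / real CARD('n)) + measure lebesgue (\<Union>\<B>) powr (1 / real CARD('n))) ^ CARD('n)
        \<le> measure lebesgue (sumset (\<Union>\<A>) (\<Union>\<B>))"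
proof -
  define r where "r = 1 / real CARD('n)"
  have finA: "finite \<A>" and finB: "finite \<B>" using A B by (auto simp: box_family_def)
  obtain P Q where PQ: "P \<in> \<A>" "Q \<in> \<A>" "P \<noteq> Q"
    using c2 by (metis card_le_Suc0_iff_eq finA not_less_eq_eq numeral_2_eq_2)
  obtain a b where P: "P = box a b" "\<forall>i. a $ i < b $ i"
    using box_familyD[OF A PQ(1)] box_ne_empty_cart by metis
  obtain a' b' where Q: "Q = box a' b'" "\<forall>i. a' $ i < b' $ i"
    using box_familyD[OF A PQ(2)] box_ne_empty_cart by metis
  have "P \<inter> Q = {}" using A PQ unfolding box_family_def pairwise_def disjnt_def by blast
  then obtain k where k: "b $ k \<le> a' $ k \<or> b' $ k \<le> a $ k"
    unfolding P Q disjoint_interval_cart using P(2) Q(2) by (meson leD)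
  obtain c P1 P2 where c: "P1 \<in> \<A>" "P2 \<in> \<A>" "P1 \<subseteq> {x. x $ k < c}" "P2 \<subseteq> {x. x $ k > c}"
  proof (cases "b $ k \<le> a' $ k")
    case True
    show ?thesis
      using True P Q PQ by (intro that[of P Q "b $ k"]) (auto simp: mem_box_cart intro: order.strict_trans1)
  next
    case False
    then have "b' $ k \<le> a $ k" using k by simp
    then show ?thesis
      using P Q PQ by (intro that[of Q P "b' $ k"]) (auto simp: mem_box_cart intro: order.strict_trans1)
  qed
  have ne: "P1 \<noteq> {}" "P2 \<noteq> {}" using A c by (auto simp: box_family_def)
  define Au where "Au = upper_part k c \<A>"
  define Al where "Al = lower_part k c \<A>"
  have "P2 \<inter> {x. x $ k > c} \<noteq> {}" using ne c by auto
  then have "Au \<noteq> {}" unfolding Au_def upper_part_def using c(2) by blast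
  then have Au: "box_family Au" unfolding Au_def using A by (intro box_family_parts)
  have "P1 \<inter> {x. x $ k < c} \<noteq> {}" using ne c by auto
  then have "Al \<noteq> {}" unfolding Al_def lower_part_def using c(1) by blast
  then have Al: "box_family Al" unfolding Al_def using A by (intro box_family_parts)
  have "P1 \<inter> {x. x $ k > c} = {}" "P2 \<inter> {x. x $ k < c} = {}" using c by force+
  then have cardA: "card Au < card \<A>" "card Al < card \<A>"
    unfolding Au_def Al_def using card_parts_less[OF finA] c by blast+
  define \<alpha> where "\<alpha> = measure lebesgue (\<Union>\<A>)"
  define \<beta> where "\<beta> = measure lebesgue (\<Union>\<B>)"
  have \<alpha>: "\<alpha> > 0" and \<beta>: "\<beta> > 0" using measure_box_family_pos A B by (auto simp: \<alpha>_def \<beta>_def)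
  define \<theta> where "\<theta> = measure lebesgue (\<Union>Au) / \<alpha>"
  have sumA: "\<alpha> = measure lebesgue (\<Union>Au) + measure lebesgue (\<Union>Al)"
    unfolding \<alpha>_def Au_def Al_def Union_parts using box_family_open_bounded[OF A] by (intro measure_parts)
  have Aupos: "measure lebesgue (\<Union>Au) > 0" "measure lebesgue (\<Union>Al) > 0" using measure_box_family_pos Au Al by auto
  have mAu: "measure lebesgue (\<Union>Au) = \<theta> * \<alpha>" using \<alpha> by (simp add: \<theta>_def)
  have mAl: "measure lebesgue (\<Union>Al) = (1 - \<theta>) * \<alpha>" using sumA mAu by (simp add: algebra_simps)
  have \<theta>: "0 < \<theta>" "\<theta> < 1"
    using Aupos \<alpha> unfolding mAu mAl by (auto simp: zero_less_mult_iff)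
  define h where "h t = measure lebesgue (\<Union>\<B> \<inter> {x. x $ k > t})" for t
  obtain M where M: "\<And>x. x \<in> \<Union>\<B> \<Longrightarrow> norm x \<le> M" "M > 0"
    using box_family_open_bounded(2)[OF B] bounded_pos by metis
  have Mk: "\<bar>x $ k\<bar> \<le> M" if "x \<in> \<Union>\<B>" for x using M(1)[OF that] component_le_norm_cart[of x k] by linarith
  have "\<Union>\<B> \<inter> {x. x $ k > - M - 1} = \<Union>\<B>" "\<Union>\<B> \<inter> {x. x $ k > M} = {}" using Mk by fastforce+
  then have hM: "h (- M - 1) = \<beta>" "h M = 0" unfolding h_def \<beta>_def by simp_all
  have "\<exists>t. - M - 1 \<le> t \<and> t \<le> M \<and> h t = \<theta> * \<beta>"
  proof (rule IVT2')
    show "continuous_on {- M - 1..M} h" unfolding h_def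
      using continuous_measure_upper[OF B] continuous_on_subset by blast
  qed (use hM \<theta> \<beta> M in \<open>auto simp: mult_le_cancel_right1\<close>)
  then obtain t where t: "h t = \<theta> * \<beta>" by blast
  define Bu where "Bu = upper_part k t \<B>"
  define Bl where "Bl = lower_part k t \<B>"
  have sumB: "\<beta> = measure lebesgue (\<Union>Bu) + measure lebesgue (\<Union>Bl)"
    unfolding \<beta>_def Bu_def Bl_def Union_parts using box_family_open_bounded[OF B] by (intro measure_parts)
  have mBu: "measure lebesgue (\<Union>Bu) = \<theta> * \<beta>" using t unfolding h_def Bu_def Union_parts .
  have mBl: "measure lebesgue (\<Union>Bl) = (1 - \<theta>) * \<beta>" using sumB mBu by (simp add: algebra_simps)
  have "\<Union>Bu \<noteq> {}" using mBu \<theta> \<beta> by (metis less_numeral_extra(3) measure_empty mult_pos_pos)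
  then have Bu: "box_family Bu" unfolding Bu_def using B by (intro box_family_parts) auto
  have "\<Union>Bl \<noteq> {}" using mBl \<theta> \<beta> by (metis diff_gt_0_iff_gt less_numeral_extra(3) measure_empty mult_pos_pos)
  then have Bl: "box_family Bl" unfolding Bl_def using B by (intro box_family_parts) auto
  have cardB: "card Bu \<le> card \<B>" "card Bl \<le> card \<B>" unfolding Bu_def Bl_def using card_parts_le finB by auto
  \<comment> \<open>Homogeneity of degree 1: since both families are cut in the same ratio, the two
    lower bounds add up exactly to that for the whole.\<close>
  have scale: "((s * \<alpha>) powr r + (s * \<beta>) powr r) ^ CARD('n) = s * (\<alpha> powr r + \<beta> powr r) ^ CARD('n)" if "s > 0" for s
  proof -
    have "(s * \<alpha>) powr r + (s * \<beta>) powr r = s powr r * (\<alpha> powr r + \<beta> powr r)"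
      using that \<alpha> \<beta> by (simp add: powr_mult algebra_simps)
    moreover have "(s powr r) ^ CARD('n) = s" unfolding r_def using that by (intro powr_inverse_power) auto
    ultimately show ?thesis by (simp add: power_mult_distrib)
  qed
  have "\<theta> * (\<alpha> powr r + \<beta> powr r) ^ CARD('n) \<le> measure lebesgue (sumset (\<Union>Au) (\<Union>Bu))"
    using IH[OF Au Bu cardA(1) cardB(1)] scale[OF \<theta>(1)] unfolding mAu mBu r_def by simp
  moreover have "(1 - \<theta>) * (\<alpha> powr r + \<beta> powr r) ^ CARD('n) \<le> measure lebesgue (sumset (\<Union>Al) (\<Union>Bl))"
    using IH[OF Al Bl cardA(2) cardB(2)] scale[of "1 - \<theta>"] \<theta> unfolding mAl mBl r_def by simp
  ultimately have "(\<alpha> powr r + \<beta> powr r) ^ CARD('n) \<le> measure lebesgue (sumset (\<Union>Au) (\<Union>Bu)) + measure lebesgue (sumset (\<Union>Al) (\<Union>Bl))"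
    by (simp add: algebra_simps)
  \<comment> \<open>The partial sumsets lie strictly on opposite sides of the hyperplane where the
    \<open>k\<close>-th coordinate is \<open>c + t\<close>.\<close>
  also have "\<dots> = measure lebesgue (sumset (\<Union>Au) (\<Union>Bu) \<union> sumset (\<Union>Al) (\<Union>Bl))"
  proof (rule measure_Un2_disj[symmetric])
    show "sumset (\<Union>Au) (\<Union>Bu) \<in> lmeasurable" "sumset (\<Union>Al) (\<Union>Bl) \<in> lmeasurable"
      using box_family_open_bounded Au Al Bu Bl by (auto intro!: sumset_lmeasurable)
    have "x $ k > c + t" if "x \<in> sumset (\<Union>Au) (\<Union>Bu)" for x
      using that unfolding Au_def Bu_def Union_parts by (auto simp: sumset_def)
    moreover have "x $ k < c + t" if "x \<in> sumset (\<Union>Al) (\<Union>Bl)" for x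
      using that unfolding Al_def Bl_def Union_parts by (auto simp: sumset_def)
    ultimately show "disjnt (sumset (\<Union>Au) (\<Union>Bu)) (sumset (\<Union>Al) (\<Union>Bl))"
      unfolding disjnt_iff by (metis less_asym)
  qed
  also have "\<dots> \<le> measure lebesgue (sumset (\<Union>\<A>) (\<Union>\<B>))"
  proof (rule measure_mono_fmeasurable)
    show "sumset (\<Union>Au) (\<Union>Bu) \<union> sumset (\<Union>Al) (\<Union>Bl) \<subseteq> sumset (\<Union>\<A>) (\<Union>\<B>)"
      unfolding Au_def Bu_def Al_def Bl_def Union_parts by (intro Un_least sumset_mono) auto
    show "sumset (\<Union>Au) (\<Union>Bu) \<union> sumset (\<Union>Al) (\<Union>Bl) \<in> sets lebesgue"
      using box_family_open_bounded Au Al Bu Bl by (intro sets.Un fmeasurableD sumset_lmeasurable) auto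
    show "sumset (\<Union>\<A>) (\<Union>\<B>) \<in> lmeasurable"
      using box_family_open_bounded A B by (auto intro!: sumset_lmeasurable)
  qed
  finally show ?thesis unfolding \<alpha>_def \<beta>_def r_def .
qed

text \<open>Splitting shrinks the first family and does not enlarge the second, so the total number
  of boxes decreases. If only the second family has two boxes, the roles are exchanged.\<close>

theorem brunn_minkowski_boxes:
  fixes \<A> \<B> :: "(real^'n) set set"
  assumes "box_family \<A>" "box_family \<B>"
  shows "(measure lebesgue (\<Union>\<A>) powr (1 / real CARD('n)) + measure lebesgue (\<Union>\<B>) powr (1 / real CARD('n))) ^ CARD('n)
        \<le> measure lebesgue (sumset (\<Union>\<A>) (\<Union>\<B>))"
  using assms
proof (induction "card \<A> + card \<B>" arbitrary: \<A> \<B> rule: less_induct)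
  case less
  have cA: "card \<A> > 0" and cB: "card \<B> > 0" using less.prems by (auto simp: box_family_def card_gt_0_iff)
  consider "card \<A> \<ge> 2" | "card \<B> \<ge> 2" | "card \<A> = 1" "card \<B> = 1" using cA cB by linarith
  then show ?case
  proof cases
    case 1
    show ?thesis by (rule brunn_minkowski_split[OF less.prems 1]) (rule less.hyps, auto)
  next
    case 2
    show ?thesis
      using brunn_minkowski_split[OF less.prems(2,1) 2] less.hyps
      by (simp add: sumset_commute add.commute)
  next
    case 3
    then obtain P Q where PQ: "\<A> = {P}" "\<B> = {Q}" by (metis card_1_singletonE)
    then have ne: "P \<noteq> {}" "Q \<noteq> {}" and ex: "\<exists>a b. P = box a b" "\<exists>a b. Q = box a b"
      using box_familyD[OF less.prems(1)] box_familyD[OF less.prems(2)] by simp_all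
    then obtain a b c e where "P = box a b" "Q = box c e" by blast
    moreover note ne
    ultimately show ?thesis using PQ brunn_minkowski_box[of a b c e] box_ne_empty_cart by auto
  qed
qed

section \<open>Compression and a discrete Brunn--Minkowski inequality\<close>

text \<open>The translates \<open>P + Min Q\<close> and \<open>Max P + Q\<close> meet in at most the
  point \<open>Max P + Min Q\<close>.\<close>

lemma card_sumset_rat_ge:
  fixes P Q :: "rat set"
  assumes fin: "finite P" "finite Q" and ne: "P \<noteq> {}" "Q \<noteq> {}"
  shows "card P + card Q \<le> card (sumset P Q) + 1"
proof -
  define U where "U = (\<lambda>p. p + Min Q) ` P"
  define V where "V = (\<lambda>q. Max P + q) ` Q"
  have "Min Q \<in> Q" "Max P \<in> P" using fin ne by auto
  then have "U \<union> V \<subseteq> sumset P Q" by (auto simp: U_def V_def)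
  then have "card (U \<union> V) \<le> card (sumset P Q)" using fin by (intro card_mono) auto
  moreover have "U \<inter> V \<subseteq> {Max P + Min Q}"
  proof
    fix x assume "x \<in> U \<inter> V"
    then obtain p q where pq: "p \<in> P" "q \<in> Q" "x = p + Min Q" "x = Max P + q" by (auto simp: U_def V_def)
    have "p \<le> Max P" "Min Q \<le> q" using pq fin by auto
    then show "x \<in> {Max P + Min Q}" using pq by auto
  qed
  then have "card (U \<inter> V) \<le> 1" using card_mono[of "{Max P + Min Q}" "U \<inter> V"] by simp
  moreover have "card U + card V = card (U \<union> V) + card (U \<inter> V)"
    using fin by (intro card_Un_Int) (auto simp: U_def V_def)
  moreover have "card U = card P" "card V = card Q" by (auto simp: U_def V_def card_image inj_on_def)
  ultimately show ?thesis by linarith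
qed

section \<open>Compression along a coordinate\<close>

definition vupd :: "'a^'n \<Rightarrow> 'n \<Rightarrow> 'a \<Rightarrow> 'a^'n" where
  "vupd x i t = (\<chi> j. if j = i then t else x $ j)"

definition vproj :: "'n \<Rightarrow> rat^'n \<Rightarrow> rat^'n" where "vproj i x = vupd x i 0"

definition fibre :: "'n \<Rightarrow> (rat^'n) set \<Rightarrow> rat^'n \<Rightarrow> rat set" where
  "fibre i S x = {t. vupd x i t \<in> S}"

text \<open>Each fibre in direction \<open>i\<close> becomes the initial segment of the naturals of
  the same size. The base point of \<open>fibre\<close> may be \<open>x\<close> itself, because its
  \<open>i\<close>-th coordinate is overwritten.\<close>

definition compress :: "'n \<Rightarrow> (rat^'n) set \<Rightarrow> (rat^'n) set" where
  "compress i S = {x. \<exists>k::nat. x $ i = of_nat k \<and> k < card (fibre i S x)}"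

text \<open>Integrality of the coordinate is built in: a set with this property in every direction
  is a down-set of vectors of naturals, so unit cubes over its points do not overlap.\<close>

definition downclosed :: "'n \<Rightarrow> (rat^'n) set \<Rightarrow> bool" where
  "downclosed j S \<longleftrightarrow> (\<forall>x\<in>S. \<exists>k::nat. x $ j = of_nat k \<and> (\<forall>k'\<le>k. vupd x j (of_nat k') \<in> S))"

lemma vupd_nth [simp]: "vupd x i t $ j = (if j = i then t else x $ j)" by (simp add: vupd_def)
lemma vupd_vupd [simp]: "vupd (vupd x i t) i u = vupd x i u" by (simp add: vupd_def vec_eq_iff)
lemma vupd_same [simp]: "vupd x i (x $ i) = x" by (simp add: vupd_def vec_eq_iff)
lemma vupd_commute: "i \<noteq> j \<Longrightarrow> vupd (vupd x i t) j u = vupd (vupd x j u) i t" by (auto simp: vupd_def vec_eq_iff)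
lemma vupd_vproj [simp]: "vupd (vproj i x) i t = vupd x i t" by (simp add: vproj_def)
lemma vproj_vupd [simp]: "vproj i (vupd x i t) = vproj i x" by (simp add: vproj_def)
lemma fibre_vproj [simp]: "fibre i S (vproj i x) = fibre i S x" by (simp add: fibre_def)
lemma fibre_vupd [simp]: "fibre i S (vupd x i t) = fibre i S x" by (simp add: fibre_def)

lemma finite_fibre [simp, intro]: "finite S \<Longrightarrow> finite (fibre i S x)"
proof -
  assume "finite S"
  moreover have "vupd x i ` fibre i S x \<subseteq> S" by (auto simp: fibre_def)
  moreover have "inj_on (vupd x i) (fibre i S x)" by (auto simp: inj_on_def vec_eq_iff)
  ultimately show ?thesis by (meson finite_imageD finite_subset)
qed

lemma inj_on_vupd: "inj_on (\<lambda>(y, t). vupd y i t) {(y, t). y $ i = 0}"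
proof (rule inj_onI, clarify)
  fix y z :: "'a^'b" and t u assume h: "y $ i = 0" "z $ i = 0" "vupd y i t = vupd z i u"
  have "t = u" using h(3) by (metis vupd_nth)
  moreover have "y $ j = z $ j" for j using h by (cases "j = i") (auto simp: vec_eq_iff split: if_splits)
  ultimately show "y = z \<and> t = u" by (simp add: vec_eq_iff)
qed

lemma compress_Sigma:
  assumes "finite S"
  shows "S = (\<lambda>(y, t). vupd y i t) ` (SIGMA y:vproj i ` S. fibre i S y)"
    and "compress i S = (\<lambda>(y, t). vupd y i t) ` (SIGMA y:vproj i ` S. of_nat ` {..<card (fibre i S y)})"
proof -
  show "S = (\<lambda>(y, t). vupd y i t) ` (SIGMA y:vproj i ` S. fibre i S y)"
  proof (intro equalityI subsetI)
    fix x assume "x \<in> S"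
    then show "x \<in> (\<lambda>(y, t). vupd y i t) ` (SIGMA y:vproj i ` S. fibre i S y)"
      by (intro image_eqI[of _ _ "(vproj i x, x $ i)"]) (auto simp: fibre_def)
  qed (auto simp: fibre_def)
  show "compress i S = (\<lambda>(y, t). vupd y i t) ` (SIGMA y:vproj i ` S. of_nat ` {..<card (fibre i S y)})"
  proof (intro equalityI subsetI)
    fix x assume "x \<in> compress i S"
    then obtain k :: nat where k: "x $ i = of_nat k" "k < card (fibre i S x)" by (auto simp: compress_def)
    then have "fibre i S x \<noteq> {}" by auto
    then obtain t where "vupd x i t \<in> S" by (auto simp: fibre_def)
    then have "vproj i x \<in> vproj i ` S" by (metis image_eqI vproj_vupd)
    then have "(vproj i x, x $ i) \<in> (SIGMA y:vproj i ` S. of_nat ` {..<card (fibre i S y)})"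
      using k by auto
    moreover have "x = (\<lambda>(y, t). vupd y i t) (vproj i x, x $ i)" by simp
    ultimately show "x \<in> (\<lambda>(y, t). vupd y i t) ` (SIGMA y:vproj i ` S. of_nat ` {..<card (fibre i S y)})"
      by (rule rev_image_eqI)
  qed (auto simp: compress_def)
qed

lemma card_compress:
  assumes "finite S" shows "card (compress i S) = card S" "finite (compress i S)"
proof -
  have inj: "inj_on (\<lambda>(y, t). vupd y i t) (SIGMA y:vproj i ` S. F y)" for F :: "rat^'a \<Rightarrow> rat set"
    by (rule inj_on_subset[OF inj_on_vupd]) (auto simp: vproj_def)
  have "card (compress i S) = card (SIGMA y:vproj i ` S. (of_nat ` {..<card (fibre i S y)} :: rat set))"
    unfolding compress_Sigma(2)[OF assms] by (rule card_image[OF inj])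
  also have "\<dots> = (\<Sum>y\<in>vproj i ` S. card (fibre i S y))"
    using assms by (subst card_SigmaI) (auto simp: card_image inj_on_def)
  also have "\<dots> = card (SIGMA y:vproj i ` S. fibre i S y)"
    using assms by (subst card_SigmaI) auto
  also have "\<dots> = card S"
    by (subst (3) compress_Sigma(1)[OF assms, of i]) (rule card_image[OF inj, symmetric])
  finally show "card (compress i S) = card S" .
  show "finite (compress i S)" unfolding compress_Sigma(2)[OF assms] using assms by auto
qed

text \<open>Fibre by fibre this is the one-dimensional inequality
  \<open>|P + Q| \<ge> |P| + |Q| - 1\<close>, which is sharp for the initial segments on the
  left.\<close>

lemma sumset_compress:
  assumes fin: "finite X" "finite Y"
  shows "sumset (compress i X) (compress i Y) \<subseteq> compress i (sumset X Y)"
proof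
  fix z assume "z \<in> sumset (compress i X) (compress i Y)"
  then obtain x y k l where z: "z = x + y" and k: "x $ i = of_nat k" "k < card (fibre i X x)"
    and l: "y $ i = of_nat l" "l < card (fibre i Y y)" by (auto simp: compress_def elim!: sumsetE)
  have sub: "sumset (fibre i X x) (fibre i Y y) \<subseteq> fibre i (sumset X Y) z"
  proof
    fix w assume "w \<in> sumset (fibre i X x) (fibre i Y y)"
    then obtain t u where "w = t + u" "vupd x i t \<in> X" "vupd y i u \<in> Y" by (auto simp: fibre_def elim!: sumsetE)
    moreover have "vupd z i (t + u) = vupd x i t + vupd y i u" by (auto simp: z vec_eq_iff)
    ultimately show "w \<in> fibre i (sumset X Y) z" by (auto simp: fibre_def)
  qed
  have "fibre i X x \<noteq> {}" "fibre i Y y \<noteq> {}" using k l by auto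
  then have "card (fibre i X x) + card (fibre i Y y) \<le> card (sumset (fibre i X x) (fibre i Y y)) + 1"
    using fin by (intro card_sumset_rat_ge) auto
  also have "\<dots> \<le> card (fibre i (sumset X Y) z) + 1" using fin by (intro add_mono card_mono sub) auto
  finally have "k + l < card (fibre i (sumset X Y) z)" using k l by linarith
  moreover have "z $ i = of_nat (k + l)" using k l z by simp
  ultimately show "z \<in> compress i (sumset X Y)" unfolding compress_def by blast
qed

lemma downclosed_compress_same: "downclosed i (compress i S)"
  unfolding downclosed_def compress_def by auto

text \<open>Lowering the \<open>j\<close>-th coordinate of the base point can only enlarge the fibre
  in direction \<open>i\<close>, so compressions in different directions do not destroy each other's
  effect.\<close>

lemma downclosed_compress:
  assumes fin: "finite S" and d: "downclosed j S"
  shows "downclosed j (compress i S)"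
proof (cases "i = j")
  case True then show ?thesis using downclosed_compress_same by simp
next
  case False
  show ?thesis unfolding downclosed_def
  proof
    fix x assume "x \<in> compress i S"
    then obtain k :: nat where k: "x $ i = of_nat k" "k < card (fibre i S x)" by (auto simp: compress_def)
    then have "fibre i S x \<noteq> {}" by auto
    then obtain t where t: "vupd x i t \<in> S" by (auto simp: fibre_def)
    then obtain l :: nat where l: "vupd x i t $ j = of_nat l" using d unfolding downclosed_def by blast
    then have xl: "x $ j = of_nat l" using False by simp
    have "vupd x j (of_nat l') \<in> compress i S" if l': "l' \<le> l" for l'
    proof -
      have "fibre i S x \<subseteq> fibre i S (vupd x j (of_nat l'))"
      proof
        fix u assume "u \<in> fibre i S x"
        then have u: "vupd x i u \<in> S" by (simp add: fibre_def)
        then obtain m :: nat where m: "vupd x i u $ j = of_nat m" "\<forall>k'\<le>m. vupd (vupd x i u) j (of_nat k') \<in> S"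
          using d unfolding downclosed_def by blast
        have "m = l" using m(1) xl False by simp
        then have "vupd (vupd x i u) j (of_nat l') \<in> S" using m(2) l' by simp
        then show "u \<in> fibre i S (vupd x j (of_nat l'))" using False by (simp add: fibre_def vupd_commute)
      qed
      then have "card (fibre i S x) \<le> card (fibre i S (vupd x j (of_nat l')))" using fin by (intro card_mono) auto
      then show ?thesis using k False unfolding compress_def by auto
    qed
    then show "\<exists>k::nat. x $ j = of_nat k \<and> (\<forall>k'\<le>k. vupd x j (of_nat k') \<in> compress i S)" using xl by blast
  qed
qed

text \<open>For \<open>i \<noteq> j\<close> the projection of the compressed set lies in the
  compression of the projected set, which has as many points as the projection itself.\<close>

lemma card_vproj_compress:
  assumes fin: "finite S" shows "card (vproj j ` compress i S) \<le> card (vproj j ` S)"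
proof (cases "i = j")
  case True
  have "vproj j ` compress i S \<subseteq> vproj j ` S"
  proof clarify
    fix x assume "x \<in> compress i S"
    then have "fibre i S x \<noteq> {}" by (auto simp: compress_def)
    then obtain t where "vupd x i t \<in> S" by (auto simp: fibre_def)
    then show "vproj j x \<in> vproj j ` S" unfolding True by (metis image_eqI vproj_vupd)
  qed
  then show ?thesis using fin by (intro card_mono) auto
next
  case False
  have "vproj j ` compress i S \<subseteq> compress i (vproj j ` S)"
  proof clarify
    fix x assume "x \<in> compress i S"
    then obtain k :: nat where k: "x $ i = of_nat k" "k < card (fibre i S x)" by (auto simp: compress_def)
    have "fibre i S x \<subseteq> fibre i (vproj j ` S) (vproj j x)"
    proof
      fix t assume "t \<in> fibre i S x"
      then have "vupd x i t \<in> S" by (simp add: fibre_def)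
      moreover have "vupd (vproj j x) i t = vproj j (vupd x i t)" using False by (simp add: vproj_def vupd_commute)
      ultimately show "t \<in> fibre i (vproj j ` S) (vproj j x)" by (simp add: fibre_def)
    qed
    then have "card (fibre i S x) \<le> card (fibre i (vproj j ` S) (vproj j x))" using fin by (intro card_mono) auto
    then show "vproj j x \<in> compress i (vproj j ` S)" using k False unfolding compress_def vproj_def by auto
  qed
  then have "card (vproj j ` compress i S) \<le> card (compress i (vproj j ` S))"
    using fin by (intro card_mono) (auto intro: card_compress)
  then show ?thesis using fin by (simp add: card_compress)
qed

text \<open>One compression per coordinate. \<open>S'\<close> is carried as a separate set, since
  the compressed sumset may exceed \<open>sumset X' Y'\<close> while keeping the cardinality of the
  original sumset.\<close>

lemma compress_all:
  fixes X Y :: "(rat^'n) set"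
  assumes fin: "finite X" "finite Y"
  obtains X' Y' S' where "finite X'" "finite Y'" "finite S'" "card X' = card X" "card Y' = card Y"
    "card S' = card (sumset X Y)" "sumset X' Y' \<subseteq> S'"
    "\<And>i. downclosed i X'" "\<And>i. downclosed i Y'" "\<And>i. downclosed i S'"
    "\<And>i. card (vproj i ` S') \<le> card (vproj i ` sumset X Y)"
proof -
  have "finite (I :: 'n set) \<Longrightarrow> \<exists>X' Y' S'. finite X' \<and> finite Y' \<and> finite S' \<and> card X' = card X \<and> card Y' = card Y
    \<and> card S' = card (sumset X Y) \<and> sumset X' Y' \<subseteq> S'
    \<and> (\<forall>i\<in>I. downclosed i X' \<and> downclosed i Y' \<and> downclosed i S')
    \<and> (\<forall>i. card (vproj i ` S') \<le> card (vproj i ` sumset X Y))" for I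
  proof (induction I rule: finite_induct)
    case empty
    show ?case by (rule exI[of _ X], rule exI[of _ Y], rule exI[of _ "sumset X Y"]) (use fin in auto)
  next
    case (insert i I)
    then obtain X' Y' S' where h: "finite X'" "finite Y'" "finite S'" "card X' = card X" "card Y' = card Y"
      "card S' = card (sumset X Y)" "sumset X' Y' \<subseteq> S'"
      "\<forall>i\<in>I. downclosed i X' \<and> downclosed i Y' \<and> downclosed i S'"
      "\<forall>i. card (vproj i ` S') \<le> card (vproj i ` sumset X Y)" by (elim exE conjE)
    have mono: "compress i (sumset X' Y') \<subseteq> compress i S'"
    proof -
      have "card (fibre i (sumset X' Y') x) \<le> card (fibre i S' x)" for x
        using h(7) by (intro card_mono[OF finite_fibre[OF h(3)]]) (auto simp: fibre_def)
      then show ?thesis unfolding compress_def by (auto intro: order.strict_trans2)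
    qed
    have "sumset (compress i X') (compress i Y') \<subseteq> compress i S'"
      using sumset_compress[OF h(1,2)] mono by blast
    moreover have "\<forall>j\<in>insert i I. downclosed j (compress i X') \<and> downclosed j (compress i Y') \<and> downclosed j (compress i S')"
      using h downclosed_compress downclosed_compress_same by blast
    moreover have "card (vproj j ` compress i S') \<le> card (vproj j ` sumset X Y)" for j
      using card_vproj_compress[OF h(3), of j i] h(9) order_trans by blast
    moreover have "card (compress i X') = card X" "card (compress i Y') = card Y" "card (compress i S') = card (sumset X Y)"
      using card_compress(1)[OF h(1)] card_compress(1)[OF h(2)] card_compress(1)[OF h(3)] h(4-6) by simp_all
    moreover have "finite (compress i X')" "finite (compress i Y')" "finite (compress i S')"
      using card_compress(2)[OF h(1)] card_compress(2)[OF h(2)] card_compress(2)[OF h(3)] by blast+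
    ultimately show ?case
      by (intro exI[of _ "compress i X'"] exI[of _ "compress i Y'"] exI[of _ "compress i S'"] conjI) blast+
  qed
  from this[OF finite[of UNIV]] obtain X' Y' S' where h: "finite X'" "finite Y'" "finite S'" "card X' = card X" "card Y' = card Y"
    "card S' = card (sumset X Y)" "sumset X' Y' \<subseteq> S'"
    "\<forall>i\<in>UNIV. downclosed i X' \<and> downclosed i Y' \<and> downclosed i S'"
    "\<forall>i. card (vproj i ` S') \<le> card (vproj i ` sumset X Y)" by (elim exE conjE)
  show ?thesis by (rule that[OF h(1-7)]) (use h(8,9) in simp_all)
qed

section \<open>From lattice points to unit cubes\<close>

definition indic :: "'n set \<Rightarrow> rat^'n" where "indic J = (\<chi> i. if i \<in> J then 1 else 0)"

text \<open>
  A sum of two unit cubes has side 2, so the volume of a sum of unions of unit cubes counts every point of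
  the sumset together with its shifts by the vertices \<open>indic J\<close>.
\<close>

lemma card_shift_Diff:
  fixes S :: "(rat^'n) set"
  assumes fin: "finite S" and dc: "\<And>i. downclosed i S" and m: "\<And>i. card (vproj i ` S) \<le> m"
  shows "card ((\<lambda>s. s + indic J) ` S - S) \<le> card J * m"
proof -
  \<comment> \<open>A downclosed set meets each line in direction \<open>i\<close> in an initial
    segment, so a unit shift adds at most one point per line.\<close>
  have single: "card ((\<lambda>s. s + indic {i}) ` S - S) \<le> m" for i
  proof -
    have "inj_on (vproj i) ((\<lambda>s. s + indic {i}) ` S - S)"
    proof (rule inj_onI)
      fix x y assume xy: "x \<in> (\<lambda>s. s + indic {i}) ` S - S" "y \<in> (\<lambda>s. s + indic {i}) ` S - S" "vproj i x = vproj i y"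
      have eq: "x $ j = y $ j" if "j \<noteq> i" for j
        using arg_cong[OF xy(3), of "\<lambda>v. v $ j"] that by (simp add: vproj_def)
      have nat: "\<exists>k::nat. w $ i = of_nat (Suc k) \<and> (\<forall>k'\<le>k. vupd w i (of_nat k') \<in> S) \<and> w \<notin> S"
        if w: "w \<in> (\<lambda>s. s + indic {i}) ` S - S" for w
      proof -
        obtain s where s: "s \<in> S" "w = s + indic {i}" "w \<notin> S" using w by auto
        obtain k :: nat where k: "s $ i = of_nat k" "\<forall>k'\<le>k. vupd s i (of_nat k') \<in> S"
          using dc[of i] s(1) unfolding downclosed_def by blast
        have "vupd w i t = vupd s i t" for t by (auto simp: s vec_eq_iff indic_def)
        then show ?thesis using k s by (intro exI[of _ k]) (auto simp: indic_def)
      qed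
      obtain k where k: "x $ i = of_nat (Suc k)" "\<forall>k'\<le>k. vupd x i (of_nat k') \<in> S" "x \<notin> S" using nat[OF xy(1)] by blast
      obtain l where l: "y $ i = of_nat (Suc l)" "\<forall>k'\<le>l. vupd y i (of_nat k') \<in> S" "y \<notin> S" using nat[OF xy(2)] by blast
      have upd: "vupd x i t = vupd y i t" for t using eq by (auto simp: vec_eq_iff)
      have "\<not> k < l"
      proof
        assume "k < l"
        then have "vupd y i (of_nat (Suc k)) \<in> S" using l(2) by (metis Suc_leI)
        then have "x \<in> S" using upd k(1) by (metis vupd_same)
        then show False using k by simp
      qed
      moreover have "\<not> l < k"
      proof
        assume "l < k"
        then have "vupd x i (of_nat (Suc l)) \<in> S" using k(2) by (metis Suc_leI)
        then have "y \<in> S" using upd l(1) by (metis vupd_same)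
        then show False using l by simp
      qed
      ultimately have "k = l" by simp
      then show "x = y" using eq k(1) l(1) by (metis vec_eq_iff)
    qed
    then have "card ((\<lambda>s. s + indic {i}) ` S - S) = card (vproj i ` ((\<lambda>s. s + indic {i}) ` S - S))"
      by (rule card_image[symmetric])
    also have "\<dots> \<le> card (vproj i ` S)"
    proof (intro card_mono)
      show "vproj i ` ((\<lambda>s. s + indic {i}) ` S - S) \<subseteq> vproj i ` S"
      proof clarify
        fix s assume "s \<in> S"
        moreover have "vproj i (s + indic {i}) = vproj i s" by (auto simp: vproj_def vec_eq_iff indic_def)
        ultimately show "vproj i (s + indic {i}) \<in> vproj i ` S" by simp
      qed
    qed (use fin in simp)
    finally show ?thesis using m[of i] by simp
  qed
  show ?thesis
  proof (induction J rule: finite_induct[OF finite])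
    case 1
    have "(\<lambda>s. s + indic {}) ` S = S" by (auto simp: indic_def zero_vec_def[symmetric])
    then show ?case by simp
  next
    case (2 i J)
    have ind: "indic (insert i J) = indic J + indic {i}" using 2 by (auto simp: indic_def vec_eq_iff)
    have "(\<lambda>s. s + indic (insert i J)) ` S - S \<subseteq>
        (\<lambda>s. s + indic {i}) ` ((\<lambda>s. s + indic J) ` S - S) \<union> ((\<lambda>s. s + indic {i}) ` S - S)"
      unfolding ind by (auto simp: add.assoc[symmetric])
    then have "card ((\<lambda>s. s + indic (insert i J)) ` S - S) \<le>
        card ((\<lambda>s. s + indic {i}) ` ((\<lambda>s. s + indic J) ` S - S) \<union> ((\<lambda>s. s + indic {i}) ` S - S))"
      using fin by (intro card_mono) auto
    also have "\<dots> \<le> card ((\<lambda>s. s + indic {i}) ` ((\<lambda>s. s + indic J) ` S - S)) + card ((\<lambda>s. s + indic {i}) ` S - S)"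
      by (rule card_Un_le)
    also have "\<dots> \<le> card J * m + m"
      using 2 single[of i] by (intro add_mono) (auto simp: card_image)
    finally show ?case using 2 by simp
  qed
qed

definition real_vec :: "rat^'n \<Rightarrow> real^'n" where "real_vec x = (\<chi> i. of_rat (x $ i))"

definition unit_box :: "rat^'n \<Rightarrow> (real^'n) set" where "unit_box x = box (real_vec x) (real_vec x + 1)"

lemma box_family_unit_box:
  fixes X :: "(rat^'n) set"
  assumes fin: "finite X" "X \<noteq> {}" and dc: "\<And>i. downclosed i X"
  shows "box_family (unit_box ` X)" "measure lebesgue (\<Union>(unit_box ` X)) = real (card X)"
proof -
  have ne: "unit_box x \<noteq> {}" for x :: "rat^'n" unfolding unit_box_def box_ne_empty_cart by simp
  have dj: "disjnt (unit_box x) (unit_box y)" if xy: "x \<in> X" "y \<in> X" "x \<noteq> y" for x y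
  proof -
    obtain i where i: "x $ i \<noteq> y $ i" using xy(3) by (metis vec_eq_iff)
    obtain k :: nat where k: "x $ i = of_nat k" using dc[of i] xy unfolding downclosed_def by blast
    obtain l :: nat where l: "y $ i = of_nat l" using dc[of i] xy unfolding downclosed_def by blast
    have kl: "k \<noteq> l" using i k l by auto
    show ?thesis unfolding disjnt_iff
    proof (intro allI notI)
      fix p assume "p \<in> unit_box x \<and> p \<in> unit_box y"
      then have "real k < p $ i" "p $ i < real k + 1" "real l < p $ i" "p $ i < real l + 1"
        using k l by (auto simp: unit_box_def mem_box_cart real_vec_def of_rat_of_nat_eq dest!: spec[of _ i])
      then show False using kl by linarith
    qed
  qed
  have inj: "inj_on unit_box X"
  proof (rule inj_onI, rule ccontr)
    fix x y assume "x \<in> X" "y \<in> X" "unit_box x = unit_box y" "x \<noteq> y"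
    then show False using dj[of x y] ne[of y] by (simp add: disjnt_def)
  qed
  show bf: "box_family (unit_box ` X)"
    unfolding box_family_def pairwise_def using fin ne dj by (auto simp: unit_box_def)
  have "measure lebesgue (unit_box x) = 1" for x :: "rat^'n"
    unfolding unit_box_def by (subst measure_box_cart) simp_all
  then show "measure lebesgue (\<Union>(unit_box ` X)) = real (card X)"
    unfolding measure_box_family[OF bf] by (simp only: sum.reindex[OF inj] o_def) simp
qed

text \<open>The error term counts the shifts of \<open>S'\<close> by the \<open>2 ^ d\<close>
  vertices of the cube, each adding at most \<open>d * m\<close> points because every coordinate
  projection of \<open>S'\<close> has at most \<open>m\<close> points.\<close>

theorem discrete_brunn_minkowski:
  fixes X Y :: "(rat^'n) set"
  assumes fin: "finite X" "finite Y" and ne: "X \<noteq> {}" "Y \<noteq> {}"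
    and m: "\<And>i. card (vproj i ` sumset X Y) \<le> m"
  shows "(real (card X) powr (1 / real CARD('n)) + real (card Y) powr (1 / real CARD('n))) ^ CARD('n)
    \<le> real (card (sumset X Y)) + real (2 ^ CARD('n) * CARD('n) * m)"
proof -
  obtain X' Y' S' where h: "finite X'" "finite Y'" "finite S'" "card X' = card X" "card Y' = card Y"
    "card S' = card (sumset X Y)" "sumset X' Y' \<subseteq> S'"
    and dc: "\<And>i. downclosed i X'" "\<And>i. downclosed i Y'" "\<And>i. downclosed i S'"
    and pr: "\<And>i. card (vproj i ` S') \<le> card (vproj i ` sumset X Y)"
    using compress_all[OF fin] by metis
  have m': "card (vproj i ` S') \<le> m" for i using pr[of i] m[of i] by linarith
  have ne': "X' \<noteq> {}" "Y' \<noteq> {}" using h ne fin by (metis card_0_eq card.empty)+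
  define S2 where "S2 = (\<Union>J::'n set. (\<lambda>s. s + indic J) ` S')"
  have finS2: "finite S2" using h by (auto simp: S2_def)
  have "S2 \<subseteq> S' \<union> (\<Union>J::'n set. (\<lambda>s. s + indic J) ` S' - S')" by (auto simp: S2_def)
  then have "card S2 \<le> card (S' \<union> (\<Union>J::'n set. (\<lambda>s. s + indic J) ` S' - S'))"
    using h by (intro card_mono) auto
  also have "\<dots> \<le> card S' + card (\<Union>J::'n set. (\<lambda>s. s + indic J) ` S' - S')" by (rule card_Un_le)
  also have "card (\<Union>J::'n set. (\<lambda>s. s + indic J) ` S' - S') \<le> (\<Sum>J::'n set\<in>UNIV. card ((\<lambda>s. s + indic J) ` S' - S'))"
    by (rule card_UN_le) simp
  also have "\<dots> \<le> (\<Sum>J::'n set\<in>UNIV. CARD('n) * m)"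
  proof (rule sum_mono)
    fix J :: "'n set"
    have "card ((\<lambda>s. s + indic J) ` S' - S') \<le> card J * m" using h dc m' by (intro card_shift_Diff)
    also have "\<dots> \<le> CARD('n) * m" by (intro mult_right_mono card_mono) auto
    finally show "card ((\<lambda>s. s + indic J) ` S' - S') \<le> CARD('n) * m" .
  qed
  also have "\<dots> = 2 ^ CARD('n) * (CARD('n) * m)" by (simp add: card_UNIV_set)
  finally have cS2: "card S2 \<le> card (sumset X Y) + 2 ^ CARD('n) * CARD('n) * m" using h by (simp add: mult.assoc)
  have sub: "sumset (\<Union>(unit_box ` X')) (\<Union>(unit_box ` Y')) \<subseteq> (\<Union>s\<in>S2. cbox (real_vec s) (real_vec s + 1))"
  proof
    fix p assume "p \<in> sumset (\<Union>(unit_box ` X')) (\<Union>(unit_box ` Y'))"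
    then obtain x y u v where p: "x \<in> X'" "y \<in> Y'" "u \<in> unit_box x" "v \<in> unit_box y" "p = u + v" by (auto elim!: sumsetE)
    define s where "s = x + y"
    have s: "s \<in> S'" using p h(7) by (auto simp: s_def)
    have bounds: "real_of_rat (s $ i) < p $ i" "p $ i < real_of_rat (s $ i) + 2" for i
    proof -
      have "real_of_rat (x $ i) < u $ i" "u $ i < real_of_rat (x $ i) + 1" "real_of_rat (y $ i) < v $ i" "v $ i < real_of_rat (y $ i) + 1"
        using p(3,4) by (auto simp: unit_box_def mem_box_cart real_vec_def)
      then show "real_of_rat (s $ i) < p $ i" "p $ i < real_of_rat (s $ i) + 2"
        unfolding s_def p(5) vector_add_component of_rat_add by linarith+
    qed
    \<comment> \<open>The coordinates in which the offsets inside the two unit cubes add up to at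
      least 1.\<close>
    define J where "J = {i. p $ i \<ge> real_of_rat (s $ i) + 1}"
    have "p \<in> cbox (real_vec (s + indic J)) (real_vec (s + indic J) + 1)"
      unfolding mem_box_cart
    proof (intro allI)
      fix i
      show "real_vec (s + indic J) $ i \<le> p $ i \<and> p $ i \<le> (real_vec (s + indic J) + 1) $ i"
        using bounds[of i] by (cases "i \<in> J") (auto simp: real_vec_def indic_def J_def of_rat_add)
    qed
    moreover have "s + indic J \<in> S2" using s by (auto simp: S2_def)
    ultimately show "p \<in> (\<Union>s\<in>S2. cbox (real_vec s) (real_vec s + 1))" by blast
  qed
  note bX = box_family_unit_box[OF h(1) ne'(1) dc(1)]
  note bY = box_family_unit_box[OF h(2) ne'(2) dc(2)]
  have "(real (card X) powr (1 / real CARD('n)) + real (card Y) powr (1 / real CARD('n))) ^ CARD('n)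
     \<le> measure lebesgue (sumset (\<Union>(unit_box ` X')) (\<Union>(unit_box ` Y')))"
    using brunn_minkowski_boxes[OF bX(1) bY(1)] unfolding bX(2) bY(2) h(4,5) .
  also have "\<dots> \<le> measure lebesgue (\<Union>s\<in>S2. cbox (real_vec s) (real_vec s + 1))"
  proof (rule measure_mono_fmeasurable[OF sub])
    show "sumset (\<Union>(unit_box ` X')) (\<Union>(unit_box ` Y')) \<in> sets lebesgue"
      by (intro fmeasurableD sumset_lmeasurable box_family_open_bounded bX bY)
    show "(\<Union>s\<in>S2. cbox (real_vec s) (real_vec s + 1)) \<in> lmeasurable"
      using finS2 by (intro fmeasurable.finite_UN) auto
  qed
  also have "\<dots> \<le> (\<Sum>s\<in>S2. measure lebesgue (cbox (real_vec s) (real_vec s + 1)))"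
    using finS2 by (intro measure_UNION_le) auto
  also have "\<dots> = (\<Sum>s\<in>S2. 1)"
  proof (intro sum.cong refl)
    fix s :: "rat^'n"
    have "real_vec s \<in> cbox (real_vec s) (real_vec s + 1)" by (simp add: mem_box_cart)
    then have "cbox (real_vec s) (real_vec s + 1) \<noteq> {}" by blast
    then show "measure lebesgue (cbox (real_vec s) (real_vec s + 1)) = 1" by (simp add: content_cbox_cart)
  qed
  also have "\<dots> = real (card S2)" by simp
  also have "\<dots> \<le> real (card (sumset X Y) + 2 ^ CARD('n) * CARD('n) * m)" using cS2 by (simp only: of_nat_le_iff)
  finally show ?thesis by simp
qed

section \<open>Covering by few parallel lines\<close>

lemma common_denominator:
  assumes "finite (Q :: rat set)" shows "\<exists>N::nat. N > 0 \<and> (\<forall>q\<in>Q. of_nat N * q \<in> \<int>)"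
  using assms
proof (induction Q rule: finite_induct)
  case empty then show ?case by auto
next
  case (insert x Q)
  then obtain N where N: "N > 0" "\<forall>q\<in>Q. of_nat N * q \<in> \<int>" by auto
  obtain a b where ab: "quotient_of x = (a, b)" by (cases "quotient_of x")
  have b: "b > 0" using quotient_of_denom_pos[OF ab] .
  have x: "x = of_int a / of_int b" using quotient_of_div[OF ab] .
  have "of_nat (N * nat b) * q \<in> \<int>" if "q \<in> insert x Q" for q
  proof (cases "q = x")
    case True
    have "of_nat (N * nat b) * q = of_int (int N * a)" using b unfolding True x by simp
    then show ?thesis by (metis Ints_of_int)
  next
    case False
    then have "of_nat N * q \<in> \<int>" using that N by auto
    moreover have "of_nat (N * nat b) * q = of_int b * (of_nat N * q)" using b by simp
    ultimately show ?thesis by (simp only: Ints_mult Ints_of_int)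
  qed
  then show ?case using N b by (intro exI[of _ "N * nat b"]) auto
qed

text \<open>Reduction to integers: an additive functional that vanishes at no nonzero element of
  \<open>6V - 6V\<close>, scaled to be integral on \<open>V\<close>, preserves all six-term
  coincidences. The progression found in the image therefore lifts back to a progression.\<close>

lemma ap_in_2V_minus_2V:
  fixes V :: "(rat^'n) set" and C :: real
  assumes fin: "finite V" and ne: "V \<noteq> {}" and C: "C \<ge> 1"
    and dbl: "real (card (diffset (nfold_sum 6 V) (nfold_sum 6 V))) \<le> C * real (card V)"
  obtains v :: "rat^'n" and l :: nat where "v \<noteq> 0"
    "real (card V) powr (1 / real (nat \<lceil>144 * C\<^sup>2\<rceil>)) \<le> 4 * (real l + 1)"
    "\<And>j. j \<le> l \<Longrightarrow> of_nat j *s v \<in> diffset (nfold_sum 2 V) (nfold_sum 2 V)"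
proof -
  define D where "D = diffset (nfold_sum 6 V) (nfold_sum 6 V)"
  have finD: "finite D" using fin by (simp add: D_def)
  have memD: "a1+a2+a3+a4+a5+a6 - (b1+b2+b3+b4+b5+b6) \<in> D"
    if "a1\<in>V" "a2\<in>V" "a3\<in>V" "a4\<in>V" "a5\<in>V" "a6\<in>V" "b1\<in>V" "b2\<in>V" "b3\<in>V" "b4\<in>V" "b5\<in>V" "b6\<in>V"
    for a1 a2 a3 a4 a5 a6 b1 b2 b3 b4 b5 b6
    unfolding D_def diffset_def using that by (blast intro: nfold_sum_6I)
  obtain a0 where a0: "a0 \<in> V" using ne by auto
  define \<F> where "\<F> = {F :: rat^'n \<Rightarrow> rat. \<forall>x y. F (x + y) = F x + F y}"
  have "\<exists>F\<in>\<F>. \<forall>x\<in>D-{0}. F x \<noteq> 0"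
  proof (rule exists_nonvanishing_combination)
    fix x assume "x \<in> D - {0}"
    then obtain i where "x $ i \<noteq> 0" by (metis DiffD2 insertI1 vec_eq_iff zero_index)
    moreover have "(\<lambda>x. x $ i) \<in> \<F>" by (simp add: \<F>_def)
    ultimately show "\<exists>G\<in>\<F>. G x \<noteq> 0" by (intro bexI[of _ "\<lambda>x. x $ i"])
  qed (use finD in \<open>auto simp: \<F>_def algebra_simps\<close>)
  then obtain F0 where "F0 \<in> \<F>" "\<forall>x\<in>D-{0}. F0 x \<noteq> 0" by blast
  then have F0: "\<And>x y. F0 (x + y) = F0 x + F0 y" "\<And>x. x \<in> D \<Longrightarrow> x \<noteq> 0 \<Longrightarrow> F0 x \<noteq> 0"
    by (simp_all add: \<F>_def)
  obtain N :: nat where N: "N > 0" "\<forall>q\<in>F0 ` V. of_nat N * q \<in> \<int>" using common_denominator[of "F0 ` V"] fin by auto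
  define F where "F x = of_nat N * F0 x" for x
  have Fadd: "F (x + y) = F x + F y" for x y by (simp add: F_def F0(1) algebra_simps)
  have F00: "F 0 = 0" using Fadd[of 0 0] by simp
  have Fdiff: "F (x - y) = F x - F y" for x y using Fadd[of "x - y" y] by simp
  have Fnz: "x = 0" if "x \<in> D" "F x = 0" for x using that F0(2) N(1) by (auto simp: F_def)
  have FV: "of_int \<lfloor>F x\<rfloor> = F x" if "x \<in> V" for x
  proof -
    have "F x \<in> \<int>" using N(2) that by (auto simp: F_def)
    then show ?thesis by (rule of_int_floor[OF _])
  qed
  define A where "A = (\<lambda>x. \<lfloor>F x\<rfloor>) ` V"
  have injA: "inj_on (\<lambda>x. \<lfloor>F x\<rfloor>) V"
  proof (rule inj_onI)
    fix x y assume xy: "x \<in> V" "y \<in> V" "\<lfloor>F x\<rfloor> = \<lfloor>F y\<rfloor>"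
    then have "F x = F y" using FV by metis
    then have "F (x - y) = 0" by (simp add: Fdiff)
    moreover have "x - y \<in> D" using memD[of x a0 a0 a0 a0 a0 y a0 a0 a0 a0 a0] xy a0 by simp
    ultimately have "x - y = 0" using Fnz by blast
    then show "x = y" by simp
  qed
  have cA: "card A = card V" unfolding A_def by (rule card_image[OF injA])
  have lift: "\<exists>x\<in>nfold_sum k V. of_int z = F x" if "z \<in> nfold_sum k A" for k z
    using that
  proof (induction k arbitrary: z)
    case 0 then show ?case by (simp add: F00)
  next
    case (Suc k)
    then obtain a z' where az: "a \<in> A" "z' \<in> nfold_sum k A" "z = a + z'" by auto
    obtain x where x: "x \<in> V" "a = \<lfloor>F x\<rfloor>" using az by (auto simp: A_def)
    obtain x' where x': "x' \<in> nfold_sum k V" "of_int z' = F x'" using Suc.IH[OF az(2)] by auto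
    have "of_int z = F (x + x')" using az x x' FV by (simp add: Fadd)
    then show ?case using x x' by (intro bexI[of _ "x + x'"]) auto
  qed
  have lift2: "\<exists>x\<in>diffset (nfold_sum k V) (nfold_sum m V). of_int z = F x"
    if zm: "z \<in> diffset (nfold_sum k A) (nfold_sum m A)" for k m z
  proof -
    obtain z1 z2 where z: "z = z1 - z2" "z1 \<in> nfold_sum k A" "z2 \<in> nfold_sum m A" using zm by (auto simp: diffset_def)
    obtain x1 x2 where "x1 \<in> nfold_sum k V" "of_int z1 = F x1" "x2 \<in> nfold_sum m V" "of_int z2 = F x2"
      using lift[OF z(2)] lift[OF z(3)] by blast
    then show ?thesis using z by (intro bexI[of _ "x1 - x2"]) (auto simp: Fdiff diffset_def)
  qed
  have "card (diffset (nfold_sum 6 A) (nfold_sum 6 A)) \<le> card D"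
  proof -
    have "diffset (nfold_sum 6 A) (nfold_sum 6 A) \<subseteq> (\<lambda>x. \<lfloor>F x\<rfloor>) ` D"
    proof
      fix z assume "z \<in> diffset (nfold_sum 6 A) (nfold_sum 6 A)"
      then obtain x where "x \<in> D" "of_int z = F x" using lift2 unfolding D_def by blast
      then show "z \<in> (\<lambda>x. \<lfloor>F x\<rfloor>) ` D" by (metis floor_of_int image_eqI)
    qed
    then have "card (diffset (nfold_sum 6 A) (nfold_sum 6 A)) \<le> card ((\<lambda>x. \<lfloor>F x\<rfloor>) ` D)"
      using finD by (intro card_mono) auto
    also have "\<dots> \<le> card D" by (rule card_image_le[OF finD])
    finally show ?thesis .
  qed
  then have "real (card (diffset (nfold_sum 6 A) (nfold_sum 6 A))) \<le> C * real (card A)"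
    using dbl unfolding cA D_def by linarith
  moreover have "finite A" "A \<noteq> {}" using fin ne by (auto simp: A_def)
  ultimately obtain w :: int and l :: nat where w: "w \<noteq> 0"
    "real (card A) powr (1 / real (nat \<lceil>144 * C\<^sup>2\<rceil>)) \<le> 4 * (real l + 1)"
    "\<And>j. j \<le> l \<Longrightarrow> int j * w \<in> diffset (nfold_sum 2 A) (nfold_sum 2 A)"
    using ap_in_2A_minus_2A_int[OF _ _ C] by metis
  have "\<exists>x\<in>diffset (nfold_sum 2 V) (nfold_sum 2 V). of_int (int j * w) = F x" if "j \<le> l" for j
    using lift2[OF w(3)[OF that]] .
  then obtain e where e: "\<And>j. j \<le> l \<Longrightarrow> e j \<in> diffset (nfold_sum 2 V) (nfold_sum 2 V)"
    "\<And>j. j \<le> l \<Longrightarrow> F (e j) = of_int (int j * w)" by metis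
  have quad: "\<exists>a1\<in>V. \<exists>a2\<in>V. \<exists>a3\<in>V. \<exists>a4\<in>V. x = a1 + a2 - a3 - a4" if xm: "x \<in> diffset (nfold_sum 2 V) (nfold_sum 2 V)" for x
  proof -
    obtain y z where yz: "x = y - z" "y \<in> nfold_sum 2 V" "z \<in> nfold_sum 2 V" using xm by (auto simp: diffset_def)
    obtain a1 a2 where "a1 \<in> V" "a2 \<in> V" "y = a1 + a2" using yz(2) by (rule nfold_sum_2E)
    moreover obtain a3 a4 where "a3 \<in> V" "a4 \<in> V" "z = a3 + a4" using yz(3) by (rule nfold_sum_2E)
    moreover have "y - (a3 + a4) = y - a3 - a4" by simp
    ultimately show ?thesis using yz by metis
  qed
  \<comment> \<open>The defect of additivity of the lifts lies in \<open>6V - 6V\<close>, where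
    \<open>F\<close> has no nonzero zeros.\<close>
  have comb: "x - y - z \<in> D" if xyz: "x \<in> diffset (nfold_sum 2 V) (nfold_sum 2 V)"
    "y \<in> diffset (nfold_sum 2 V) (nfold_sum 2 V)" "z \<in> diffset (nfold_sum 2 V) (nfold_sum 2 V)" for x y z
  proof -
    obtain a1 a2 a3 a4 where a: "a1\<in>V" "a2\<in>V" "a3\<in>V" "a4\<in>V" "x = a1 + a2 - a3 - a4" using quad[OF xyz(1)] by blast
    obtain b1 b2 b3 b4 where b: "b1\<in>V" "b2\<in>V" "b3\<in>V" "b4\<in>V" "y = b1 + b2 - b3 - b4" using quad[OF xyz(2)] by blast
    obtain c1 c2 c3 c4 where c: "c1\<in>V" "c2\<in>V" "c3\<in>V" "c4\<in>V" "z = c1 + c2 - c3 - c4" using quad[OF xyz(3)] by blast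
    have "x - y - z = a1 + a2 + b3 + b4 + c3 + c4 - (a3 + a4 + b1 + b2 + c1 + c2)"
      unfolding a(5) b(5) c(5) by (simp add: algebra_simps)
    moreover have "a1 + a2 + b3 + b4 + c3 + c4 - (a3 + a4 + b1 + b2 + c1 + c2) \<in> D"
      using a b c by (intro memD)
    ultimately show ?thesis by (simp only:)
  qed
  have zero_mem: "0 \<in> diffset (nfold_sum 2 V) (nfold_sum 2 V)"
    using nfold_sum_2I[OF a0 a0] unfolding diffset_def by force
  show ?thesis
  proof (cases "l = 0")
    case True
    have "(axis undefined 1 :: rat^'n) \<noteq> 0" by (simp add: axis_eq_0_iff)
    then show ?thesis using that[of "axis undefined 1" l] True w(2) zero_mem cA by simp
  next
    case False
    have e0: "e 0 = 0"
      using comb[OF e(1)[of 0] zero_mem zero_mem] Fnz[of "e 0"] e(2)[of 0] by simp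
    have step: "e (Suc j) = e j + e 1" if "Suc j \<le> l" for j
    proof -
      have j: "j \<le> l" "1 \<le> l" using that by auto
      have "F (e (Suc j) - e j - e 1) = 0"
        unfolding Fdiff e(2)[OF that] e(2)[OF j(1)] e(2)[OF j(2)] by (simp add: algebra_simps)
      then have "e (Suc j) - e j - e 1 = 0" using Fnz[OF comb[OF e(1)[OF that] e(1)[OF j(1)] e(1)[OF j(2)]]] by simp
      then show ?thesis by (simp add: algebra_simps)
    qed
    have ej: "e j = of_nat j *s e 1" if "j \<le> l" for j using that
    proof (induction j)
      case 0 then show ?case by (simp add: e0)
    next
      case (Suc j)
      then have "e (Suc j) = of_nat j *s e 1 + e 1" using step[OF Suc.prems] by (simp only: Suc_leD)
      then show ?case unfolding of_nat_Suc vec.scale_left_distrib vec.scale_one by (simp only: add.commute)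
    qed
    have "e 1 \<noteq> 0"
    proof
      assume "e 1 = 0"
      moreover have "F (e 1) = of_int w" using e(2)[of 1] False by (simp del: One_nat_def)
      ultimately show False using F00 w(1) by simp
    qed
    then show ?thesis using that[of "e 1" l] w(2) cA e(1) ej by simp
  qed
qed

section \<open>Counting parallel lines\<close>

definition line :: "rat^'n \<Rightarrow> rat^'n \<Rightarrow> (rat^'n) set" where
  "line u x = range (\<lambda>c. x + c *s u)"

definition nlines :: "rat^'n \<Rightarrow> (rat^'n) set \<Rightarrow> nat" where
  "nlines u S = card (line u ` S)"

lemma lineI: "y = x + c *s u \<Longrightarrow> y \<in> line u x"
  unfolding line_def by (rule range_eqI)

lemma mem_line_self [simp]: "x \<in> line u x"
  unfolding line_def by (rule image_eqI[of _ _ 0]) auto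

lemma line_eq: "y \<in> line u x \<Longrightarrow> line u y = line u x"
proof -
  assume "y \<in> line u x"
  then obtain c where c: "y = x + c *s u" by (auto simp: line_def)
  show ?thesis unfolding line_def
  proof (intro equalityI subsetI)
    fix z assume "z \<in> range (\<lambda>c. y + c *s u)"
    then obtain b where "z = y + b *s u" by auto
    then have "z = x + (c + b) *s u" by (simp add: c vec.scale_left_distrib)
    then show "z \<in> range (\<lambda>c. x + c *s u)" by blast
  next
    fix z assume "z \<in> range (\<lambda>c. x + c *s u)"
    then obtain b where "z = x + b *s u" by auto
    then have "z = y + (b - c) *s u" by (simp add: c vec.scale_left_diff_distrib)
    then show "z \<in> range (\<lambda>c. y + c *s u)" by blast
  qed
qed

lemma nlines_mono: "S \<subseteq> S' \<Longrightarrow> finite S' \<Longrightarrow> nlines u S \<le> nlines u S'"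
  unfolding nlines_def by (intro card_mono) auto

lemma nlines_image_le:
  assumes "finite S" shows "nlines (M *v u) ((\<lambda>x. M *v x) ` S) \<le> nlines u S"
proof -
  have "line (M *v u) (M *v x) = (\<lambda>x. M *v x) ` line u x" for x
    unfolding line_def by (auto simp: matrix_vector_right_distrib vector_scalar_commute image_image)
  then have "line (M *v u) ` (\<lambda>x. M *v x) ` S = (\<lambda>L. (\<lambda>x. M *v x) ` L) ` line u ` S" by (auto simp: image_image)
  then show ?thesis unfolding nlines_def using assms by (simp add: card_image_le)
qed

lemma nlines_sumset_ge:
  assumes "finite X" "finite Y" "Y \<noteq> {}" shows "nlines u X \<le> nlines u (sumset X Y)"
proof -
  obtain b where b: "b \<in> Y" using assms by auto
  have tr: "line u (x + b) = (\<lambda>z. z + b) ` line u x" for x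
    unfolding line_def by (auto simp: image_image algebra_simps)
  have "inj_on (\<lambda>L. (\<lambda>z. z + b) ` L) (line u ` X)"
    by (rule inj_on_subset[OF _ subset_UNIV]) (simp add: inj_image_eq_iff inj_def)
  then have "nlines u X = card ((\<lambda>L. (\<lambda>z. z + b) ` L) ` line u ` X)" unfolding nlines_def by (simp add: card_image)
  also have "\<dots> \<le> card (line u ` sumset X Y)"
  proof (rule card_mono)
    show "(\<lambda>L. (\<lambda>z. z + b) ` L) ` line u ` X \<subseteq> line u ` sumset X Y"
    proof clarify
      fix x assume "x \<in> X"
      then have "x + b \<in> sumset X Y" using b by auto
      then show "(\<lambda>z. z + b) ` line u x \<in> line u ` sumset X Y" unfolding tr[symmetric] by (rule imageI)
    qed
  qed (use assms in simp)
  finally show ?thesis unfolding nlines_def .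
qed

text \<open>Choose one representative on each line met by \<open>S\<close>. The translates of
  \<open>P\<close> by these representatives lie on different lines, hence are disjoint.\<close>

lemma nlines_mult_card_le:
  assumes fin: "finite S" "finite P" and P: "P \<subseteq> line u p0"
  shows "nlines u S * card P \<le> card (sumset S P)"
proof -
  have "\<forall>L\<in>line u ` S. \<exists>x\<in>S. line u x = L" by auto
  then obtain rep where rep: "\<And>L. L \<in> line u ` S \<Longrightarrow> rep L \<in> S \<and> line u (rep L) = L" by metis
  have "inj_on (\<lambda>(L, p). rep L + p) (line u ` S \<times> P)"
  proof (rule inj_onI, clarify)
    fix s p s' p' assume h: "s \<in> S" "p \<in> P" "s' \<in> S" "p' \<in> P" "rep (line u s) + p = rep (line u s') + p'"
    have "p \<in> line u p0" "p' \<in> line u p0" using h(2,4) P by auto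
    then obtain c c' where c: "p = p0 + c *s u" "p' = p0 + c' *s u" unfolding line_def by blast
    have "rep (line u s') = rep (line u s) + (p - p')" using h(5) by (simp add: algebra_simps)
    also have "p - p' = (c - c') *s u" by (simp add: c vec.scale_left_diff_distrib)
    finally have "rep (line u s') \<in> line u (rep (line u s))" by (rule lineI)
    then have "line u (rep (line u s')) = line u (rep (line u s))" by (rule line_eq)
    then have "line u s = line u s'" using rep h by auto
    then show "line u s = line u s' \<and> p = p'" using h(5) by simp
  qed
  then have "card (line u ` S \<times> P) \<le> card (sumset S P)"
    using fin rep by (intro card_inj_on_le[of "\<lambda>(L, p). rep L + p"]) auto
  then show ?thesis unfolding nlines_def by (simp add: card_cartesian_product)
qed

lemma rich_line:
  assumes fin: "finite S" and ne: "S \<noteq> {}"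
  obtains x where "card S \<le> nlines u S * card (S \<inter> line u x)"
proof -
  define M where "M = Max ((\<lambda>L. card (S \<inter> L)) ` line u ` S)"
  have fin': "finite ((\<lambda>L. card (S \<inter> L)) ` line u ` S)" and ne': "(\<lambda>L. card (S \<inter> L)) ` line u ` S \<noteq> {}" using assms by auto
  have "M \<in> (\<lambda>L. card (S \<inter> L)) ` line u ` S" unfolding M_def by (rule Max_in[OF fin' ne'])
  then obtain x where x: "M = card (S \<inter> line u x)" by auto
  have "S \<subseteq> (\<Union>L\<in>line u ` S. S \<inter> L)" by auto
  then have "card S \<le> card (\<Union>L\<in>line u ` S. S \<inter> L)" using fin by (intro card_mono) auto
  also have "\<dots> \<le> (\<Sum>L\<in>line u ` S. card (S \<inter> L))" using fin by (intro card_UN_le) auto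
  also have "\<dots> \<le> (\<Sum>L\<in>line u ` S. M)" unfolding M_def using fin' by (intro sum_mono Max_ge) auto
  also have "\<dots> = nlines u S * M" by (simp add: nlines_def)
  finally show ?thesis using that x by simp
qed

lemma card_vproj_le_nlines:
  assumes "finite S" shows "card (vproj i ` S) \<le> nlines (axis i 1) S"
proof -
  have "vproj i y = vproj i x" if "y \<in> line (axis i 1) x" for x y :: "rat^'a"
    using that by (auto simp: line_def vproj_def vec_eq_iff axis_def)
  then have "vproj i x = vproj i (SOME y. y \<in> line (axis i 1) x)" for x :: "rat^'a"
    by (metis mem_line_self someI)
  then have "vproj i ` S = (\<lambda>L. vproj i (SOME y. y \<in> L)) ` line (axis i 1) ` S" by (simp add: image_image)
  then show ?thesis unfolding nlines_def using assms by (simp add: card_image_le)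
qed

lemma sumset_matrix_image:
  "sumset ((\<lambda>x. M *v x) ` X) ((\<lambda>x. M *v x) ` Y) = (\<lambda>x. M *v x) ` sumset X Y"
proof (intro equalityI subsetI)
  fix z assume "z \<in> sumset ((\<lambda>x. M *v x) ` X) ((\<lambda>x. M *v x) ` Y)"
  then obtain x y where "x \<in> X" "y \<in> Y" "z = M *v x + M *v y" by (auto elim!: sumsetE)
  then show "z \<in> (\<lambda>x. M *v x) ` sumset X Y"
    by (intro image_eqI[of _ _ "x + y"]) (simp_all add: matrix_vector_right_distrib sumsetI)
qed (auto simp: matrix_vector_right_distrib intro!: sumsetI elim!: sumsetE)

text \<open>A change of basis by the inverse of \<open>W\<close> turns the given directions into
  coordinate directions, where counting lines bounds coordinate projections.\<close>

lemma brunn_minkowski_directions: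
  fixes X Y :: "(rat^'n) set" and W :: "rat^'n^'n"
  assumes fin: "finite X" "finite Y" and ne: "X \<noteq> {}" "Y \<noteq> {}" and W: "invertible W"
    and m: "\<And>i. nlines (W *v axis i 1) (sumset X Y) \<le> m"
  shows "(real (card X) powr (1 / real CARD('n)) + real (card Y) powr (1 / real CARD('n))) ^ CARD('n)
    \<le> real (card (sumset X Y)) + real (2 ^ CARD('n) * CARD('n) * m)"
proof -
  obtain M where M: "M ** W = mat 1" "W ** M = mat 1" using W unfolding invertible_def by blast
  have inj: "inj (\<lambda>x. M *v x)"
    by (rule inj_on_inverseI[of _ "\<lambda>x. W *v x"]) (simp add: matrix_vector_mul_assoc M)
  have cM: "card ((\<lambda>x. M *v x) ` Z) = card Z" for Z by (rule card_image) (rule inj_on_subset[OF inj], simp)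
  have "card (vproj i ` sumset ((\<lambda>x. M *v x) ` X) ((\<lambda>x. M *v x) ` Y)) \<le> m" for i
  proof -
    have "card (vproj i ` sumset ((\<lambda>x. M *v x) ` X) ((\<lambda>x. M *v x) ` Y)) \<le> nlines (axis i 1) ((\<lambda>x. M *v x) ` sumset X Y)"
      unfolding sumset_matrix_image using fin by (intro card_vproj_le_nlines) auto
    also have "axis i 1 = M *v (W *v axis i 1)" by (simp add: matrix_vector_mul_assoc M)
    also have "nlines (M *v (W *v axis i 1)) ((\<lambda>x. M *v x) ` sumset X Y) \<le> nlines (W *v axis i 1) (sumset X Y)"
      using fin by (intro nlines_image_le) auto
    finally show ?thesis using m[of i] by linarith
  qed
  then show ?thesis
    using discrete_brunn_minkowski[of "(\<lambda>x. M *v x) ` X" "(\<lambda>x. M *v x) ` Y" m] fin ne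
    unfolding sumset_matrix_image cM by simp
qed

lemma matrix_inv_both:
  assumes "invertible (A :: 'a::semiring_1^'n^'n)"
  shows "A ** matrix_inv A = mat 1" "matrix_inv A ** A = mat 1"
  using someI_ex[OF assms[unfolded invertible_def]] unfolding matrix_inv_def by blast+

lemma sumset_eq_diffset: "sumset X Y = diffset X (uminus ` Y)"
proof (intro equalityI subsetI)
  fix z assume "z \<in> sumset X Y"
  then obtain x y where "x \<in> X" "y \<in> Y" "z = x - (- y)" by (auto elim!: sumsetE)
  then show "z \<in> diffset X (uminus ` Y)" unfolding diffset_def by blast
next
  fix z assume "z \<in> diffset X (uminus ` Y)"
  then obtain x y where "x \<in> X" "y \<in> Y" "z = x + y" by (auto simp: diffset_def)
  then show "z \<in> sumset X Y" by auto
qed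

text \<open>Irreducibility for invertible matrices: with equal dimensions, \<open>V\<close> is
  trivial exactly when \<open>U\<close> is, so a conclusion about \<open>U\<close> suffices.\<close>

locale lin_pair =
  fixes L1 L2 :: "rat^'n^'n"
  assumes inv1: "invertible L1" and inv2: "invertible L2"
    and irr: "\<And>U V. vec.subspace U \<Longrightarrow> vec.subspace V \<Longrightarrow> vec.dim U = vec.dim V \<Longrightarrow>
      (\<lambda>u. L1 *v u) ` U \<subseteq> V \<Longrightarrow> (\<lambda>u. L2 *v u) ` U \<subseteq> V \<Longrightarrow> U = {0} \<or> U = UNIV"
begin

lemma inj_L: "inj ((*v) L1)" "inj ((*v) L2)"
  using inv1 inv2 inj_matrix_vector_mult by blast+

lemma card_L [simp]: "card ((*v) L1 ` B) = card B" "card ((*v) L2 ` B) = card B"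
  by (rule card_image, rule inj_on_subset, rule inj_L, simp)+

definition G :: "(rat^'n) set \<Rightarrow> (rat^'n) set \<Rightarrow> nat" where
  "G B C = card (sumset ((*v) L1 ` B) ((*v) L2 ` C))"

definition T :: "rat^'n^'n" where "T = matrix_inv L1 ** L2"

lemma L1_T: "L1 *v (T *v x) = L2 *v x"
proof -
  have "L1 ** T = L2" unfolding T_def
    by (simp add: matrix_mul_assoc matrix_inv_both(1)[OF inv1])
  then show ?thesis by (simp add: matrix_vector_mul_assoc)
qed

text \<open>Irreducibility with \<open>V = L1 U\<close>, which has the dimension of
  \<open>U\<close>; the hypothesis says that \<open>U\<close> is invariant under
  \<open>T\<close>.\<close>

lemma invariant_subspace:
  assumes U: "vec.subspace U" and sub: "(*v) L2 ` U \<subseteq> (*v) L1 ` U"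
  shows "U = {0} \<or> U = UNIV"
proof (rule irr[OF U])
  have lin: "Vector_Spaces.linear (*s) (*s) ((*v) L1)" by (rule matrix_vector_mul_linear_gen)
  show "vec.subspace ((*v) L1 ` U)" by (rule vec.linear_subspace_image[OF lin U])
  show "vec.dim U = vec.dim ((*v) L1 ` U)"
    using vec.dim_image_eq[OF lin, of U] inj_on_subset[OF inj_L(1)] by simp
qed (use sub in auto)

primrec orb :: "rat^'n \<Rightarrow> nat \<Rightarrow> rat^'n" where
  "orb v 0 = v" | "orb v (Suc j) = T *v orb v j"

text \<open>Once an iterate lies in the span of the earlier ones, that span is
  \<open>T\<close>-invariant and nonzero, hence everything.\<close>

lemma dim_orbit:
  assumes v: "v \<noteq> 0" and k: "k \<le> CARD('n)"
  shows "vec.dim (orb v ` {..<k}) \<ge> k"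
  using k
proof (induction k)
  case (Suc k)
  define U where "U = vec.span (orb v ` {..<k})"
  have IH: "vec.dim U \<ge> k" using Suc by (simp add: U_def)
  show ?case
  proof (cases "orb v k \<in> U")
    case False
    have "orb v ` {..<Suc k} = insert (orb v k) (orb v ` {..<k})" by (simp add: lessThan_Suc)
    then have "vec.dim (orb v ` {..<Suc k}) = vec.dim (orb v ` {..<k}) + 1"
      using False by (simp add: vec.dim_insert U_def)
    then show ?thesis using IH by (simp add: U_def)
  next
    case True
    have "k > 0"
    proof (rule ccontr)
      assume "\<not> k > 0"
      then show False using True v by (simp add: U_def)
    qed
    have TU: "T *v x \<in> U" if "x \<in> U" for x
    proof -
      have "orb v j \<in> U" if "j < Suc k" for j
        using that True vec.span_base[of "orb v j" "orb v ` {..<k}"] by (cases "j = k") (auto simp: U_def)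
      then have "orb v (Suc j) \<in> U" if "j < k" for j using that by (metis Suc_less_eq)
      then have "(*v) T ` orb v ` {..<k} \<subseteq> U" by auto
      then have "vec.span ((*v) T ` orb v ` {..<k}) \<subseteq> U" unfolding U_def by (metis vec.span_minimal vec.subspace_span)
      moreover have "vec.span ((*v) T ` orb v ` {..<k}) = (*v) T ` U" unfolding U_def
        by (rule vec.linear_span_image[OF matrix_vector_mul_linear_gen])
      ultimately show ?thesis using that by blast
    qed
    have "U = {0} \<or> U = UNIV"
    proof (rule invariant_subspace)
      show "vec.subspace U" by (simp add: U_def)
      show "(*v) L2 ` U \<subseteq> (*v) L1 ` U"
      proof clarify
        fix x assume "x \<in> U"
        then show "L2 *v x \<in> (*v) L1 ` U" using TU[of x] L1_T[of x] by (metis image_eqI)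
      qed
    qed
    moreover have "orb v 0 \<in> U" unfolding U_def by (intro vec.span_base imageI) (use \<open>k > 0\<close> in simp)
    then have "U \<noteq> {0}" using v by (metis orb.simps(1) singletonD)
    ultimately have UN: "U = UNIV" by simp
    have "vec.dim (orb v ` {..<k}) = vec.dim U" by (simp add: U_def)
    also have "\<dots> = CARD('n)" unfolding UN by (rule vec_dim_card)
    finally have "CARD('n) = vec.dim (orb v ` {..<k})" ..
    also have "\<dots> \<le> vec.dim (orb v ` {..<Suc k})" by (rule vec.dim_subset) auto
    finally show ?thesis using Suc.prems by linarith
  qed
qed simp

text \<open>The columns are \<open>L2 *v orb v j\<close> because lines are counted in the sumset,
  where \<open>nlines_step\<close> controls the \<open>L2\<close>-image of a direction.\<close>

lemma orbit_matrix:
  assumes v: "v \<noteq> 0"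
  obtains W :: "rat^'n^'n" and f :: "'n \<Rightarrow> nat" where "invertible W" "\<And>i. f i < CARD('n)" "\<And>i. W *v axis i 1 = L2 *v orb v (f i)"
proof -
  obtain f :: "'n \<Rightarrow> nat" where f: "bij_betw f UNIV {..<CARD('n)}"
    using ex_bij_betw_finite_nat[OF finite[of "UNIV :: 'n set"]] unfolding atLeast0LessThan by blast
  define W0 :: "rat^'n^'n" where "W0 = (\<chi> j i. orb v (f i) $ j)"
  have colj: "column i W0 = orb v (f i)" for i by (simp add: column_def W0_def vec_eq_iff)
  have "columns W0 = orb v ` {..<CARD('n)}"
  proof -
    have "columns W0 = orb v ` f ` UNIV" unfolding columns_def colj by auto
    then show ?thesis using f by (simp add: bij_betw_def)
  qed
  then have "vec.dim (columns W0) \<ge> CARD('n)" using dim_orbit[OF v, of "CARD('n)"] by simp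
  then have "vec.span (columns W0) = UNIV"
    by (intro vec.subspace_dim_equal vec.subspace_span vec.subspace_UNIV subset_UNIV)
      (simp only: vec_dim_card vec.dim_span)
  then have "invertible W0" using matrix_right_invertible_span_columns[of W0] by (metis invertible_right_inverse)
  then have 1: "invertible (L2 ** W0)" using inv2 by (simp add: invertible_mult)
  have 2: "(L2 ** W0) *v axis i 1 = L2 *v orb v (f i)" for i
  proof -
    have "W0 *v axis i 1 = orb v (f i)"
      by (simp add: vec_eq_iff matrix_vector_mult_def axis_def W0_def if_distrib cong: if_cong)
    then show ?thesis by (simp add: matrix_vector_mul_assoc[symmetric])
  qed
  have 3: "f i < CARD('n)" for i using f by (auto simp: bij_betw_def)
  show ?thesis by (rule that[OF 1 3 2])
qed

text \<open>The triangle inequality with pivot \<open>V\<close> gives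
  \<open>|V| |U + 2V| \<le> |V + U| |V - 2V|\<close>, and the two factors cost \<open>K\<close> and
  \<open>K^3\<close>.\<close>

lemma sumset_triple_bound:
  assumes fin: "finite A" and ne: "A \<noteq> {}" and K: "real (G A A) \<le> K * real (card A)" "K \<ge> 1"
  shows "real (card (sumset (sumset ((*v) L1 ` A) ((*v) L2 ` A)) ((*v) L2 ` A))) \<le> K ^ 4 * real (card A)"
proof -
  define U V where "U = (*v) L1 ` A" and "V = (*v) L2 ` A"
  have finUV: "finite U" "finite V" "U \<noteq> {}" "V \<noteq> {}" using fin ne by (auto simp: U_def V_def)
  have c: "card U = card A" "card V = card A" by (simp_all add: U_def V_def)
  have UV: "real (card (sumset U V)) \<le> K * real (card U)" using K(1) unfolding G_def U_def V_def by simp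
  \<comment> \<open>The sign makes \<open>U - Z\<close> equal to \<open>U + 2V\<close> and
    \<open>V + Z\<close> equal to \<open>V - 2V\<close>.\<close>
  define Z where "Z = uminus ` sumset V V"
  have "sumset (sumset U V) V = diffset U Z"
    unfolding sumset_assoc Z_def by (rule sumset_eq_diffset)
  moreover have "card V * card (diffset U Z) \<le> card (sumset V U) * card (sumset V Z)"
    using finUV by (intro ruzsa_triangle) (auto simp: Z_def)
  moreover have "real (card (sumset V Z)) \<le> K ^ 3 * real (card U)"
  proof -
    have two: "(2::nat) = Suc (Suc 0)" by simp
    have "nfold_sum 2 V = sumset V V" unfolding two nfold_sum.simps by (auto simp: sumset_def)
    moreover have "nfold_sum 1 V = V" by (auto simp: sumset_def)
    moreover have "uminus ` Z = sumset V V" by (simp add: Z_def image_image)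
    ultimately have "sumset V Z = diffset (nfold_sum 1 V) (nfold_sum 2 V)"
      using sumset_eq_diffset[of V Z] by (simp only:)
    moreover have "(1::nat) + 2 = 3" by simp
    ultimately show ?thesis using plunnecke_ruzsa[OF finUV(1,2,3) UV, of 1 2] by (simp only:)
  qed
  ultimately have "real (card V) * real (card (sumset (sumset U V) V)) \<le> (K * real (card A)) * (K ^ 3 * real (card A))"
  proof -
    assume h: "sumset (sumset U V) V = diffset U Z" "card V * card (diffset U Z) \<le> card (sumset V U) * card (sumset V Z)"
      "real (card (sumset V Z)) \<le> K ^ 3 * real (card U)"
    have "real (card V) * real (card (sumset (sumset U V) V)) \<le> real (card (sumset V U)) * real (card (sumset V Z))"
      using h(1,2) by (metis of_nat_le_iff of_nat_mult)
    also have "\<dots> \<le> (K * real (card A)) * (K ^ 3 * real (card A))"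
      using h(3) UV K(2) by (intro mult_mono) (simp_all add: sumset_commute c)
    finally show ?thesis .
  qed
  moreover have "card A > 0" using fin ne by (simp add: card_gt_0_iff)
  ultimately show ?thesis unfolding U_def[symmetric] V_def[symmetric] c
    by (simp add: power4_eq_xxxx power3_eq_cube mult.assoc mult.left_commute)
qed

text \<open>Some line in direction \<open>v\<close> carries at least \<open>|A| / m\<close> points
  of \<open>A\<close>. Its \<open>L2\<close>-image \<open>P\<close> lies on one line in direction
  \<open>L2 *v v\<close>, so the number of such lines meeting \<open>U + V\<close>, times
  \<open>|P|\<close>, is at most \<open>|U + 2V| \<le> K^4 |A|\<close>. As
  \<open>L2 *v v = L1 *v (T *v v)\<close>, undoing \<open>L1\<close> on the first summand gives the
  count for \<open>A\<close> in direction \<open>T *v v\<close>.\<close>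

lemma nlines_step:
  assumes fin: "finite A" and ne: "A \<noteq> {}" and K: "real (G A A) \<le> K * real (card A)" "K \<ge> 1"
    and m: "real (nlines v A) \<le> m"
  shows "real (nlines (L2 *v v) (sumset ((*v) L1 ` A) ((*v) L2 ` A))) \<le> K ^ 4 * m"
    and "real (nlines (T *v v) A) \<le> K ^ 4 * m"
proof -
  define U V where "U = (*v) L1 ` A" and "V = (*v) L2 ` A"
  define S where "S = sumset U V"
  have finUV: "finite U" "finite V" "U \<noteq> {}" "V \<noteq> {}" using fin ne by (auto simp: U_def V_def)
  obtain x where x: "card A \<le> nlines v A * card (A \<inter> line v x)" using rich_line[OF fin ne] by blast
  define P where "P = (*v) L2 ` (A \<inter> line v x)"
  have cP: "card P = card (A \<inter> line v x)" by (simp add: P_def)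
  have PV: "P \<subseteq> V" by (auto simp: P_def V_def)
  have Pl: "P \<subseteq> line (L2 *v v) (L2 *v x)"
    unfolding P_def line_def by (auto simp: matrix_vector_right_distrib vector_scalar_commute)
  have cA: "card A > 0" using fin ne by (simp add: card_gt_0_iff)
  have "real (nlines (L2 *v v) S) * real (card P) \<le> real (card (sumset S P))"
    using nlines_mult_card_le[OF _ _ Pl, of S] finUV PV by (metis S_def finite_subset finite_sumset of_nat_le_iff of_nat_mult)
  also have "\<dots> \<le> real (card (sumset S V))"
    using finUV PV by (auto simp: S_def intro!: card_mono sumset_mono)
  also have "\<dots> \<le> K ^ 4 * real (card A)"
    using sumset_triple_bound[OF fin ne K] by (simp add: S_def U_def V_def)
  also have "\<dots> \<le> K ^ 4 * (m * real (card P))"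
  proof (intro mult_left_mono)
    have "real (card A) \<le> real (nlines v A) * real (card P)" using x cP by (metis of_nat_le_iff of_nat_mult)
    also have "\<dots> \<le> m * real (card P)" using m by (intro mult_right_mono) auto
    finally show "real (card A) \<le> m * real (card P)" .
  qed (use K in auto)
  finally have "real (nlines (L2 *v v) S) * real (card P) \<le> (K ^ 4 * m) * real (card P)" by simp
  moreover have "card P > 0" using x cA cP by (metis gr0I mult_0_right not_le)
  ultimately show *: "real (nlines (L2 *v v) (sumset ((*v) L1 ` A) ((*v) L2 ` A))) \<le> K ^ 4 * m"
    unfolding S_def U_def V_def by (simp add: mult_le_cancel_right_pos)
  have A: "A = (*v) (matrix_inv L1) ` U"
    unfolding U_def by (simp add: image_image matrix_vector_mul_assoc matrix_inv_both(2)[OF inv1])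
  have "nlines (T *v v) A = nlines (matrix_inv L1 *v (L2 *v v)) ((*v) (matrix_inv L1) ` U)"
    using A by (simp add: T_def matrix_vector_mul_assoc)
  also have "\<dots> \<le> nlines (L2 *v v) U" using finUV by (intro nlines_image_le) auto
  also have "\<dots> \<le> nlines (L2 *v v) S" unfolding S_def using finUV by (intro nlines_sumset_ge) auto
  finally show "real (nlines (T *v v) A) \<le> K ^ 4 * m"
    using * unfolding S_def U_def V_def by linarith
qed

lemma nlines_orbit:
  assumes fin: "finite A" and ne: "A \<noteq> {}" and K: "real (G A A) \<le> K * real (card A)" "K \<ge> 1"
    and m: "real (nlines v A) \<le> m"
  shows "real (nlines (orb v j) A) \<le> (K ^ 4) ^ j * m"
proof (induction j)
  case (Suc j)
  then show ?case using nlines_step(2)[OF fin ne K Suc] by (simp add: mult.assoc)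
qed (use m in simp)

text \<open>Adding to \<open>V\<close> a progression of \<open>l + 1\<close> points of
  \<open>2V - 2V\<close> stays in \<open>3V - 2V\<close>, which has at most \<open>K^5 |A|\<close>
  elements, so the lines along it number at most \<open>K^5 |A| / (l + 1)\<close>. The exponent 12
  is the cost of \<open>6V - 6V\<close>. The direction is finally pulled back by
  \<open>L2\<close>.\<close>

lemma exists_rich_direction:
  assumes fin: "finite A" and ne: "A \<noteq> {}" and K: "real (G A A) \<le> K * real (card A)" "K \<ge> 1"
  obtains v where "v \<noteq> 0"
    "real (nlines v A) \<le> 4 * K ^ 5 * real (card A) powr (1 - 1 / real (nat \<lceil>144 * (K ^ 12)\<^sup>2\<rceil>))"
proof -
  define U V where "U = (*v) L1 ` A" and "V = (*v) L2 ` A"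
  have finUV: "finite U" "finite V" "U \<noteq> {}" "V \<noteq> {}" using fin ne by (auto simp: U_def V_def)
  have c: "card U = card A" "card V = card A" by (simp_all add: U_def V_def)
  have UV: "real (card (sumset U V)) \<le> K * real (card U)" using K(1) unfolding G_def U_def V_def by simp
  have "real (card (diffset (nfold_sum 6 V) (nfold_sum 6 V))) \<le> K ^ 12 * real (card V)"
    using plunnecke_ruzsa[OF finUV(1-3) UV, of 6 6] by (simp add: c)
  moreover have "K ^ 12 \<ge> 1" using K(2) by simp
  ultimately obtain w l where w: "w \<noteq> 0"
    "real (card V) powr (1 / real (nat \<lceil>144 * (K ^ 12)\<^sup>2\<rceil>)) \<le> 4 * (real l + 1)"
    "\<And>j. j \<le> l \<Longrightarrow> of_nat j *s w \<in> diffset (nfold_sum 2 V) (nfold_sum 2 V)"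
    using ap_in_2V_minus_2V[OF finUV(2,4), of "K ^ 12"] by metis
  define P where "P = (\<lambda>j::nat. of_nat j *s w) ` {..l}"
  have Pl: "P \<subseteq> line w 0" unfolding P_def line_def by auto
  have "inj_on (\<lambda>j::nat. of_nat j *s w) {..l}" using w(1) by (auto simp: inj_on_def vec.scale_cancel_right)
  then have cP: "card P = l + 1" unfolding P_def by (simp add: card_image)
  have "sumset V P \<subseteq> diffset (nfold_sum 3 V) (nfold_sum 2 V)"
  proof
    fix z assume "z \<in> sumset V P"
    then obtain x j where z: "x \<in> V" "j \<le> l" "z = x + of_nat j *s w" by (auto simp: P_def elim!: sumsetE)
    obtain y y' where y: "y \<in> nfold_sum 2 V" "y' \<in> nfold_sum 2 V" "of_nat j *s w = y - y'"
      using w(3)[OF z(2)] by (auto simp: diffset_def)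
    have three: "(3::nat) = Suc 2" by simp
    have "x + y \<in> nfold_sum 3 V" unfolding three nfold_sum.simps using z y by auto
    moreover have "z = (x + y) - y'" using z y by simp
    ultimately show "z \<in> diffset (nfold_sum 3 V) (nfold_sum 2 V)" using y(2) unfolding diffset_def by blast
  qed
  then have "card (sumset V P) \<le> card (diffset (nfold_sum 3 V) (nfold_sum 2 V))" using finUV by (intro card_mono) auto
  then have "real (card (sumset V P)) \<le> K ^ 5 * real (card A)"
    using plunnecke_ruzsa[OF finUV(1-3) UV, of 3 2] by (simp add: c)
  moreover have "nlines w V * card P \<le> card (sumset V P)"
    using finUV by (intro nlines_mult_card_le[OF _ _ Pl]) (auto simp: P_def)
  ultimately have le: "real (nlines w V) * (real l + 1) \<le> K ^ 5 * real (card A)"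
  proof -
    assume "real (card (sumset V P)) \<le> K ^ 5 * real (card A)" "nlines w V * card P \<le> card (sumset V P)"
    moreover have "real (nlines w V) * (real l + 1) = real (nlines w V * card P)" by (simp add: cP algebra_simps)
    ultimately show ?thesis by linarith
  qed
  define \<tau> where "\<tau> = 1 / real (nat \<lceil>144 * (K ^ 12)\<^sup>2\<rceil>)"
  have cA: "card A > 0" using fin ne by (simp add: card_gt_0_iff)
  have "real (nlines w V) * real (card A) powr \<tau> \<le> real (nlines w V) * (4 * (real l + 1))"
    using w(2) by (intro mult_left_mono) (auto simp: \<tau>_def c)
  also have "\<dots> = 4 * (real (nlines w V) * (real l + 1))" by simp
  also have "\<dots> \<le> 4 * (K ^ 5 * real (card A))" using le by linarith
  also have "\<dots> = 4 * K ^ 5 * real (card A)" by simp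
  also have "\<dots> = (4 * K ^ 5 * real (card A) powr (1 - \<tau>)) * real (card A) powr \<tau>"
    unfolding mult.assoc powr_add[symmetric] using cA by simp
  finally have "real (nlines w V) * real (card A) powr \<tau> \<le> (4 * K ^ 5 * real (card A) powr (1 - \<tau>)) * real (card A) powr \<tau>" .
  then have wV: "real (nlines w V) \<le> 4 * K ^ 5 * real (card A) powr (1 - \<tau>)"
    using cA by (simp add: mult_le_cancel_right_pos)
  define v where "v = matrix_inv L2 *v w"
  have A: "A = (*v) (matrix_inv L2) ` V"
    unfolding V_def by (simp add: image_image matrix_vector_mul_assoc matrix_inv_both(2)[OF inv2])
  have "nlines v A \<le> nlines w V" unfolding v_def using finUV by (subst A) (intro nlines_image_le, auto)
  moreover have "v \<noteq> 0"
  proof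
    assume "v = 0"
    then have "L2 *v v = 0" by simp
    then show False using w(1) unfolding v_def by (simp add: matrix_vector_mul_assoc matrix_inv_both(1)[OF inv2])
  qed
  ultimately show ?thesis using that[of v] wV unfolding \<tau>_def by (meson of_nat_le_iff order_trans)
qed

text \<open>Lines are counted once, in the sumset for the whole of \<open>A\<close>; the sumset of a
  pair \<open>B\<close>, \<open>C\<close> of subsets meets no more of them. This is why the error
  involves \<open>|A|\<close> only, with constants depending on \<open>K\<close> and the
  dimension.\<close>

theorem brunn_minkowski_pairs:
  assumes K: "K \<ge> 1"
  obtains E \<tau> :: real where "E > 0" "0 < \<tau>" "\<tau> < 1"
    "\<And>A B C. finite A \<Longrightarrow> real (G A A) \<le> K * real (card A) \<Longrightarrow> B \<subseteq> A \<Longrightarrow> C \<subseteq> A \<Longrightarrow> B \<noteq> {} \<Longrightarrow> C \<noteq> {} \<Longrightarrow>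
      (real (card B) powr (1 / real CARD('n)) + real (card C) powr (1 / real CARD('n))) ^ CARD('n)
        \<le> real (G B C) + E * real (card A) powr (1 - \<tau>)"
proof -
  define d where "d = CARD('n)"
  define \<tau> where "\<tau> = 1 / real (nat \<lceil>144 * (K ^ 12)\<^sup>2\<rceil>)"
  \<comment> \<open>The factor \<open>4 * K ^ 5\<close> belongs to the initial direction; at most
    \<open>d - 1\<close> applications of \<open>T\<close> and the passage to the sumset cost
    \<open>K ^ 4\<close> each.\<close>
  define m0 where "m0 = (K ^ 4) ^ d * (4 * K ^ 5)"
  define E where "E = real (2 ^ d * d) * m0"
  have K1: "K ^ j \<ge> 1" for j using K by simp
  have "(K ^ 12)\<^sup>2 \<ge> 1" using K by simp
  then have "real (nat \<lceil>144 * (K ^ 12)\<^sup>2\<rceil>) \<ge> 144" by linarith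
  moreover have "0 < 1 / x \<and> 1 / x < 1" if "x \<ge> 144" for x :: real using that by auto
  ultimately have \<tau>: "0 < \<tau>" "\<tau> < 1" unfolding \<tau>_def by blast+
  have "d > 0" by (simp add: d_def)
  moreover have "m0 > 0" unfolding m0_def using K by simp
  ultimately have E: "E > 0" by (simp add: E_def)
  have main: "(real (card B) powr (1 / real CARD('n)) + real (card C) powr (1 / real CARD('n))) ^ CARD('n)
        \<le> real (G B C) + E * real (card A) powr (1 - \<tau>)"
    if fin: "finite A" and GK: "real (G A A) \<le> K * real (card A)" and BC: "B \<subseteq> A" "C \<subseteq> A" "B \<noteq> {}" "C \<noteq> {}" for A B C
  proof -
    have ne: "A \<noteq> {}" using BC by auto
    define S where "S = sumset ((*v) L1 ` A) ((*v) L2 ` A)"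
    obtain v where v: "v \<noteq> 0" "real (nlines v A) \<le> 4 * K ^ 5 * real (card A) powr (1 - \<tau>)"
      by (rule exists_rich_direction[OF fin ne GK K, folded \<tau>_def])
    obtain W :: "rat^'n^'n" and f :: "'n \<Rightarrow> nat" where W: "invertible W" "\<And>i. f i < CARD('n)" "\<And>i. W *v axis i 1 = L2 *v orb v (f i)"
      using orbit_matrix[OF v(1)] by metis
    define M where "M = m0 * real (card A) powr (1 - \<tau>)"
    have nS: "real (nlines (W *v axis i 1) S) \<le> M" for i
    proof -
      have "real (nlines (L2 *v orb v (f i)) S) \<le> K ^ 4 * ((K ^ 4) ^ f i * (4 * K ^ 5 * real (card A) powr (1 - \<tau>)))"
        unfolding S_def by (intro nlines_step(1)[OF fin ne GK K] nlines_orbit[OF fin ne GK K] v)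
      also have "\<dots> = (K ^ 4) ^ Suc (f i) * (4 * K ^ 5 * real (card A) powr (1 - \<tau>))" by simp
      also have "\<dots> \<le> (K ^ 4) ^ d * (4 * K ^ 5 * real (card A) powr (1 - \<tau>))"
        using W(2)[of i] K by (intro mult_right_mono power_increasing K1) (auto simp: d_def Suc_le_eq)
      also have "\<dots> = M" by (simp add: M_def m0_def)
      finally show ?thesis unfolding W(3) .
    qed
    define m where "m = nat \<lfloor>M\<rfloor>"
    have M0: "M \<ge> 0" using nS[of undefined] by linarith
    have finB: "finite B" "finite C" using BC fin by (auto intro: finite_subset)
    have "nlines (W *v axis i 1) (sumset ((*v) L1 ` B) ((*v) L2 ` C)) \<le> m" for i
    proof -
      have "nlines (W *v axis i 1) (sumset ((*v) L1 ` B) ((*v) L2 ` C)) \<le> nlines (W *v axis i 1) S"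
        unfolding S_def using BC fin by (intro nlines_mono sumset_mono) auto
      then have "real (nlines (W *v axis i 1) (sumset ((*v) L1 ` B) ((*v) L2 ` C))) \<le> M" using nS[of i] by linarith
      then show ?thesis unfolding m_def by linarith
    qed
    then have "(real (card ((*v) L1 ` B)) powr (1 / real CARD('n)) + real (card ((*v) L2 ` C)) powr (1 / real CARD('n))) ^ CARD('n)
      \<le> real (G B C) + real (2 ^ CARD('n) * CARD('n) * m)"
      unfolding G_def using BC finB W(1) by (intro brunn_minkowski_directions) auto
    also have "real (2 ^ CARD('n) * CARD('n) * m) \<le> E * real (card A) powr (1 - \<tau>)"
    proof -
      have "real m \<le> M" using M0 unfolding m_def by linarith
      then have "real (2 ^ d * d) * real m \<le> real (2 ^ d * d) * M" by (intro mult_left_mono) auto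
      then show ?thesis by (simp add: E_def M_def d_def mult.assoc)
    qed
    finally show ?thesis by simp
  qed
  show ?thesis by (rule that[OF E \<tau> main])
qed

end

section \<open>Lattices and indices\<close>

definition addgroup :: "'a::ab_group_add set \<Rightarrow> bool" where
  "addgroup H \<longleftrightarrow> 0 \<in> H \<and> (\<forall>x\<in>H. \<forall>y\<in>H. x - y \<in> H)"

definition zspan :: "'a::ab_group_add set \<Rightarrow> 'a set" where
  "zspan X = \<Inter>{H. addgroup H \<and> X \<subseteq> H}"

lemma addgroupD:
  assumes "addgroup H" shows "0 \<in> H" "x \<in> H \<Longrightarrow> y \<in> H \<Longrightarrow> x - y \<in> H" "x \<in> H \<Longrightarrow> - x \<in> H" "x \<in> H \<Longrightarrow> y \<in> H \<Longrightarrow> x + y \<in> H"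
proof -
  show z: "0 \<in> H" and d: "\<And>x y. x \<in> H \<Longrightarrow> y \<in> H \<Longrightarrow> x - y \<in> H" using assms by (auto simp: addgroup_def)
  show m: "- x \<in> H" if "x \<in> H" for x using d[OF z that] by simp
  show "x + y \<in> H" if "x \<in> H" "y \<in> H" using d[OF that(1) m[OF that(2)]] by simp
qed

lemma addgroup_zspan: "addgroup (zspan X)"
  unfolding addgroup_def zspan_def by (auto dest: addgroupD)

lemma zspan_superset: "X \<subseteq> zspan X" unfolding zspan_def by auto

lemma zspan_minimal: "addgroup H \<Longrightarrow> X \<subseteq> H \<Longrightarrow> zspan X \<subseteq> H" unfolding zspan_def by auto

lemma addgroup_of_nat:
  fixes H :: "(rat^'n) set" assumes "addgroup H" "x \<in> H" shows "of_nat k *s x \<in> H"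
proof (induction k)
  case 0 then show ?case using addgroupD(1)[OF assms(1)] by simp
next
  case (Suc k)
  have "of_nat (Suc k) *s x = x + of_nat k *s x" by (simp add: vec.scale_left_distrib)
  then show ?case using addgroupD(4)[OF assms(1) assms(2) Suc] by (simp only:)
qed

lemma addgroup_of_int:
  fixes H :: "(rat^'n) set" assumes "addgroup H" "x \<in> H" shows "of_int k *s x \<in> H"
proof (cases "k \<ge> 0")
  case True
  then show ?thesis using addgroup_of_nat[OF assms, of "nat k"] by simp
next
  case False
  have "- (of_nat (nat (- k)) *s x) \<in> H" by (rule addgroupD(3)[OF assms(1) addgroup_of_nat[OF assms]])
  moreover have "- (of_nat (nat (- k)) *s x) = of_int k *s x"
    unfolding vec.scale_minus_left[symmetric] using False by (simp only: of_nat_nat) simp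
  ultimately show ?thesis by (simp only:)
qed

lemma addgroup_sum:
  assumes "addgroup H" "finite I" "\<And>i. i \<in> I \<Longrightarrow> f i \<in> H" shows "sum f I \<in> H"
  using assms(2,3) by (induction I rule: finite_induct) (auto intro: addgroupD[OF assms(1)])

lemma addgroup_matrix_image:
  fixes H :: "(rat^'n) set" assumes "addgroup H" shows "addgroup ((*v) M ` H)"
  unfolding addgroup_def
proof (intro conjI ballI)
  show "0 \<in> (*v) M ` H" using addgroupD(1)[OF assms] by (intro image_eqI[of _ _ 0]) auto
  fix x y assume "x \<in> (*v) M ` H" "y \<in> (*v) M ` H"
  then obtain a b where "a \<in> H" "b \<in> H" "x = M *v a" "y = M *v b" by auto
  then show "x - y \<in> (*v) M ` H"
    using addgroupD(2)[OF assms] by (intro image_eqI[of _ _ "a - b"]) (auto simp: matrix_vector_mult_diff_distrib)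
qed

lemma addgroup_sumset:
  assumes "addgroup H" "addgroup K" shows "addgroup (sumset H K)"
  unfolding addgroup_def
proof (intro conjI ballI)
  show "0 \<in> sumset H K" using sumsetI[OF addgroupD(1)[OF assms(1)] addgroupD(1)[OF assms(2)]] by simp
  fix x y assume "x \<in> sumset H K" "y \<in> sumset H K"
  then obtain a b a' b' where ab: "a \<in> H" "b \<in> K" "x = a + b" "a' \<in> H" "b' \<in> K" "y = a' + b'" by (auto elim!: sumsetE)
  have "x - y = (a - a') + (b - b')" using ab by simp
  moreover have "(a - a') + (b - b') \<in> sumset H K" using addgroupD(2)[OF assms(1)] addgroupD(2)[OF assms(2)] ab by (intro sumsetI)
  ultimately show "x - y \<in> sumset H K" by (simp only:)
qed

lemma det_Ints:
  fixes M :: "rat^'n^'n" assumes "\<And>i j. M $ i $ j \<in> \<int>" shows "det M \<in> \<int>"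
  unfolding det_def using assms by (intro Ints_sum Ints_mult Ints_prod) auto

definition int_vecs :: "(rat^'n) set" where "int_vecs = {z. \<forall>i. z $ i \<in> \<int>}"

text \<open>Take \<open>d\<close> vectors of the lattice with nonzero determinant of least absolute
  value, which exists because all determinants have the common denominator \<open>N ^ d\<close>.
  Minimality forces every lattice vector to have integral coordinates with respect to them.\<close>

lemma lattice_basis:
  fixes X :: "(rat^'n) set"
  assumes fin: "finite X" and span: "vec.span (zspan X) = UNIV"
  obtains Q :: "rat^'n^'n" where "invertible Q" "zspan X = (*v) Q ` int_vecs"
proof -
  define \<Gamma> where "\<Gamma> = zspan X"
  have grp: "addgroup \<Gamma>" unfolding \<Gamma>_def by (rule addgroup_zspan)
  have "finite ((\<lambda>(x, i). x $ i) ` (X \<times> UNIV))" using fin by auto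
  then obtain N :: nat where N: "N > 0" "\<forall>q\<in>(\<lambda>(x, i). x $ i) ` (X \<times> UNIV). of_nat N * q \<in> \<int>"
    using common_denominator by blast
  have N\<Gamma>: "of_nat N * x $ i \<in> \<int>" if "x \<in> \<Gamma>" for x i
  proof -
    have "addgroup {x::rat^'n. \<forall>i. of_nat N * x $ i \<in> \<int>}"
      by (auto simp: addgroup_def right_diff_distrib)
    moreover have "X \<subseteq> {x. \<forall>i. of_nat N * x $ i \<in> \<int>}" using N(2) by auto
    ultimately have "\<Gamma> \<subseteq> {x. \<forall>i. of_nat N * x $ i \<in> \<int>}" unfolding \<Gamma>_def by (rule zspan_minimal)
    then show ?thesis using that by auto
  qed
  define \<M> where "\<M> = {M::rat^'n^'n. (\<forall>j. column j M \<in> \<Gamma>) \<and> det M \<noteq> 0}"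
  have detN: "of_nat N ^ CARD('n) * det M \<in> \<int>" if "M \<in> \<M>" for M
  proof -
    have "of_nat N ^ CARD('n) * det M = det (\<chi> i. of_nat N *s row i M)"
      by (simp add: det_rows_mul row_def)
    also have "\<dots> \<in> \<int>"
    proof (rule det_Ints)
      fix i j
      have "column j M \<in> \<Gamma>" using that by (simp add: \<M>_def)
      from N\<Gamma>[OF this, of i] show "(\<chi> i. of_nat N *s row i M) $ i $ j \<in> \<int>" by (simp add: row_def column_def)
    qed
    finally show ?thesis .
  qed
  obtain B where B: "B \<subseteq> \<Gamma>" "vec.independent B" "\<Gamma> \<subseteq> vec.span B" using vec.maximal_independent_subset[of \<Gamma>] by blast
  have spanB: "vec.span B = UNIV"
    using B(3) span unfolding \<Gamma>_def by (metis vec.span_minimal vec.subspace_span top.extremum_uniqueI)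
  have "card B = CARD('n)"
    by (metis B(2) spanB vec.dim_eq_card_independent vec.dim_span vec_dim_card)
  moreover have "finite B" using B(2) vec.finiteI_independent by blast
  ultimately obtain f :: "'n \<Rightarrow> rat^'n" where f: "bij_betw f UNIV B"
    by (metis finite finite_same_card_bij)
  define M0 :: "rat^'n^'n" where "M0 = (\<chi> i j. f j $ i)"
  have col: "column j M0 = f j" for j by (simp add: column_def M0_def vec_eq_iff)
  have "columns M0 = f ` UNIV" unfolding columns_def col by auto
  then have "vec.span (columns M0) = UNIV" using f spanB by (simp add: bij_betw_def)
  then have "invertible M0" using matrix_right_invertible_span_columns[of M0] by (metis invertible_right_inverse)
  then have "det M0 \<noteq> 0" by (simp add: invertible_det_nz)
  moreover have "column j M0 \<in> \<Gamma>" for j using f B(1) unfolding col bij_betw_def by auto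
  ultimately have M0: "M0 \<in> \<M>" by (simp add: \<M>_def)
  define \<mu> where "\<mu> M = nat \<bar>\<lfloor>of_nat N ^ CARD('n) * det M\<rfloor>\<bar>" for M :: "rat^'n^'n"
  obtain M where M: "M \<in> \<M>" "\<And>M'. M' \<in> \<M> \<Longrightarrow> \<mu> M \<le> \<mu> M'"
    using M0 ex_has_least_nat[of "\<lambda>M. M \<in> \<M>" M0 \<mu>] by blast
  have detM: "det M \<noteq> 0" and colM: "\<And>j. column j M \<in> \<Gamma>" using M(1) by (auto simp: \<M>_def)
  have invM: "invertible M" using detM by (simp add: invertible_det_nz)
  have le: "\<bar>det M\<bar> \<le> \<bar>det M'\<bar>" if M': "M' \<in> \<M>" for M'
  proof -
    obtain a b where ab: "of_nat N ^ CARD('n) * det M = of_int a" "of_nat N ^ CARD('n) * det M' = of_int b"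
      using detN[OF M(1)] detN[OF M'] by (metis Ints_cases)
    have "nat \<bar>a\<bar> \<le> nat \<bar>b\<bar>" using M(2)[OF M'] unfolding \<mu>_def ab by simp
    then have "\<bar>rat_of_int a\<bar> \<le> \<bar>rat_of_int b\<bar>" by linarith
    then have "of_nat N ^ CARD('n) * \<bar>det M\<bar> \<le> of_nat N ^ CARD('n) * \<bar>det M'\<bar>"
      unfolding ab[symmetric] by (simp add: abs_mult)
    then show ?thesis using N(1) by simp
  qed
  have "\<Gamma> = (*v) M ` int_vecs"
  proof (intro equalityI subsetI)
    fix v assume v: "v \<in> \<Gamma>"
    define c where "c = matrix_inv M *v v"
    have Mc: "M *v c = v" unfolding c_def by (simp add: matrix_vector_mul_assoc matrix_inv_both[OF invM])
    have "c $ k \<in> \<int>" for k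
    proof (rule ccontr)
      assume nk: "c $ k \<notin> \<int>"
      \<comment> \<open>Reducing the nonintegral coordinate to its fractional part and exchanging
        column \<open>k\<close> multiplies the determinant by \<open>frac (c $ k)\<close>, against
        minimality.\<close>
      define x where "x = c - of_int \<lfloor>c $ k\<rfloor> *s axis k 1"
      define M' where "M' = (\<chi> i j. if j = k then (M *v x) $ i else M $ i $ j)"
      have dM': "det M' = frac (c $ k) * det M"
        unfolding M'_def cramer_lemma by (simp add: x_def frac_def)
      have "M *v axis k 1 = column k M"
        by (simp add: vec_eq_iff matrix_vector_mult_def axis_def column_def if_distrib cong: if_cong)
      then have "M *v x = v - of_int \<lfloor>c $ k\<rfloor> *s column k M"
        unfolding x_def by (simp add: matrix_vector_mult_diff_distrib vector_scalar_commute Mc)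
      then have Mx: "M *v x \<in> \<Gamma>" using addgroupD(2)[OF grp v addgroup_of_int[OF grp colM]] by simp
      have "column j M' \<in> \<Gamma>" for j
      proof (cases "j = k")
        case True
        then have "column j M' = M *v x" by (simp add: column_def M'_def vec_eq_iff)
        then show ?thesis using Mx by simp
      next
        case False
        then have "column j M' = column j M" by (simp add: column_def M'_def vec_eq_iff)
        then show ?thesis using colM by simp
      qed
      moreover have fr: "frac (c $ k) > 0" "frac (c $ k) < 1" using nk by (auto simp: frac_gt_0_iff frac_lt_1)
      ultimately have "M' \<in> \<M>" using detM by (simp add: \<M>_def dM')
      from le[OF this] have "\<bar>det M\<bar> \<le> frac (c $ k) * \<bar>det M\<bar>" using fr by (simp add: dM' abs_mult)
      moreover have "frac (c $ k) * \<bar>det M\<bar> < 1 * \<bar>det M\<bar>" using fr detM by (intro mult_strict_right_mono) auto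
      ultimately show False by simp
    qed
    then have "c \<in> int_vecs" by (simp add: int_vecs_def)
    then show "v \<in> (*v) M ` int_vecs" using Mc by blast
  next
    fix v assume "v \<in> (*v) M ` int_vecs"
    then obtain z where z: "v = M *v z" "\<And>i. z $ i \<in> \<int>" by (auto simp: int_vecs_def)
    have "v = (\<Sum>j\<in>UNIV. z $ j *s column j M)" unfolding z(1) by (rule matrix_mult_sum)
    also have "\<dots> \<in> \<Gamma>"
    proof (rule addgroup_sum[OF grp])
      fix j
      obtain a where "z $ j = of_int a" using z(2) Ints_cases by metis
      then show "z $ j *s column j M \<in> \<Gamma>" using addgroup_of_int[OF grp colM] by simp
    qed simp
    finally show "v \<in> \<Gamma>" .
  qed
  then show ?thesis using that[OF invM] unfolding \<Gamma>_def by simp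
qed


section \<open>Index and determinant of sublattices\<close>

lemma addgroup_int_vecs: "addgroup (int_vecs :: (rat^'n) set)"
  by (auto simp: addgroup_def int_vecs_def)

lemma matrix_eq_mult_int:
  fixes M V :: "rat^'n^'n"
  assumes "\<And>j. column j V \<in> (*v) M ` int_vecs"
  obtains Z where "V = M ** Z" "\<And>i j. Z $ i $ j \<in> \<int>"
proof -
  have "\<forall>j. \<exists>z. z \<in> int_vecs \<and> column j V = M *v z" using assms by blast
  then obtain z where z: "\<And>j. z j \<in> int_vecs" "\<And>j. column j V = M *v z j" by metis
  define Z :: "rat^'n^'n" where "Z = (\<chi> i j. z j $ i)"
  have "V $ i $ j = (M ** Z) $ i $ j" for i j
    using arg_cong[OF z(2)[of j], of "\<lambda>v. v $ i"]
    by (simp add: column_def matrix_vector_mult_def matrix_matrix_mult_def Z_def)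
  then have "V = M ** Z" by (simp add: vec_eq_iff)
  moreover have "Z $ i $ j \<in> \<int>" for i j using z(1) by (simp add: Z_def int_vecs_def)
  ultimately show ?thesis using that by blast
qed

lemma abs_det_ge_1:
  fixes Z :: "rat^'n^'n" assumes "\<And>i j. Z $ i $ j \<in> \<int>" "det Z \<noteq> 0" shows "\<bar>det Z\<bar> \<ge> 1"
  using Ints_nonzero_abs_ge1[OF det_Ints[OF assms(1)] assms(2)] .

lemma column_mem_lattice: "column j M \<in> (*v) M ` (int_vecs :: (rat^'n) set)"
proof (rule image_eqI)
  show "column j M = M *v axis j 1"
    by (simp add: vec_eq_iff matrix_vector_mult_def axis_def column_def if_distrib cong: if_cong)
  show "axis j 1 \<in> (int_vecs :: (rat^'n) set)" by (simp add: int_vecs_def axis_def)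
qed

text \<open>Two multiples of \<open>y\<close> share a representative in \<open>R\<close>, and their
  difference lies in \<open>H\<close>.\<close>

lemma multiple_mem_of_finite_cosets:
  fixes H :: "(rat^'n) set"
  assumes H: "addgroup H" and fin: "finite R" and cov: "\<And>k::nat. of_nat k *s y \<in> sumset H R"
  obtains t :: nat where "t > 0" "of_nat t *s y \<in> H"
proof -
  have "\<forall>k. \<exists>r. r \<in> R \<and> of_nat k *s y - r \<in> H"
  proof
    fix k
    obtain h r where hr: "h \<in> H" "r \<in> R" "of_nat k *s y = h + r" using cov[of k] by (auto elim!: sumsetE)
    then show "\<exists>r. r \<in> R \<and> of_nat k *s y - r \<in> H" by (intro exI[of _ r]) simp
  qed
  then obtain f where f: "\<And>k. f k \<in> R" "\<And>k. of_nat k *s y - f k \<in> H" by metis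
  have "\<not> inj f"
  proof
    assume "inj f"
    moreover have "range f \<subseteq> R" using f(1) by auto
    ultimately show False using fin by (meson finite_imageD finite_subset infinite_UNIV_nat)
  qed
  then obtain a b where ab: "a < b" "f a = f b" unfolding inj_def by (metis linorder_neqE_nat)
  have "(of_nat b *s y - f b) - (of_nat a *s y - f a) \<in> H" by (rule addgroupD(2)[OF H f(2) f(2)])
  also have "(of_nat b *s y - f b) - (of_nat a *s y - f a) = of_nat (b - a) *s y"
    using ab by (simp add: of_nat_diff vec.scale_left_diff_distrib)
  finally show ?thesis using that[of "b - a"] ab(1) by simp
qed

lemma exists_prime_order:
  fixes H :: "(rat^'n) set"
  assumes H: "addgroup H" and y: "y \<notin> H" and t: "t > 0" "of_nat t *s y \<in> H"
  obtains p s :: nat where "prime p" "of_nat s *s y \<notin> H" "of_nat p *s (of_nat s *s y) \<in> H"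
proof -
  define t0 where "t0 = (LEAST t. t > 0 \<and> of_nat t *s y \<in> H)"
  have t0: "t0 > 0" "of_nat t0 *s y \<in> H"
    using LeastI[of "\<lambda>t. t > 0 \<and> of_nat t *s y \<in> H" t] t by (auto simp: t0_def)
  have "t0 \<noteq> 1" using t0(2) y by auto
  then obtain p where p: "prime p" "p dvd t0" using prime_factor_nat by blast
  obtain s where s: "t0 = p * s" using p(2) by auto
  have "s > 0" "s < t0" using s t0(1) prime_gt_1_nat[OF p(1)] by auto
  then have "of_nat s *s y \<notin> H" using not_less_Least[of s "\<lambda>t. t > 0 \<and> of_nat t *s y \<in> H"] by (auto simp: t0_def)
  moreover have "of_nat p *s (of_nat s *s y) \<in> H" using t0(2) unfolding s by (simp add: vec.scale_scale)
  ultimately show ?thesis using that p(1) by blast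
qed

lemma prime_order_dvd:
  fixes H :: "(rat^'n) set"
  assumes H: "addgroup H" and x: "x \<notin> H" and p: "prime p" "of_nat p *s x \<in> H" and k: "of_int k *s x \<in> H"
  shows "int p dvd k"
proof (rule ccontr)
  assume "\<not> int p dvd k"
  then have "coprime (int p) k" using p(1) by (simp add: prime_imp_coprime)
  then obtain u v where "u * int p + v * k = 1" using bezout_int[of "int p" k] by (auto simp: coprime_iff_gcd_eq_1)
  then have "rat_of_int (u * int p + v * k) = 1" by (simp only: of_int_1)
  then have "x = rat_of_int (u * int p + v * k) *s x" by simp
  also have "\<dots> = of_int u *s (of_nat p *s x) + of_int v *s (of_int k *s x)"
    by (simp add: vec.scale_left_distrib vec.scale_scale)
  also have "\<dots> \<in> H" by (intro addgroupD(4)[OF H] addgroup_of_int[OF H] p k)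
  finally show False using x by simp
qed

text \<open>
  The lattice spanned by \<open>M'\<close> arises from that of \<open>M\<close> by adjoining one element of prime order \<open>p\<close>.
\<close>

lemma det_le_prime_mult_det:
  fixes M M' :: "rat^'n^'n"
  assumes invM: "invertible M" and invM': "invertible M'"
    and x: "x \<notin> (*v) M ` int_vecs" and p: "prime p" "of_nat p *s x \<in> (*v) M ` int_vecs"
    and mem: "\<And>y. y \<in> (*v) M' ` int_vecs \<Longrightarrow> \<exists>g\<in>(*v) M ` int_vecs. \<exists>i::int. y = g + of_int i *s x"
    and xM': "x \<in> (*v) M' ` int_vecs"
  shows "\<bar>det M\<bar> \<le> of_nat p * \<bar>det M'\<bar>"
proof -
  define \<Gamma> where "\<Gamma> = (*v) M ` (int_vecs :: (rat^'n) set)"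
  have grp: "addgroup \<Gamma>" unfolding \<Gamma>_def by (rule addgroup_matrix_image[OF addgroup_int_vecs])
  \<comment> \<open>If all columns of \<open>M'\<close> were in \<open>\<Gamma>\<close>, so would be
    \<open>x\<close>. The column outside has a coefficient of \<open>x\<close> that is prime to
    \<open>p\<close>.\<close>
  obtain k where k: "column k M' \<notin> \<Gamma>"
  proof (rule ccontr)
    assume "\<not> thesis"
    then have all: "column j M' \<in> \<Gamma>" for j using that by blast
    obtain z where z: "x = M' *v z" "z \<in> int_vecs" using xM' by blast
    have "x = (\<Sum>j\<in>UNIV. z $ j *s column j M')" unfolding z(1) by (rule matrix_mult_sum)
    also have "\<dots> \<in> \<Gamma>"
    proof (rule addgroup_sum[OF grp])
      fix j
      obtain a where "z $ j = of_int a" using z(2) Ints_cases unfolding int_vecs_def by blast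
      then show "z $ j *s column j M' \<in> \<Gamma>" using addgroup_of_int[OF grp all] by simp
    qed simp
    finally show False using x by (simp add: \<Gamma>_def)
  qed
  have "\<forall>j. \<exists>g i. g \<in> \<Gamma> \<and> column j M' = g + of_int i *s x" using mem[OF column_mem_lattice] unfolding \<Gamma>_def by blast
  then obtain g i where gi: "\<And>j. g j \<in> \<Gamma>" "\<And>j. column j M' = g j + rat_of_int (i j) *s x" by metis
  have "\<not> int p dvd i k"
  proof
    assume "int p dvd i k"
    then obtain e where "i k = int p * e" by auto
    then have "rat_of_int (i k) *s x = of_int e *s (of_nat p *s x)" by (simp add: vec.scale_scale mult.commute)
    moreover have "of_int e *s (of_nat p *s x) \<in> \<Gamma>"
      by (rule addgroup_of_int[OF grp]) (simp add: \<Gamma>_def p(2))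
    ultimately have "rat_of_int (i k) *s x \<in> \<Gamma>" by (simp only:)
    then show False using k gi addgroupD(4)[OF grp] by metis
  qed
  then have "coprime (int p) (i k)" using p(1) by (simp add: prime_imp_coprime)
  then obtain u v where uv: "u * int p + v * i k = 1" using bezout_int[of "int p" "i k"] by (auto simp: coprime_iff_gcd_eq_1)
  define c where "c j = v * i j" for j
  \<comment> \<open>\<open>v\<close> inverts \<open>i k\<close> modulo \<open>p\<close>, so
    subtracting \<open>c j\<close> times column \<open>k\<close> from column \<open>j\<close> makes
    the coefficient of \<open>x\<close> divisible by \<open>p\<close>; column \<open>k\<close> is
    multiplied by \<open>p\<close>. Thus \<open>M' ** Z\<close> has its columns in
    \<open>\<Gamma>\<close>, with \<open>det Z = p\<close>.\<close>
  define w :: "rat^'n" where "w = (\<chi> j. if j = k then of_nat p else - of_int (c j))"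
  define Z :: "rat^'n^'n" where "Z = (\<chi> a. if a = k then (\<Sum>b\<in>UNIV. w $ b *s row b (mat 1)) else row a (mat 1))"
  have detZ: "det Z = of_nat p" unfolding Z_def cramer_lemma_transpose by (simp add: w_def)
  have rowk: "(\<Sum>b\<in>UNIV. w $ b *s row b (mat 1)) = w"
    by (simp add: vec_eq_iff row_def mat_def if_distrib cong: if_cong)
  have Zn: "Z $ a $ j = (if a = k then w $ j else if a = j then 1 else 0)" for a j
    unfolding Z_def rowk by (simp add: row_def mat_def)
  have colV: "column j (M' ** Z) = (if j = k then of_nat p *s column k M' else column j M' - of_int (c j) *s column k M')" for j
  proof -
    have "(M' ** Z) $ a $ j = M' $ a $ k * w $ j + (if j = k then 0 else M' $ a $ j)" for a
    proof -
      have "(M' ** Z) $ a $ j = (\<Sum>b\<in>UNIV. M' $ a $ b * (if b = k then w $ j else if b = j then 1 else 0))"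
        by (simp add: matrix_matrix_mult_def Zn)
      also have "\<dots> = M' $ a $ k * w $ j + (\<Sum>b\<in>UNIV - {k}. M' $ a $ b * (if b = k then w $ j else if b = j then 1 else 0))"
        by (subst sum.remove[of _ k]) auto
      also have "(\<Sum>b\<in>UNIV - {k}. M' $ a $ b * (if b = k then w $ j else if b = j then 1 else 0))
          = (\<Sum>b\<in>UNIV - {k}. if b = j then M' $ a $ b else 0)" by (intro sum.cong) auto
      also have "\<dots> = (if j = k then 0 else M' $ a $ j)" by (simp add: sum.delta')
      finally show ?thesis .
    qed
    then show ?thesis by (auto simp: column_def vec_eq_iff w_def mult.commute)
  qed
  have "column j (M' ** Z) \<in> \<Gamma>" for j
  proof (cases "j = k")
    case True
    have "of_nat p *s column k M' = of_nat p *s g k + of_int (i k) *s (of_nat p *s x)"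
      unfolding gi(2)[of k] by (simp add: vec.scale_right_distrib vec.scale_scale mult.commute)
    also have "\<dots> \<in> \<Gamma>"
      by (rule addgroupD(4)[OF grp addgroup_of_nat[OF grp gi(1)] addgroup_of_int[OF grp p(2)[folded \<Gamma>_def]]])
    finally show ?thesis using True by (simp add: colV)
  next
    case False
    have "i j - c j * i k = (u * i j) * int p"
    proof -
      have "i j - c j * i k = i j * (u * int p + v * i k) - c j * i k" using uv by simp
      then show ?thesis by (simp add: c_def algebra_simps)
    qed
    then have e: "rat_of_int (i j) - of_int (c j) * of_int (i k) = of_int (u * i j) * of_nat p"
      by (metis of_int_diff of_int_mult of_int_of_nat_eq)
    have "column j M' - of_int (c j) *s column k M' = (g j - of_int (c j) *s g k) + (rat_of_int (i j) - of_int (c j) * of_int (i k)) *s x"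
      unfolding gi(2)[of k] gi(2)[of j] by (simp add: vec.scale_right_distrib vec.scale_scale vec.scale_left_diff_distrib)
    also have "(rat_of_int (i j) - of_int (c j) * of_int (i k)) *s x = of_int (u * i j) *s (of_nat p *s x)"
      unfolding e by (simp add: vec.scale_scale)
    also have "(g j - of_int (c j) *s g k) + of_int (u * i j) *s (of_nat p *s x) \<in> \<Gamma>"
      by (rule addgroupD(4)[OF grp addgroupD(2)[OF grp gi(1) addgroup_of_int[OF grp gi(1)]]
            addgroup_of_int[OF grp p(2)[folded \<Gamma>_def]]])
    finally show ?thesis using False by (simp add: colV)
  qed
  then obtain Y where Y: "M' ** Z = M ** Y" "\<And>a b. Y $ a $ b \<in> \<int>"
    using matrix_eq_mult_int[of "M' ** Z" M] unfolding \<Gamma>_def by blast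
  have d: "det M' * of_nat p = det M * det Y" using arg_cong[OF Y(1), of det] by (simp add: det_mul detZ)
  have "det M' \<noteq> 0" using invM' by (simp add: invertible_det_nz)
  then have "det Y \<noteq> 0" using d p(1) by (metis mult_eq_0_iff of_nat_0_eq_iff not_prime_0 mult_zero_right)
  then have "\<bar>det Y\<bar> \<ge> 1" using Y(2) abs_det_ge_1 by blast
  then have "\<bar>det M\<bar> * 1 \<le> \<bar>det M\<bar> * \<bar>det Y\<bar>" by (intro mult_left_mono) auto
  also have "\<dots> = of_nat p * \<bar>det M'\<bar>" using arg_cong[OF d, of abs] by (simp add: abs_mult mult.commute)
  finally show ?thesis by simp
qed

text \<open>Induction on the number of representatives: adjoining an element of prime order
  \<open>p\<close> modulo the sublattice divides the number of representatives needed by at least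
  \<open>p\<close>, and the determinant by at most \<open>p\<close>.\<close>

lemma det_le_index:
  fixes M :: "rat^'n^'n"
  assumes "invertible M" "(*v) M ` int_vecs \<subseteq> int_vecs" "finite R" "R \<subseteq> int_vecs"
    "int_vecs \<subseteq> sumset ((*v) M ` int_vecs) R"
  shows "\<bar>det M\<bar> \<le> of_nat (card R)"
  using assms
proof (induction "card R" arbitrary: M R rule: less_induct)
  case less
  note inv = less.prems(1) and sub = less.prems(2) and fin = less.prems(3) and Rint = less.prems(4) and cov = less.prems(5)
  define \<Gamma> where "\<Gamma> = (*v) M ` (int_vecs :: (rat^'n) set)"
  have grp: "addgroup \<Gamma>" unfolding \<Gamma>_def by (rule addgroup_matrix_image[OF addgroup_int_vecs])
  have cov\<Gamma>: "\<exists>g\<in>\<Gamma>. \<exists>r\<in>R. v = g + r" if "v \<in> int_vecs" for v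
    using subsetD[OF cov that] unfolding \<Gamma>_def sumset_def by blast
  have z: "0 \<in> (int_vecs :: (rat^'n) set)" by (simp add: int_vecs_def)
  then have "R \<noteq> {}" using cov by auto
  then have cR: "card R \<ge> 1" using fin by (simp add: Suc_le_eq card_gt_0_iff)
  show ?case
  proof (cases "int_vecs \<subseteq> \<Gamma>")
    case True
    have "column j (mat 1) \<in> \<Gamma>" for j
    proof -
      have "column j (mat 1) \<in> (int_vecs :: (rat^'n) set)" by (simp add: int_vecs_def column_def mat_def)
      then show ?thesis using True by blast
    qed
    then obtain Z where Z: "mat 1 = M ** Z" "\<And>i j. Z $ i $ j \<in> \<int>"
      using matrix_eq_mult_int[of "mat 1" M] unfolding \<Gamma>_def by blast
    have d: "det M * det Z = 1" using arg_cong[OF Z(1), of det] by (simp add: det_mul)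
    then have "det Z \<noteq> 0" by auto
    then have "\<bar>det Z\<bar> \<ge> 1" using Z(2) abs_det_ge_1 by blast
    then have "\<bar>det M\<bar> * 1 \<le> \<bar>det M\<bar> * \<bar>det Z\<bar>" by (intro mult_left_mono) auto
    also have "\<dots> = 1" using d by (simp add: abs_mult[symmetric])
    also have "(1::rat) \<le> of_nat (card R)" using cR by simp
    finally show ?thesis by simp
  next
    case False
    then obtain y where y: "y \<in> int_vecs" "y \<notin> \<Gamma>" by blast
    have covk: "of_nat k *s y \<in> sumset \<Gamma> R" for k
      using addgroup_of_nat[OF addgroup_int_vecs y(1), of k] cov unfolding \<Gamma>_def by blast
    obtain t where t: "t > 0" "of_nat t *s y \<in> \<Gamma>" by (rule multiple_mem_of_finite_cosets[OF grp fin covk])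
    obtain p s where p: "prime p" "of_nat s *s y \<notin> \<Gamma>" "of_nat p *s (of_nat s *s y) \<in> \<Gamma>"
      by (rule exists_prime_order[OF grp y(2) t])
    define x where "x = of_nat s *s y"
    have x: "x \<notin> \<Gamma>" "of_nat p *s x \<in> \<Gamma>" "x \<in> int_vecs"
      using p addgroup_of_nat[OF addgroup_int_vecs y(1)] by (simp_all add: x_def)
    define X where "X = insert x (range (\<lambda>j. column j M))"
    define \<Gamma>' where "\<Gamma>' = zspan X"
    have grp': "addgroup \<Gamma>'" unfolding \<Gamma>'_def by (rule addgroup_zspan)
    have XG: "X \<subseteq> \<Gamma>'" unfolding \<Gamma>'_def by (rule zspan_superset)
    have finX: "finite X" by (simp add: X_def)
    have \<Gamma>\<Gamma>': "\<Gamma> \<subseteq> \<Gamma>'"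
    proof
      fix v assume "v \<in> \<Gamma>"
      then obtain z where z: "v = M *v z" "z \<in> int_vecs" by (auto simp: \<Gamma>_def)
      have "v = (\<Sum>j\<in>UNIV. z $ j *s column j M)" unfolding z(1) by (rule matrix_mult_sum)
      also have "\<dots> \<in> \<Gamma>'"
      proof (rule addgroup_sum[OF grp'])
        fix j
        obtain a where a: "z $ j = of_int a" using z(2) Ints_cases unfolding int_vecs_def by blast
        have "column j M \<in> \<Gamma>'" using XG by (auto simp: X_def)
        from addgroup_of_int[OF grp' this, of a] show "z $ j *s column j M \<in> \<Gamma>'" by (simp add: a)
      qed simp
      finally show "v \<in> \<Gamma>'" .
    qed
    have x\<Gamma>': "x \<in> \<Gamma>'" using XG by (simp add: X_def)
    have colint: "column j M \<in> \<Gamma>" for j unfolding \<Gamma>_def by (rule column_mem_lattice)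
    have rep: "\<exists>g\<in>\<Gamma>. \<exists>i::int. v = g + of_int i *s x" if v: "v \<in> \<Gamma>'" for v
    proof -
      define H where "H = {v. \<exists>g\<in>\<Gamma>. \<exists>i::int. v = g + of_int i *s x}"
      have "addgroup H" unfolding addgroup_def
      proof (intro conjI ballI)
        have "0 = 0 + rat_of_int 0 *s x" by simp
        then show "0 \<in> H" unfolding H_def using addgroupD(1)[OF grp] by blast
        fix v w assume "v \<in> H" "w \<in> H"
        then obtain g i g' i' where h: "g \<in> \<Gamma>" "v = g + rat_of_int i *s x" "g' \<in> \<Gamma>" "w = g' + rat_of_int i' *s x"
          by (auto simp: H_def)
        have "v - w = (g - g') + of_int (i - i') *s x" using h by (simp add: vec.scale_left_diff_distrib)
        then show "v - w \<in> H" unfolding H_def using addgroupD(2)[OF grp h(1,3)] by blast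
      qed
      moreover have "X \<subseteq> H"
      proof
        fix v assume "v \<in> X"
        then consider "v = x" | "v \<in> \<Gamma>" using colint by (auto simp: X_def)
        then show "v \<in> H"
        proof cases
          case 1
          then have "v = 0 + of_int 1 *s x" by simp
          then show ?thesis unfolding H_def using addgroupD(1)[OF grp] by blast
        next
          case 2
          then have "v = v + of_int 0 *s x" by simp
          then show ?thesis unfolding H_def using 2 by blast
        qed
      qed
      ultimately have "\<Gamma>' \<subseteq> H" unfolding \<Gamma>'_def by (rule zspan_minimal)
      then show ?thesis using v unfolding H_def by blast
    qed
    have \<Gamma>'int: "\<Gamma>' \<subseteq> int_vecs" unfolding \<Gamma>'_def
      by (rule zspan_minimal[OF addgroup_int_vecs]) (use x(3) colint sub in \<open>auto simp: X_def \<Gamma>_def\<close>)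
    have spanX: "vec.span (zspan X) = UNIV"
    proof -
      have "vec.span (columns M) = UNIV"
        using inv matrix_right_invertible_span_columns[of M] unfolding invertible_def by blast
      moreover have "columns M \<subseteq> zspan X" using XG unfolding \<Gamma>'_def X_def columns_def by auto
      ultimately show ?thesis using vec.span_mono by blast
    qed
    obtain M' :: "rat^'n^'n" where M': "invertible M'" "\<Gamma>' = (*v) M' ` int_vecs"
      unfolding \<Gamma>'_def by (rule lattice_basis[OF finX spanX])
    \<comment> \<open>The choice depends only on the class of \<open>\<rho>\<close> modulo
      \<open>\<Gamma>'\<close>, so the image of \<open>f\<close> has exactly one representative from
      each class that meets \<open>R\<close>.\<close>
    define f where "f \<rho> = (SOME \<sigma>. \<sigma> \<in> R \<and> \<sigma> - \<rho> \<in> \<Gamma>')" for \<rho>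
    have f: "f \<rho> \<in> R" "f \<rho> - \<rho> \<in> \<Gamma>'" if "\<rho> \<in> R" for \<rho>
    proof -
      have "\<rho> \<in> R \<and> \<rho> - \<rho> \<in> \<Gamma>'" using that addgroupD(1)[OF grp'] by simp
      then have "f \<rho> \<in> R \<and> f \<rho> - \<rho> \<in> \<Gamma>'" unfolding f_def by (rule someI)
      then show "f \<rho> \<in> R" "f \<rho> - \<rho> \<in> \<Gamma>'" by auto
    qed
    have feq: "f \<rho> = f \<rho>'" if "\<rho> - \<rho>' \<in> \<Gamma>'" for \<rho> \<rho>'
    proof -
      have "\<sigma> - \<rho> \<in> \<Gamma>' \<longleftrightarrow> \<sigma> - \<rho>' \<in> \<Gamma>'" for \<sigma>
      proof
        assume "\<sigma> - \<rho> \<in> \<Gamma>'"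
        then have "(\<sigma> - \<rho>) + (\<rho> - \<rho>') \<in> \<Gamma>'" using that by (rule addgroupD(4)[OF grp'])
        then show "\<sigma> - \<rho>' \<in> \<Gamma>'" by simp
      next
        assume "\<sigma> - \<rho>' \<in> \<Gamma>'"
        then have "(\<sigma> - \<rho>') - (\<rho> - \<rho>') \<in> \<Gamma>'" using that by (rule addgroupD(2)[OF grp'])
        then show "\<sigma> - \<rho> \<in> \<Gamma>'" by simp
      qed
      then show ?thesis unfolding f_def by simp
    qed
    define R' where "R' = f ` R"
    have R'R: "R' \<subseteq> R" using f by (auto simp: R'_def)
    have finR': "finite R'" using fin by (simp add: R'_def)
    have distinct: "\<sigma> = \<sigma>'" if \<sigma>: "\<sigma> \<in> R'" "\<sigma>' \<in> R'" "\<sigma> - \<sigma>' \<in> \<Gamma>'" for \<sigma> \<sigma>'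
    proof -
      obtain \<rho> \<rho>' where r: "\<rho> \<in> R" "\<sigma> = f \<rho>" "\<rho>' \<in> R" "\<sigma>' = f \<rho>'" using \<sigma> by (auto simp: R'_def)
      have "((\<sigma> - \<sigma>') - (f \<rho> - \<rho>)) + (f \<rho>' - \<rho>') \<in> \<Gamma>'"
        by (rule addgroupD(4)[OF grp' addgroupD(2)[OF grp' \<sigma>(3) f(2)[OF r(1)]] f(2)[OF r(3)]])
      then have "\<rho> - \<rho>' \<in> \<Gamma>'" by (simp add: r)
      then show ?thesis using feq r by simp
    qed
    have cov': "int_vecs \<subseteq> sumset \<Gamma>' R'"
    proof
      fix v :: "rat^'n" assume "v \<in> int_vecs"
      then obtain g \<rho> where g: "g \<in> \<Gamma>" "\<rho> \<in> R" "v = g + \<rho>" using cov\<Gamma> by blast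
      have "g - (f \<rho> - \<rho>) \<in> \<Gamma>'" by (rule addgroupD(2)[OF grp' subsetD[OF \<Gamma>\<Gamma>' g(1)] f(2)[OF g(2)]])
      moreover have "v = (g - (f \<rho> - \<rho>)) + f \<rho>" using g by simp
      ultimately show "v \<in> sumset \<Gamma>' R'" using g(2) unfolding R'_def by blast
    qed
    have "\<forall>q\<in>R' \<times> {..<p}. \<exists>r\<in>R. fst q + of_nat (snd q) *s x - r \<in> \<Gamma>"
    proof
      fix q assume "q \<in> R' \<times> {..<p}"
      then have "fst q + of_nat (snd q) *s x \<in> int_vecs"
        using R'R Rint x(3) by (intro addgroupD(4)[OF addgroup_int_vecs] addgroup_of_nat[OF addgroup_int_vecs]) auto
      then obtain g r where "g \<in> \<Gamma>" "r \<in> R" "fst q + of_nat (snd q) *s x = g + r"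
        using cov\<Gamma> by blast
      then show "\<exists>r\<in>R. fst q + of_nat (snd q) *s x - r \<in> \<Gamma>" by (intro bexI[of _ r]) auto
    qed
    \<comment> \<open>\<open>h\<close> assigns to \<open>(\<sigma>, i)\<close> a representative of
      \<open>\<sigma> + i x\<close> modulo \<open>\<Gamma>\<close>; its injectivity gives
      \<open>card R' * p \<le> card R\<close>.\<close>
    then obtain h where h: "\<And>q. q \<in> R' \<times> {..<p} \<Longrightarrow> h q \<in> R" "\<And>q. q \<in> R' \<times> {..<p} \<Longrightarrow> fst q + of_nat (snd q) *s x - h q \<in> \<Gamma>"
      by metis
    have "inj_on h (R' \<times> {..<p})"
    proof (rule inj_onI)
      fix q q' assume q: "q \<in> R' \<times> {..<p}" "q' \<in> R' \<times> {..<p}" "h q = h q'"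
      have "(fst q + of_nat (snd q) *s x - h q) - (fst q' + of_nat (snd q') *s x - h q') \<in> \<Gamma>"
        by (rule addgroupD(2)[OF grp h(2)[OF q(1)] h(2)[OF q(2)]])
      also have "(fst q + of_nat (snd q) *s x - h q) - (fst q' + of_nat (snd q') *s x - h q')
          = (fst q - fst q') + of_int (int (snd q) - int (snd q')) *s x"
        using q(3) by (simp add: vec.scale_left_diff_distrib)
      finally have D: "(fst q - fst q') + of_int (int (snd q) - int (snd q')) *s x \<in> \<Gamma>" .
      have "((fst q - fst q') + of_int (int (snd q) - int (snd q')) *s x) - of_int (int (snd q) - int (snd q')) *s x \<in> \<Gamma>'"
        by (rule addgroupD(2)[OF grp' subsetD[OF \<Gamma>\<Gamma>' D] addgroup_of_int[OF grp' x\<Gamma>']])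
      then have "fst q - fst q' \<in> \<Gamma>'" by simp
      then have eq: "fst q = fst q'" using distinct q by auto
      then have "of_int (int (snd q) - int (snd q')) *s x \<in> \<Gamma>" using D by simp
      then have "int p dvd int (snd q) - int (snd q')" by (rule prime_order_dvd[OF grp x(1) p(1) x(2)])
      moreover have "\<bar>int (snd q) - int (snd q')\<bar> < int p" using q by auto
      ultimately have "int (snd q) = int (snd q')" using zdvd_imp_le[of "int p" "\<bar>int (snd q) - int (snd q')\<bar>"] by auto
      then show "q = q'" using eq by (simp add: prod_eq_iff)
    qed
    then have "card (R' \<times> {..<p}) \<le> card R" using h(1) fin by (intro card_inj_on_le[of h]) auto
    then have cR': "card R' * p \<le> card R" by (simp add: card_cartesian_product)
    have "R' \<noteq> {}" using \<open>R \<noteq> {}\<close> by (simp add: R'_def)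
    then have "card R' > 0" using finR' by (simp add: card_gt_0_iff)
    then have "card R' * 1 < card R' * p" using prime_gt_1_nat[OF p(1)] by (intro mult_strict_left_mono) auto
    then have "card R' < card R" using cR' by linarith
    moreover have "R' \<subseteq> int_vecs" using R'R Rint by blast
    ultimately have IH: "\<bar>det M'\<bar> \<le> of_nat (card R')"
      using less.hyps[of R' M'] M' finR' \<Gamma>'int cov' by simp
    have "\<bar>det M\<bar> \<le> of_nat p * \<bar>det M'\<bar>"
      by (rule det_le_prime_mult_det[OF inv M'(1) x(1)[unfolded \<Gamma>_def] p(1) x(2)[unfolded \<Gamma>_def]
            rep[unfolded M'(2) \<Gamma>_def] x\<Gamma>'[unfolded M'(2)]])
    also have "\<dots> \<le> of_nat p * of_nat (card R')" using IH by (intro mult_left_mono) auto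
    also have "\<dots> = of_nat (card R' * p)" by simp
    also have "\<dots> \<le> of_nat (card R)" using cR' by (simp only: of_nat_le_iff)
    finally show ?thesis .
  qed
qed

section \<open>Coprimality as a lower bound for an index\<close>

locale coprime_lin_pair = lin_pair L1 L2 for L1 L2 :: "rat^'n^'n" +
  assumes cop: "\<And>P Q. invertible P \<Longrightarrow> invertible Q \<Longrightarrow> is_int_mat (P ** L1 ** Q) \<Longrightarrow> is_int_mat (P ** L2 ** Q) \<Longrightarrow>
    \<bar>det P * det Q\<bar> \<ge> 1"
begin

lemma coprime_lin_pair_swap: "coprime_lin_pair L2 L1"
proof
  show "invertible L2" "invertible L1" by (rule inv2 inv1)+
  fix U V :: "(rat^'n) set"
  assume "vec.subspace U" "vec.subspace V" "vec.dim U = vec.dim V" "(\<lambda>u. L2 *v u) ` U \<subseteq> V" "(\<lambda>u. L1 *v u) ` U \<subseteq> V"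
  then show "U = {0} \<or> U = UNIV" using irr by blast
next
  fix P Q :: "rat^'n^'n"
  assume "invertible P" "invertible Q" "is_int_mat (P ** L2 ** Q)" "is_int_mat (P ** L1 ** Q)"
  then show "1 \<le> \<bar>det P * det Q\<bar>" using cop by blast
qed

text \<open>Some positive multiple of each \<open>x\<close> in \<open>\<Gamma>\<close> lies in the
  subgroup covered by \<open>R\<close>, so \<open>L2 x\<close> lies in the \<open>L1\<close>-image
  of the rational span, which is therefore invariant.\<close>

lemma span_of_finite_index:
  assumes grp: "addgroup \<Gamma>" and ne: "\<Gamma> \<noteq> {0}" and fin: "finite R"
    and cov: "\<Gamma> \<subseteq> sumset {x \<in> \<Gamma>. L2 *v x \<in> (*v) L1 ` \<Gamma>} R"
  shows "vec.span \<Gamma> = UNIV"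
proof -
  define \<Lambda> where "\<Lambda> = {x \<in> \<Gamma>. L2 *v x \<in> (*v) L1 ` \<Gamma>}"
  have grpL: "addgroup ((*v) L1 ` \<Gamma>)" by (rule addgroup_matrix_image[OF grp])
  have grp\<Lambda>: "addgroup \<Lambda>" unfolding addgroup_def \<Lambda>_def
    using addgroupD[OF grp] addgroupD[OF grpL] by (auto simp: matrix_vector_mult_diff_distrib)
  have "(*v) L2 ` vec.span \<Gamma> \<subseteq> (*v) L1 ` vec.span \<Gamma>"
  proof -
    have sub: "vec.subspace ((*v) L1 ` vec.span \<Gamma>)"
      by (rule vec.linear_subspace_image[OF matrix_vector_mul_linear_gen vec.subspace_span])
    have "L2 *v x \<in> (*v) L1 ` vec.span \<Gamma>" if "x \<in> \<Gamma>" for x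
    proof -
      have "of_nat k *s x \<in> sumset \<Lambda> R" for k using addgroup_of_nat[OF grp that, of k] cov unfolding \<Lambda>_def by blast
      then obtain t where t: "t > 0" "of_nat t *s x \<in> \<Lambda>" by (rule multiple_mem_of_finite_cosets[OF grp\<Lambda> fin])
      then obtain y where y: "y \<in> \<Gamma>" "L2 *v (of_nat t *s x) = L1 *v y" by (auto simp: \<Lambda>_def)
      have "L2 *v x = (1 / of_nat t) *s (L2 *v (of_nat t *s x))" using t(1) by (simp add: vector_scalar_commute[symmetric] vec.scale_scale)
      also have "\<dots> = L1 *v ((1 / of_nat t) *s y)" unfolding y(2) by (simp add: vector_scalar_commute)
      also have "\<dots> \<in> (*v) L1 ` vec.span \<Gamma>" by (intro imageI vec.span_scale vec.span_base y)
      finally show ?thesis .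
    qed
    then have "(*v) L2 ` \<Gamma> \<subseteq> (*v) L1 ` vec.span \<Gamma>" by blast
    then have "vec.span ((*v) L2 ` \<Gamma>) \<subseteq> (*v) L1 ` vec.span \<Gamma>" using sub by (rule vec.span_minimal)
    then show ?thesis by (simp only: vec.linear_span_image[OF matrix_vector_mul_linear_gen])
  qed
  then have "vec.span \<Gamma> = {0} \<or> vec.span \<Gamma> = UNIV" by (intro invariant_subspace vec.subspace_span)
  moreover have "vec.span \<Gamma> \<noteq> {0}" using ne addgroupD(1)[OF grp] vec.span_superset[of \<Gamma>] by blast
  ultimately show ?thesis by blast
qed

text \<open>Write \<open>\<Gamma> = Q Z^d\<close> and
  \<open>L1 \<Gamma> + L2 \<Gamma> = S Z^d\<close>. With \<open>P\<close> the inverse of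
  \<open>S\<close>, both \<open>P L1 Q\<close> and \<open>P L2 Q\<close> are integral, so
  coprimality gives \<open>|det L1| \<le> |det (P L1 Q)|\<close>. The right side is bounded by the
  index of \<open>L1 \<Gamma>\<close> in \<open>L1 \<Gamma> + L2 \<Gamma>\<close>.\<close>

lemma index_ge_det:
  assumes finX: "finite X" and ne: "zspan X \<noteq> {0}" and fin: "finite R"
    and cov: "zspan X \<subseteq> sumset {x \<in> zspan X. L2 *v x \<in> (*v) L1 ` zspan X} R"
  shows "\<bar>det L1\<bar> \<le> of_nat (card R)"
proof -
  define \<Gamma> where "\<Gamma> = zspan X"
  have grp: "addgroup \<Gamma>" unfolding \<Gamma>_def by (rule addgroup_zspan)
  have span: "vec.span \<Gamma> = UNIV"
    using span_of_finite_index[OF grp ne[folded \<Gamma>_def] fin] cov unfolding \<Gamma>_def by blast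
  obtain Q :: "rat^'n^'n" where Q: "invertible Q" "\<Gamma> = (*v) Q ` int_vecs" unfolding \<Gamma>_def
    by (rule lattice_basis[OF finX span[unfolded \<Gamma>_def]])
  define X' where "X' = (*v) L1 ` X \<union> (*v) L2 ` X"
  define \<Gamma>' where "\<Gamma>' = zspan X'"
  have grp': "addgroup \<Gamma>'" unfolding \<Gamma>'_def by (rule addgroup_zspan)
  have image_sub: "(*v) L ` \<Gamma> \<subseteq> \<Gamma>'" if "(*v) L ` X \<subseteq> X'" for L
  proof -
    have "addgroup {x. L *v x \<in> \<Gamma>'}" unfolding addgroup_def
      using addgroupD[OF grp'] by (auto simp: matrix_vector_mult_diff_distrib)
    moreover have "X \<subseteq> {x. L *v x \<in> \<Gamma>'}" using that zspan_superset[of X'] unfolding \<Gamma>'_def by auto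
    ultimately have "\<Gamma> \<subseteq> {x. L *v x \<in> \<Gamma>'}" unfolding \<Gamma>_def by (rule zspan_minimal)
    then show ?thesis by auto
  qed
  have L1\<Gamma>: "(*v) L1 ` \<Gamma> \<subseteq> \<Gamma>'" and L2\<Gamma>: "(*v) L2 ` \<Gamma> \<subseteq> \<Gamma>'" by (intro image_sub, simp add: X'_def)+
  have \<Gamma>'sub: "\<Gamma>' \<subseteq> sumset ((*v) L1 ` \<Gamma>) ((*v) L2 ` \<Gamma>)" unfolding \<Gamma>'_def
  proof (rule zspan_minimal)
    have g: "addgroup ((*v) L1 ` \<Gamma>)" "addgroup ((*v) L2 ` \<Gamma>)" by (rule addgroup_matrix_image[OF grp])+
    then show "addgroup (sumset ((*v) L1 ` \<Gamma>) ((*v) L2 ` \<Gamma>))" by (rule addgroup_sumset)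
    have "x \<in> sumset ((*v) L1 ` \<Gamma>) ((*v) L2 ` \<Gamma>)" if "x \<in> (*v) L1 ` \<Gamma>" for x
      using sumsetI[OF that addgroupD(1)[OF g(2)]] by simp
    moreover have "x \<in> sumset ((*v) L1 ` \<Gamma>) ((*v) L2 ` \<Gamma>)" if "x \<in> (*v) L2 ` \<Gamma>" for x
      using sumsetI[OF addgroupD(1)[OF g(1)] that] by simp
    ultimately show "X' \<subseteq> sumset ((*v) L1 ` \<Gamma>) ((*v) L2 ` \<Gamma>)"
      using zspan_superset[of X] unfolding X'_def \<Gamma>_def by blast
  qed
  have "vec.span ((*v) L1 ` \<Gamma>) = (*v) L1 ` UNIV"
    unfolding span[symmetric] by (rule vec.linear_span_image[OF matrix_vector_mul_linear_gen])
  also have "\<dots> = UNIV"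
  proof -
    have "x \<in> range ((*v) L1)" for x
      by (rule range_eqI[of _ _ "matrix_inv L1 *v x"]) (simp add: matrix_vector_mul_assoc matrix_inv_both[OF inv1])
    then show ?thesis by blast
  qed
  finally have span': "vec.span \<Gamma>' = UNIV" using vec.span_mono[OF L1\<Gamma>] by blast
  have finX': "finite X'" using finX by (simp add: X'_def)
  obtain S :: "rat^'n^'n" where S: "invertible S" "\<Gamma>' = (*v) S ` int_vecs" unfolding \<Gamma>'_def
    by (rule lattice_basis[OF finX' span'[unfolded \<Gamma>'_def]])
  define P where "P = matrix_inv S"
  have PS: "P ** S = mat 1" "S ** P = mat 1" using matrix_inv_both[OF S(1)] by (simp_all add: P_def)
  have invP: "invertible P" using PS unfolding invertible_def by blast
  have P\<Gamma>': "P *v x \<in> int_vecs" if "x \<in> \<Gamma>'" for x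
  proof -
    obtain z where "x = S *v z" "z \<in> int_vecs" using \<open>x \<in> \<Gamma>'\<close> S(2) by blast
    then show ?thesis by (simp add: matrix_vector_mul_assoc PS)
  qed
  have intmat: "is_int_mat (P ** L ** Q)" if L: "(*v) L ` \<Gamma> \<subseteq> \<Gamma>'" for L
    unfolding is_int_mat_def
  proof (intro allI)
    fix i j
    have "Q *v axis j 1 \<in> \<Gamma>" unfolding Q(2) by (intro imageI) (simp add: int_vecs_def axis_def)
    then have "P *v (L *v (Q *v axis j 1)) \<in> int_vecs" using L by (intro P\<Gamma>') blast
    then have "((P ** L ** Q) *v axis j 1) $ i \<in> \<int>" by (simp add: int_vecs_def matrix_vector_mul_assoc matrix_mul_assoc)
    then show "(P ** L ** Q) $ i $ j \<in> \<int>"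
      by (simp add: matrix_vector_mult_def axis_def if_distrib cong: if_cong)
  qed
  have "\<bar>det P * det Q\<bar> \<ge> 1" by (rule cop[OF invP Q(1) intmat[OF L1\<Gamma>] intmat[OF L2\<Gamma>]])
  then have "\<bar>det L1\<bar> * 1 \<le> \<bar>det L1\<bar> * \<bar>det P * det Q\<bar>" by (intro mult_left_mono) auto
  also have "\<dots> = \<bar>det (P ** L1 ** Q)\<bar>" by (simp add: det_mul abs_mult)
  \<comment> \<open>Representatives: an element of \<open>L2 \<Gamma>\<close> differs from some
    \<open>L2 r\<close> with \<open>r \<in> R\<close> by an element of
    \<open>L1 \<Gamma>\<close>.\<close>
  also have "\<dots> \<le> of_nat (card ((*v) (P ** L2) ` (R \<inter> \<Gamma>)))"
  proof (rule det_le_index)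
    show "invertible (P ** L1 ** Q)" by (intro invertible_mult invP inv1 Q(1))
    show "finite ((*v) (P ** L2) ` (R \<inter> \<Gamma>))" using fin by simp
    show "(*v) (P ** L2) ` (R \<inter> \<Gamma>) \<subseteq> int_vecs"
    proof clarify
      fix r assume "r \<in> \<Gamma>"
      then have "P *v (L2 *v r) \<in> int_vecs" using L2\<Gamma> by (intro P\<Gamma>') blast
      then show "(P ** L2) *v r \<in> int_vecs" by (simp add: matrix_vector_mul_assoc)
    qed
    show "(*v) (P ** L1 ** Q) ` int_vecs \<subseteq> int_vecs"
    proof clarify
      fix z :: "rat^'n" assume "z \<in> int_vecs"
      then have "Q *v z \<in> \<Gamma>" using Q(2) by blast
      then have "P *v (L1 *v (Q *v z)) \<in> int_vecs" using L1\<Gamma> by (intro P\<Gamma>') blast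
      then show "(P ** L1 ** Q) *v z \<in> int_vecs" by (simp add: matrix_vector_mul_assoc matrix_mul_assoc)
    qed
    show "int_vecs \<subseteq> sumset ((*v) (P ** L1 ** Q) ` int_vecs) ((*v) (P ** L2) ` (R \<inter> \<Gamma>))"
    proof
      fix z :: "rat^'n" assume "z \<in> int_vecs"
      then have "S *v z \<in> \<Gamma>'" using S(2) by blast
      then obtain g h where gh: "g \<in> \<Gamma>" "h \<in> \<Gamma>" "S *v z = L1 *v g + L2 *v h" using \<Gamma>'sub by (auto elim!: sumsetE)
      obtain l r where lr: "l \<in> \<Gamma>" "L2 *v l \<in> (*v) L1 ` \<Gamma>" "r \<in> R" "h = l + r"
        using subsetD[OF cov[folded \<Gamma>_def] gh(2)] by (auto elim!: sumsetE)
      obtain g' where g': "g' \<in> \<Gamma>" "L2 *v l = L1 *v g'" using lr(2) by blast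
      have r: "r \<in> \<Gamma>" using addgroupD(2)[OF grp gh(2) lr(1)] lr(4) by simp
      obtain z' where z': "z' \<in> int_vecs" "g + g' = Q *v z'" using addgroupD(4)[OF grp gh(1) g'(1)] Q(2) by blast
      have "z = P *v (S *v z)" by (simp add: matrix_vector_mul_assoc PS)
      also have "S *v z = L1 *v (Q *v z') + L2 *v r"
        unfolding gh(3) lr(4) z'(2)[symmetric] by (simp add: matrix_vector_right_distrib g'(2) add.assoc)
      also have "P *v (L1 *v (Q *v z') + L2 *v r) = (P ** L1 ** Q) *v z' + (P ** L2) *v r"
        by (simp add: matrix_vector_right_distrib matrix_vector_mul_assoc matrix_mul_assoc)
      finally show "z \<in> sumset ((*v) (P ** L1 ** Q) ` int_vecs) ((*v) (P ** L2) ` (R \<inter> \<Gamma>))"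
        using z'(1) r lr(3) by blast
    qed
  qed
  also have "\<dots> \<le> of_nat (card R)"
  proof -
    have "card ((*v) (P ** L2) ` (R \<inter> \<Gamma>)) \<le> card (R \<inter> \<Gamma>)" using fin by (intro card_image_le) simp
    also have "\<dots> \<le> card R" using fin by (intro card_mono) auto
    finally show ?thesis by (simp only: of_nat_le_iff)
  qed
  finally show ?thesis by simp
qed

end

section \<open>Residue classes\<close>

definition cls :: "rat^'n^'n \<Rightarrow> (rat^'n) set \<Rightarrow> (rat^'n) set \<Rightarrow> rat^'n \<Rightarrow> (rat^'n) set" where
  "cls L H B a = {x \<in> B. L *v (x - a) \<in> H}"

definition classes :: "rat^'n^'n \<Rightarrow> (rat^'n) set \<Rightarrow> (rat^'n) set \<Rightarrow> (rat^'n) set set" where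
  "classes L H B = cls L H B ` B"

lemma finite_classes [simp, intro]: "finite B \<Longrightarrow> finite (classes L H B)"
  by (simp add: classes_def)

lemma classes_subset: "P \<in> classes L H B \<Longrightarrow> P \<subseteq> B"
  by (auto simp: classes_def cls_def)

lemma classes_nonempty: "addgroup H \<Longrightarrow> P \<in> classes L H B \<Longrightarrow> P \<noteq> {}"
  using addgroupD(1)[of H] by (force simp: classes_def cls_def)

lemma classes_diff:
  assumes "addgroup H" "P \<in> classes L H B" "x \<in> P" "y \<in> P" shows "L *v (x - y) \<in> H"
proof -
  obtain a where "L *v (x - a) \<in> H" "L *v (y - a) \<in> H" using assms by (auto simp: classes_def cls_def)
  then have "L *v (x - a) - L *v (y - a) \<in> H" by (rule addgroupD(2)[OF assms(1)])
  then show ?thesis by (simp add: matrix_vector_mult_diff_distrib)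
qed

lemma classes_closed:
  assumes "addgroup H" "P \<in> classes L H B" "x \<in> P" "y \<in> B" "L *v (y - x) \<in> H" shows "y \<in> P"
proof -
  obtain a where a: "P = cls L H B a" using assms by (auto simp: classes_def)
  then have "L *v (x - a) \<in> H" using assms by (simp add: cls_def)
  then have "L *v (y - x) + L *v (x - a) \<in> H" using assms by (intro addgroupD(4)[OF assms(1)])
  then have "L *v (y - a) \<in> H" by (simp add: matrix_vector_mult_diff_distrib)
  then show ?thesis using assms a by (simp add: cls_def)
qed

lemma classes_eq:
  assumes "addgroup H" "P \<in> classes L H B" "Q \<in> classes L H B" "x \<in> P" "y \<in> Q" "L *v (x - y) \<in> H"
  shows "P = Q"
proof -
  have "L *v (y - x) \<in> H" using addgroupD(3)[OF assms(1,6)] by (simp add: matrix_vector_mult_diff_distrib)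
  then have yP: "y \<in> P" using assms classes_subset by (metis classes_closed subsetD)
  have sub: "P1 \<subseteq> P2" if h: "P1 \<in> classes L H B" "P2 \<in> classes L H B" "y \<in> P1" "y \<in> P2" for P1 P2
  proof
    fix z assume "z \<in> P1"
    then show "z \<in> P2" using h classes_diff[OF assms(1) h(1), of z y] classes_subset[OF h(1)]
      by (intro classes_closed[OF assms(1) h(2,4)]) auto
  qed
  show ?thesis using sub[OF assms(2,3) yP assms(5)] sub[OF assms(3,2,5) yP] by blast
qed

lemma classes_disjoint:
  assumes "addgroup H" "P \<in> classes L H B" "Q \<in> classes L H B" "P \<noteq> Q" shows "P \<inter> Q = {}"
proof (rule equals0I)
  fix x assume x: "x \<in> P \<inter> Q"
  have "P = Q" by (rule classes_eq[OF assms(1-3), of x x]) (use x addgroupD(1)[OF assms(1)] in auto)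
  then show False using assms by simp
qed

lemma Union_classes: "addgroup H \<Longrightarrow> \<Union>(classes L H B) = B"
  using addgroupD(1)[of H] by (force simp: classes_def cls_def)

lemma sum_card_classes:
  assumes "addgroup H" "finite B" shows "(\<Sum>P\<in>classes L H B. card P) = card B"
proof -
  have "card (\<Union>(classes L H B)) = (\<Sum>P\<in>classes L H B. card P)"
  proof (rule card_Union_disjoint)
    show "pairwise disjnt (classes L H B)"
      using classes_disjoint[OF assms(1)] unfolding pairwise_def disjnt_def by blast
    show "finite P" if "P \<in> classes L H B" for P
      using finite_subset[OF classes_subset[OF that] assms(2)] .
  qed
  then show ?thesis by (simp add: Union_classes[OF assms(1)])
qed

lemma sum_card_classes_real:
  assumes "addgroup H" "finite B" shows "(\<Sum>P\<in>classes L H B. real (card P)) = real (card B)"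
  using sum_card_classes[OF assms, of L] by (metis of_nat_sum)

text \<open>Every class of \<open>A\<close> meets \<open>Q\<close>, and the intersections are
  distinct classes of \<open>Q\<close>.\<close>

lemma card_classes_subset_ge:
  assumes H: "addgroup H" and fin: "finite A" and Q: "Q \<subseteq> A"
    and hit: "\<And>x. x \<in> A \<Longrightarrow> \<exists>y\<in>Q. L *v (y - x) \<in> H"
  shows "card (classes L H A) \<le> card (classes L H Q)"
proof (rule card_inj_on_le[of "\<lambda>P. P \<inter> Q"])
  have mem: "P \<inter> Q \<in> classes L H Q \<and> P \<inter> Q \<noteq> {}" if P: "P \<in> classes L H A" for P
  proof -
    obtain a where a: "a \<in> A" "P = cls L H A a" using P by (auto simp: classes_def)
    obtain y where y: "y \<in> Q" "L *v (y - a) \<in> H" using hit[OF a(1)] by blast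
    have yP: "y \<in> P" using a y Q by (auto simp: cls_def)
    have "P \<inter> Q = cls L H Q y"
    proof (intro equalityI subsetI)
      fix z assume "z \<in> P \<inter> Q"
      then show "z \<in> cls L H Q y" using classes_diff[OF H P _ yP] by (auto simp: cls_def)
    next
      fix z assume "z \<in> cls L H Q y"
      then show "z \<in> P \<inter> Q" using classes_closed[OF H P yP, of z] Q by (auto simp: cls_def)
    qed
    then show ?thesis using y yP by (auto simp: classes_def)
  qed
  show "inj_on (\<lambda>P. P \<inter> Q) (classes L H A)"
  proof (rule inj_onI)
    fix P P' assume h: "P \<in> classes L H A" "P' \<in> classes L H A" "P \<inter> Q = P' \<inter> Q"
    then obtain y where "y \<in> P" "y \<in> P'" using mem[OF h(1)] by blast
    then show "P = P'" using classes_disjoint[OF H h(1,2)] by blast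
  qed
  show "(\<lambda>P. P \<inter> Q) ` classes L H A \<subseteq> classes L H Q" using mem by blast
  show "finite (classes L H Q)" using fin Q finite_subset by blast
qed

definition phi :: "nat \<Rightarrow> real \<Rightarrow> real \<Rightarrow> real" where
  "phi d x y = (x powr (1 / real d) + y powr (1 / real d)) ^ d"

lemma phi_commute: "phi d x y = phi d y x" by (simp add: phi_def add.commute)

lemma phi_scale:
  assumes "c \<ge> 0" "x \<ge> 0" "y \<ge> 0" "d > 0" shows "phi d (c * x) (c * y) = c * phi d x y"
proof -
  have "phi d (c * x) (c * y) = (c powr (1 / real d)) ^ d * phi d x y"
    unfolding phi_def power_mult_distrib[symmetric] using assms by (simp add: powr_mult distrib_left)
  then show ?thesis using assms by (simp add: powr_inverse_power)
qed

lemma phi_mono: "0 \<le> x \<Longrightarrow> x \<le> x' \<Longrightarrow> 0 \<le> y \<Longrightarrow> y \<le> y' \<Longrightarrow> phi d x y \<le> phi d x' y'"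
  unfolding phi_def by (intro power_mono add_mono powr_mono2) auto

text \<open>Equivalently, \<open>(x + t) ^ d - t ^ d\<close> is nondecreasing in
  \<open>t \<ge> 0\<close>: only terms with nonnegative coefficients remain.\<close>

lemma power_add_diff_ge:
  fixes x y y' :: real
  assumes "0 \<le> x" "0 \<le> y" "y \<le> y'" shows "(x + y) ^ d + (y' ^ d - y ^ d) \<le> (x + y') ^ d"
proof (induction d)
  case (Suc d)
  have "y ^ d \<le> (x + y) ^ d" using assms by (intro power_mono) auto
  then have "y ^ d * (y' - y) \<le> (x + y) ^ d * (y' - y)" using assms by (intro mult_right_mono) auto
  moreover have "(x + y') * ((x + y) ^ d + (y' ^ d - y ^ d)) \<le> (x + y') * (x + y') ^ d"
    using Suc assms by (intro mult_left_mono) auto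
  moreover have "x * (y' ^ d - y ^ d) \<ge> 0" using assms by (auto intro!: mult_nonneg_nonneg power_mono)
  ultimately show ?case by (simp add: algebra_simps)
qed simp

text \<open>The points of a class beyond its guaranteed minimum are gained in full, which produces
  the surplus on the smallest class.\<close>

lemma phi_increment:
  assumes "0 \<le> x" "0 \<le> y" "y \<le> y'" "d > 0" shows "phi d x y + (y' - y) \<le> phi d x y'"
proof -
  have "(y' powr (1 / real d)) ^ d = y'" "(y powr (1 / real d)) ^ d = y" using assms by (simp_all add: powr_inverse_power)
  then show ?thesis unfolding phi_def
    using power_add_diff_ge[of "x powr (1 / real d)" "y powr (1 / real d)" "y' powr (1 / real d)" d] assms
    by (simp add: powr_mono2)
qed

text \<open>Each term is bounded by the tangent of the concave power at the mean, in the form of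
  Young's inequality with second factor 1.\<close>

lemma sum_powr_le:
  fixes a :: "'i \<Rightarrow> real"
  assumes I: "finite I" "I \<noteq> {}" and a: "\<And>i. i \<in> I \<Longrightarrow> a i > 0" and \<sigma>: "0 \<le> \<sigma>" "\<sigma> \<le> 1"
  shows "(\<Sum>i\<in>I. a i powr (1 - \<sigma>)) \<le> real (card I) powr \<sigma> * (\<Sum>i\<in>I. a i) powr (1 - \<sigma>)"
proof -
  define m where "m = real (card I)"
  define n where "n = (\<Sum>i\<in>I. a i)"
  have m: "m > 0" using I by (simp add: m_def card_gt_0_iff)
  have n: "n > 0" unfolding n_def using I a by (intro sum_pos) auto
  have "(\<Sum>i\<in>I. a i powr (1 - \<sigma>)) \<le> (\<Sum>i\<in>I. (n / m) powr (1 - \<sigma>) * ((1 - \<sigma>) * (a i * m / n) + \<sigma>))"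
  proof (rule sum_mono)
    fix i assume i: "i \<in> I"
    have "a i powr (1 - \<sigma>) = (n / m) powr (1 - \<sigma>) * (a i * m / n) powr (1 - \<sigma>)"
      using a[OF i] m n by (subst powr_mult[symmetric]) auto
    also have "(a i * m / n) powr (1 - \<sigma>) * 1 powr \<sigma> \<le> (1 - \<sigma>) * (a i * m / n) + \<sigma> * 1"
      using a[OF i] m n \<sigma> by (intro Youngs_inequality_0) auto
    then have "(n / m) powr (1 - \<sigma>) * (a i * m / n) powr (1 - \<sigma>) \<le> (n / m) powr (1 - \<sigma>) * ((1 - \<sigma>) * (a i * m / n) + \<sigma>)"
      by (intro mult_left_mono) auto
    finally show "a i powr (1 - \<sigma>) \<le> (n / m) powr (1 - \<sigma>) * ((1 - \<sigma>) * (a i * m / n) + \<sigma>)" .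
  qed
  also have "\<dots> = (n / m) powr (1 - \<sigma>) * ((1 - \<sigma>) * ((\<Sum>i\<in>I. a i) * m / n) + m * \<sigma>)"
    unfolding sum_distrib_left[symmetric] sum.distrib by (simp add: sum_distrib_left[symmetric] sum_distrib_right[symmetric] sum_divide_distrib[symmetric] m_def)
  also have "\<dots> = (n / m) powr (1 - \<sigma>) * m" using n by (simp add: n_def[symmetric] algebra_simps)
  also have "\<dots> = m powr \<sigma> * n powr (1 - \<sigma>)"
  proof -
    have "m = m powr (1 - \<sigma>) * m powr \<sigma>" using m by (simp add: powr_add[symmetric])
    then have "(n / m) powr (1 - \<sigma>) * m = (n / m) powr (1 - \<sigma>) * (m powr (1 - \<sigma>) * m powr \<sigma>)" by simp
    also have "\<dots> = ((n / m) powr (1 - \<sigma>) * m powr (1 - \<sigma>)) * m powr \<sigma>" by simp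
    also have "(n / m) powr (1 - \<sigma>) * m powr (1 - \<sigma>) = n powr (1 - \<sigma>)" using m n by (subst powr_mult[symmetric]) auto
    finally show ?thesis by (simp add: mult.commute)
  qed
  finally show ?thesis unfolding m_def n_def .
qed

context lin_pair
begin

lemma G_mono: "finite B' \<Longrightarrow> finite C' \<Longrightarrow> B \<subseteq> B' \<Longrightarrow> C \<subseteq> C' \<Longrightarrow> G B C \<le> G B' C'"
  unfolding G_def by (intro card_mono sumset_mono) auto

lemma G_ge_card:
  assumes "finite B" "finite C"
  shows "B \<noteq> {} \<Longrightarrow> card C \<le> G B C" "C \<noteq> {} \<Longrightarrow> card B \<le> G B C"
  unfolding G_def
  using card_sumset_ge_right[of "(*v) L1 ` B" "(*v) L2 ` C"] card_sumset_ge_left[of "(*v) L1 ` B" "(*v) L2 ` C"] assms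
  by auto

text \<open>\<open>L2 C\<close> lies in one coset of \<open>H\<close>, so the sumsets of different
  \<open>L1\<close>-classes lie in different cosets.\<close>

lemma G_split:
  assumes H: "addgroup H" and fin: "finite B" "finite C" and C: "\<And>x y. x \<in> C \<Longrightarrow> y \<in> C \<Longrightarrow> L2 *v (x - y) \<in> H"
  shows "G B C = (\<Sum>P\<in>classes L1 H B. G P C)"
proof -
  have eq: "sumset ((*v) L1 ` B) ((*v) L2 ` C) = (\<Union>P\<in>classes L1 H B. sumset ((*v) L1 ` P) ((*v) L2 ` C))"
  proof (intro equalityI subsetI)
    fix z assume "z \<in> sumset ((*v) L1 ` B) ((*v) L2 ` C)"
    then obtain b c where bc: "b \<in> B" "c \<in> C" "z = L1 *v b + L2 *v c" by (auto elim!: sumsetE)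
    have "b \<in> \<Union>(classes L1 H B)" using bc by (simp add: Union_classes[OF H])
    then obtain P where P: "P \<in> classes L1 H B" "b \<in> P" by blast
    then have "z \<in> sumset ((*v) L1 ` P) ((*v) L2 ` C)" unfolding bc(3) using bc(2) by (intro sumsetI imageI)
    then show "z \<in> (\<Union>P\<in>classes L1 H B. sumset ((*v) L1 ` P) ((*v) L2 ` C))" using P(1) by (rule UN_I[rotated])
  next
    fix z assume "z \<in> (\<Union>P\<in>classes L1 H B. sumset ((*v) L1 ` P) ((*v) L2 ` C))"
    then obtain P where P: "P \<in> classes L1 H B" "z \<in> sumset ((*v) L1 ` P) ((*v) L2 ` C)" by blast
    have "sumset ((*v) L1 ` P) ((*v) L2 ` C) \<subseteq> sumset ((*v) L1 ` B) ((*v) L2 ` C)"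
      using classes_subset[OF P(1)] by (intro sumset_mono image_mono) auto
    then show "z \<in> sumset ((*v) L1 ` B) ((*v) L2 ` C)" using P(2) by blast
  qed
  show ?thesis unfolding G_def eq
  proof (rule card_UN_disjoint)
    show "finite (classes L1 H B)" using fin by simp
    show "\<forall>P\<in>classes L1 H B. finite (sumset ((*v) L1 ` P) ((*v) L2 ` C))"
    proof
      fix P assume "P \<in> classes L1 H B"
      then have "finite P" using finite_subset[OF classes_subset fin(1)] by blast
      then show "finite (sumset ((*v) L1 ` P) ((*v) L2 ` C))" using fin by simp
    qed
    show "\<forall>P\<in>classes L1 H B. \<forall>Q\<in>classes L1 H B. P \<noteq> Q \<longrightarrow>
        sumset ((*v) L1 ` P) ((*v) L2 ` C) \<inter> sumset ((*v) L1 ` Q) ((*v) L2 ` C) = {}"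
    proof (intro ballI impI equals0I)
      fix P Q z assume PQ: "P \<in> classes L1 H B" "Q \<in> classes L1 H B" "P \<noteq> Q"
        and "z \<in> sumset ((*v) L1 ` P) ((*v) L2 ` C) \<inter> sumset ((*v) L1 ` Q) ((*v) L2 ` C)"
      then obtain x c y c' where h: "x \<in> P" "c \<in> C" "y \<in> Q" "c' \<in> C" "L1 *v x + L2 *v c = L1 *v y + L2 *v c'"
        by (auto elim!: sumsetE)
      have "L1 *v x - L1 *v y = L2 *v c' - L2 *v c" using h(5) by (simp add: algebra_simps)
      then have "L1 *v (x - y) = L2 *v (c' - c)" by (simp add: matrix_vector_mult_diff_distrib)
      then have "L1 *v (x - y) \<in> H" using C[OF h(4,2)] by simp
      then show False using classes_eq[OF H PQ(1,2) h(1,3)] PQ(3) by simp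
    qed
  qed
qed

end

lemma (in coprime_lin_pair) G_swap: "lin_pair.G L2 L1 B C = G C B"
proof -
  interpret sw: coprime_lin_pair L2 L1 by (rule coprime_lin_pair_swap)
  show ?thesis unfolding sw.G_def G_def by (simp add: sumset_commute)
qed

lemma (in coprime_lin_pair) G_split':
  assumes H: "addgroup H" and fin: "finite B" "finite C" and C: "\<And>x y. x \<in> C \<Longrightarrow> y \<in> C \<Longrightarrow> L1 *v (x - y) \<in> H"
  shows "G C B = (\<Sum>P\<in>classes L2 H B. G C P)"
proof -
  interpret sw: coprime_lin_pair L2 L1 by (rule coprime_lin_pair_swap)
  show ?thesis using sw.G_split[OF assms] unfolding G_swap .
qed

context coprime_lin_pair
begin

definition \<Gamma> :: "(rat^'n) set \<Rightarrow> (rat^'n) set" where "\<Gamma> A = zspan (diffset A A)"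

text \<open>The kernel of the map from \<open>\<Gamma> A\<close> to
  \<open>(L1 \<Gamma> + L2 \<Gamma>) / L1 \<Gamma>\<close> induced by \<open>L2\<close>, so that its
  index in \<open>\<Gamma> A\<close> is that of \<open>L1 \<Gamma>\<close> in
  \<open>L1 \<Gamma> + L2 \<Gamma>\<close>.\<close>

definition \<Lambda> :: "(rat^'n) set \<Rightarrow> (rat^'n) set" where
  "\<Lambda> A = {x \<in> \<Gamma> A. L2 *v x \<in> (*v) L1 ` \<Gamma> A}"

lemma diff_mem_\<Gamma>: "x \<in> A \<Longrightarrow> y \<in> A \<Longrightarrow> x - y \<in> \<Gamma> A"
  unfolding \<Gamma>_def using zspan_superset[of "diffset A A"] by (auto simp: diffset_def)

lemma addgroup_\<Gamma>: "addgroup (\<Gamma> A)" "addgroup ((*v) L ` \<Gamma> A)"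
  unfolding \<Gamma>_def by (intro addgroup_zspan addgroup_matrix_image)+

lemma addgroup_\<Lambda>: "addgroup (\<Lambda> A)" "addgroup ((*v) L ` \<Lambda> A)"
proof -
  show "addgroup (\<Lambda> A)" unfolding addgroup_def \<Lambda>_def
  proof (intro conjI ballI CollectI)
    show "0 \<in> \<Gamma> A" "L2 *v 0 \<in> (*v) L1 ` \<Gamma> A"
      using addgroupD(1)[OF addgroup_\<Gamma>(1)] addgroupD(1)[OF addgroup_\<Gamma>(2)] by simp_all
    fix x y assume "x \<in> {x \<in> \<Gamma> A. L2 *v x \<in> (*v) L1 ` \<Gamma> A}" "y \<in> {x \<in> \<Gamma> A. L2 *v x \<in> (*v) L1 ` \<Gamma> A}"
    then have xy: "x \<in> \<Gamma> A" "y \<in> \<Gamma> A" "L2 *v x \<in> (*v) L1 ` \<Gamma> A" "L2 *v y \<in> (*v) L1 ` \<Gamma> A" by blast+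
    show "x - y \<in> \<Gamma> A" by (rule addgroupD(2)[OF addgroup_\<Gamma>(1) xy(1,2)])
    show "L2 *v (x - y) \<in> (*v) L1 ` \<Gamma> A"
      unfolding matrix_vector_mult_diff_distrib by (rule addgroupD(2)[OF addgroup_\<Gamma>(2) xy(3,4)])
  qed
  then show "addgroup ((*v) L ` \<Lambda> A)" by (rule addgroup_matrix_image)
qed

lemma class_diff_\<Lambda>:
  assumes "Q \<in> classes L2 ((*v) L1 ` \<Gamma> A) A" "x \<in> Q" "y \<in> Q"
  shows "x - y \<in> \<Lambda> A"
proof -
  have "x - y \<in> \<Gamma> A" using classes_subset[OF assms(1)] assms(2,3) by (intro diff_mem_\<Gamma>) auto
  then show ?thesis unfolding \<Lambda>_def using classes_diff[OF addgroup_\<Gamma>(2) assms] by blast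
qed

text \<open>
  If the \<open>L2\<close>-image of \<open>Q\<close> modulo \<open>L1 \<Lambda>\<close> is stable under translation by \<open>L1 (A - y0)\<close>, it is a full coset
  of \<open>L1 \<Gamma>\<close> and coprimality bounds its size; otherwise a translate escapes and contributes the gain.
\<close>

lemma class_gain_or_index:
  assumes fin: "finite A" and two: "a \<in> A" "b \<in> A" "a \<noteq> b"
    and Q: "Q \<in> classes L2 ((*v) L1 ` \<Gamma> A) A"
  shows "(\<exists>Q'\<in>classes L2 ((*v) L1 ` \<Gamma> A) A. G Q Q + card Q' \<le> G A Q) \<or>
    \<bar>det L1\<bar> \<le> of_nat (card (classes L2 ((*v) L1 ` \<Lambda> A) Q))"
proof -
  define H' where "H' = (*v) L1 ` \<Lambda> A"
  have grpH': "addgroup H'" unfolding H'_def by (rule addgroup_\<Lambda>(2))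
  have QA: "Q \<subseteq> A" by (rule classes_subset[OF Q])
  have finQ: "finite Q" using finite_subset[OF QA fin] .
  obtain y0 where y0: "y0 \<in> Q" using classes_nonempty[OF addgroup_\<Gamma>(2) Q] by blast
  define W where "W = sumset ((*v) L2 ` Q) H'"
  have WH: "w + h \<in> W" if wh: "w \<in> W" "h \<in> H'" for w h
  proof -
    obtain q h0 where q: "q \<in> (*v) L2 ` Q" "h0 \<in> H'" "w = q + h0" using wh(1) unfolding W_def by (rule sumsetE)
    have "w + h = q + (h0 + h)" using q(3) by simp
    also have "\<dots> \<in> W" unfolding W_def by (rule sumsetI[OF q(1) addgroupD(4)[OF grpH' q(2) wh(2)]])
    finally show ?thesis .
  qed
  have QW: "L2 *v y \<in> W" if "y \<in> Q" for y
    unfolding W_def using sumsetI[OF imageI[OF that] addgroupD(1)[OF grpH'], of "(*v) L2"] by simp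
  show ?thesis
  proof (cases "\<exists>y\<in>Q. \<exists>x\<in>A. L2 *v y + L1 *v (x - y0) \<notin> W")
    case True
    then obtain y x where yx: "y \<in> Q" "x \<in> A" "L2 *v y + L1 *v (x - y0) \<notin> W" by blast
    have "x \<in> \<Union>(classes L2 ((*v) L1 ` \<Gamma> A) A)" using yx(2) by (simp add: Union_classes[OF addgroup_\<Gamma>(2)])
    then obtain Q' where Q': "Q' \<in> classes L2 ((*v) L1 ` \<Gamma> A) A" "x \<in> Q'" by blast
    have finQ': "finite Q'" using finite_subset[OF classes_subset[OF Q'(1)] fin] .
    \<comment> \<open>Differences inside the class \<open>Q'\<close> of \<open>x\<close> lie in
      \<open>\<Lambda> A\<close>, so with \<open>x\<close> all of \<open>Q'\<close> escapes, and
      \<open>L1 Q' + L2 y\<close> is disjoint from the sumset of \<open>Q\<close>.\<close>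
    define N where "N = (\<lambda>x'. L1 *v x' + L2 *v y) ` Q'"
    have cN: "card N = card Q'" unfolding N_def
      using inj_L(1) by (intro card_image) (auto simp: inj_on_def)
    have disj: "sumset ((*v) L1 ` Q) ((*v) L2 ` Q) \<inter> N = {}"
    proof (rule equals0I)
      fix z assume "z \<in> sumset ((*v) L1 ` Q) ((*v) L2 ` Q) \<inter> N"
      then obtain u w x' where h: "u \<in> Q" "w \<in> Q" "x' \<in> Q'" "L1 *v u + L2 *v w = L1 *v x' + L2 *v y"
        by (auto simp: N_def elim!: sumsetE)
      have m: "L1 *v (u - y0) \<in> H'" "L1 *v (x - x') \<in> H'"
        unfolding H'_def using class_diff_\<Lambda>[OF Q h(1) y0] class_diff_\<Lambda>[OF Q'(1) Q'(2) h(3)] by auto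
      have "L2 *v y + L1 *v (x - y0) = L2 *v w + (L1 *v (u - y0) + L1 *v (x - x'))"
        using h(4) by (simp add: matrix_vector_mult_diff_distrib algebra_simps)
      also have "\<dots> \<in> W" by (rule WH[OF QW[OF h(2)] addgroupD(4)[OF grpH' m]])
      finally show False using yx(3) by simp
    qed
    have "G Q Q + card Q' = card (sumset ((*v) L1 ` Q) ((*v) L2 ` Q) \<union> N)"
      unfolding G_def cN[symmetric] using finQ finQ' disj by (intro card_Un_disjoint[symmetric]) (auto simp: N_def)
    also have "\<dots> \<le> G A Q" unfolding G_def
    proof (rule card_mono)
      show "finite (sumset ((*v) L1 ` A) ((*v) L2 ` Q))" using fin finQ by simp
      have "N \<subseteq> sumset ((*v) L1 ` A) ((*v) L2 ` Q)"
        unfolding N_def using classes_subset[OF Q'(1)] yx(1) by (auto intro!: sumsetI)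
      moreover have "sumset ((*v) L1 ` Q) ((*v) L2 ` Q) \<subseteq> sumset ((*v) L1 ` A) ((*v) L2 ` Q)"
        using QA by (intro sumset_mono) auto
      ultimately show "sumset ((*v) L1 ` Q) ((*v) L2 ` Q) \<union> N \<subseteq> sumset ((*v) L1 ` A) ((*v) L2 ` Q)" by blast
    qed
    finally show ?thesis using Q'(1) by blast
  next
    case False
    \<comment> \<open>The translations \<open>L1 g\<close> that map \<open>W\<close> into itself.
      The aim is that they include all of \<open>L1 \<Gamma>\<close>.\<close>
    define S where "S = {g. \<forall>w\<in>W. w + L1 *v g \<in> W}"
    have Sadd: "g + g' \<in> S" if "g \<in> S" "g' \<in> S" for g g'
      unfolding S_def
    proof (intro CollectI ballI)
      fix w assume "w \<in> W"
      then have "(w + L1 *v g) + L1 *v g' \<in> W" using that by (simp add: S_def)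
      then show "w + L1 *v (g + g') \<in> W" by (simp add: matrix_vector_right_distrib add.assoc)
    qed
    have Szero: "0 \<in> S" by (simp add: S_def)
    have Smult: "of_nat k *s g \<in> S" if "g \<in> S" for g and k :: nat
    proof (induction k)
      case 0 then show ?case using Szero by simp
    next
      case (Suc k)
      have "of_nat (Suc k) *s g = g + of_nat k *s g" by (simp add: vec.scale_left_distrib)
      then show ?case using Sadd[OF that Suc] by (simp only:)
    qed
    \<comment> \<open>\<open>W\<close> is a finite union of cosets of \<open>H'\<close>, so some
      positive multiple \<open>t\<close> of \<open>L1 g\<close> lies in \<open>H'\<close>; moving
      back by \<open>g\<close> amounts to moving forward by \<open>(t - 1) g\<close>.\<close>
    have Sneg: "- g \<in> S" if g: "g \<in> S" for g
      unfolding S_def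
    proof (intro CollectI ballI)
      fix w assume w: "w \<in> W"
      have "of_nat k *s (L1 *v g) \<in> sumset H' ((\<lambda>y. L2 *v y - w) ` Q)" for k
      proof -
        have "w + L1 *v (of_nat k *s g) \<in> W" using Smult[OF g, of k] w by (simp add: S_def)
        then obtain y h where yh: "y \<in> Q" "h \<in> H'" "w + L1 *v (of_nat k *s g) = L2 *v y + h"
          unfolding W_def by (auto elim!: sumsetE)
        have "of_nat k *s (L1 *v g) = h + (L2 *v y - w)"
          using yh(3) by (simp add: vector_scalar_commute algebra_simps)
        then show ?thesis using sumsetI[OF yh(2) imageI[OF yh(1)], of "\<lambda>y. L2 *v y - w"] by (simp only:)
      qed
      then obtain t :: nat where t: "t > 0" "of_nat t *s (L1 *v g) \<in> H'"
        by (rule multiple_mem_of_finite_cosets[OF grpH' finite_imageI[OF finQ]])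
      have "(w + L1 *v (of_nat (t - 1) *s g)) + - (of_nat t *s (L1 *v g)) \<in> W"
      proof (rule WH[OF _ addgroupD(3)[OF grpH' t(2)]])
        show "w + L1 *v (of_nat (t - 1) *s g) \<in> W" using Smult[OF g, of "t - 1"] w unfolding S_def by blast
      qed
      also have "(w + L1 *v (of_nat (t - 1) *s g)) + - (of_nat t *s (L1 *v g)) = w + L1 *v (- g)"
      proof -
        have "rat_of_nat t = of_nat (t - 1) + 1" using t(1) by (simp add: of_nat_diff)
        then have "of_nat t *s (L1 *v g) = of_nat (t - 1) *s (L1 *v g) + L1 *v g"
          by (simp only: vec.scale_left_distrib vec.scale_one)
        moreover have "L1 *v (of_nat (t - 1) *s g) = of_nat (t - 1) *s (L1 *v g)" by (simp add: vector_scalar_commute)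
        moreover have "L1 *v (- g) = - (L1 *v g)"
          using matrix_vector_mult_diff_distrib[of L1 0 g] by simp
        ultimately show ?thesis by simp
      qed
      finally show "w + L1 *v (- g) \<in> W" .
    qed
    have grpS: "addgroup S" unfolding addgroup_def
    proof (intro conjI ballI)
      fix x y assume "x \<in> S" "y \<in> S"
      then have "x + (- y) \<in> S" using Sadd Sneg by blast
      then show "x - y \<in> S" by simp
    qed (rule Szero)
    have base: "x - y0 \<in> S" if "x \<in> A" for x
      unfolding S_def
    proof (intro CollectI ballI)
      fix w assume "w \<in> W"
      then obtain y h where yh: "y \<in> Q" "h \<in> H'" "w = L2 *v y + h" unfolding W_def by (auto elim!: sumsetE)
      have "L2 *v y + L1 *v (x - y0) \<in> W" using False yh(1) that by blast
      then have "(L2 *v y + L1 *v (x - y0)) + h \<in> W" using yh(2) by (rule WH)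
      then show "w + L1 *v (x - y0) \<in> W" unfolding yh(3) by (simp add: ac_simps)
    qed
    have "diffset A A \<subseteq> S"
    proof
      fix z assume "z \<in> diffset A A"
      then obtain x x' where "x \<in> A" "x' \<in> A" "z = (x - y0) - (x' - y0)" by (auto simp: diffset_def)
      then show "z \<in> S" using addgroupD(2)[OF grpS] base by blast
    qed
    then have \<Gamma>S: "\<Gamma> A \<subseteq> S" unfolding \<Gamma>_def using grpS by (intro zspan_minimal)
    define \<C> where "\<C> = classes L2 H' Q"
    have fin\<C>: "finite \<C>" using finQ by (simp add: \<C>_def)
    have "\<forall>C\<in>\<C>. \<exists>y g. y \<in> C \<and> g \<in> \<Gamma> A \<and> L2 *v (y - y0) = L1 *v g"
    proof
      fix C assume C: "C \<in> \<C>"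
      obtain y where y: "y \<in> C" using classes_nonempty[OF grpH'] C unfolding \<C>_def by blast
      then have "y \<in> Q" using classes_subset C unfolding \<C>_def by blast
      then have "L2 *v (y - y0) \<in> (*v) L1 ` \<Gamma> A" using classes_diff[OF addgroup_\<Gamma>(2) Q _ y0] by blast
      then show "\<exists>y g. y \<in> C \<and> g \<in> \<Gamma> A \<and> L2 *v (y - y0) = L1 *v g" using y by blast
    qed
    from bchoice[OF this] obtain ry where ry: "\<forall>C\<in>\<C>. \<exists>g. ry C \<in> C \<and> g \<in> \<Gamma> A \<and> L2 *v (ry C - y0) = L1 *v g" ..
    from bchoice[OF ry] obtain rg where rg: "\<forall>C\<in>\<C>. ry C \<in> C \<and> rg C \<in> \<Gamma> A \<and> L2 *v (ry C - y0) = L1 *v rg C" ..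
    have r: "\<And>C. C \<in> \<C> \<Longrightarrow> ry C \<in> C" "\<And>C. C \<in> \<C> \<Longrightarrow> rg C \<in> \<Gamma> A"
      "\<And>C. C \<in> \<C> \<Longrightarrow> L2 *v (ry C - y0) = L1 *v rg C" using rg by simp_all
    \<comment> \<open>\<open>L2 y0 + L1 g\<close> stays in \<open>W\<close>, so it falls into the
      coset of some class \<open>C\<close> of \<open>Q\<close>, and then \<open>g\<close> and
      \<open>rg C\<close> agree modulo \<open>\<Lambda> A\<close>.\<close>
    have cov: "\<Gamma> A \<subseteq> sumset (\<Lambda> A) (rg ` \<C>)"
    proof
      fix g assume "g \<in> \<Gamma> A"
      then have "g \<in> S" using \<Gamma>S by blast
      then have "L2 *v y0 + L1 *v g \<in> W" using QW[OF y0] unfolding S_def by blast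
      then obtain y h where yh: "y \<in> Q" "h \<in> H'" "L2 *v y0 + L1 *v g = L2 *v y + h" unfolding W_def by (auto elim!: sumsetE)
      have "y \<in> \<Union>\<C>" using yh(1) unfolding \<C>_def by (simp add: Union_classes[OF grpH'])
      then obtain C where C: "C \<in> \<C>" "y \<in> C" by blast
      have "L2 *v (y - ry C) \<in> H'" using classes_diff[OF grpH' _ C(2) r(1)[OF C(1)]] C(1) unfolding \<C>_def by blast
      then have "L2 *v (y - ry C) + h \<in> H'" using yh(2) by (rule addgroupD(4)[OF grpH'])
      then obtain l where l: "l \<in> \<Lambda> A" "L2 *v (y - ry C) + h = L1 *v l" unfolding H'_def by blast
      have "L1 *v g = (L2 *v y + h) - L2 *v y0" unfolding yh(3)[symmetric] by simp
      also have "\<dots> = (L2 *v (y - ry C) + h) + L2 *v (ry C - y0)" unfolding matrix_vector_mult_diff_distrib by simp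
      also have "\<dots> = L1 *v (l + rg C)" unfolding l(2) r(3)[OF C(1)] matrix_vector_right_distrib ..
      finally have "g = l + rg C" by (rule injD[OF inj_L(1)])
      then show "g \<in> sumset (\<Lambda> A) (rg ` \<C>)" using sumsetI[OF l(1) imageI[OF C(1)], of rg] by (simp only:)
    qed
    have ne: "zspan (diffset A A) \<noteq> {0}"
    proof
      assume "zspan (diffset A A) = {0}"
      then have "a - b \<in> {0}" using diff_mem_\<Gamma>[OF two(1,2)] unfolding \<Gamma>_def by blast
      then show False using two(3) by simp
    qed
    have "\<bar>det L1\<bar> \<le> of_nat (card (rg ` \<C>))"
      by (rule index_ge_det[OF finite_diffset[OF fin fin] ne finite_imageI[OF fin\<C>] cov[unfolded \<Lambda>_def \<Gamma>_def]])
    also have "\<dots> \<le> of_nat (card \<C>)" by (rule of_nat_mono[OF card_image_le[OF fin\<C>]])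
    finally show ?thesis unfolding \<C>_def H'_def by (rule disjI2)
  qed
qed

end

section \<open>Induction on the cardinality\<close>

text \<open>\<open>\<epsilon>\<close> is chosen so that a gain of \<open>n / (2 K)\<close> outweighs
  \<open>4 \<epsilon>\<close> times any error below \<open>2 K n\<close>; \<open>\<sigma>\<close> so
  that splitting into at most \<open>2 K\<close> classes costs a factor
  \<open>1 + \<epsilon>\<close>. The first bound on \<open>D\<close> absorbs up to
  \<open>(2 K)^2\<close> Brunn--Minkowski errors into \<open>\<epsilon>\<close> times the error, the
  second makes the claim trivial for singletons.\<close>

locale ind_setup = coprime_lin_pair L1 L2 for L1 L2 :: "rat^'n^'n" +
  fixes K D \<sigma> \<epsilon> E \<tau> :: real
  assumes K: "K = phi CARD('n) (of_rat \<bar>det L1\<bar>) (of_rat \<bar>det L2\<bar>)" and K1: "K \<ge> 1"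
    and BM: "\<And>A B C. finite A \<Longrightarrow> real (G A A) \<le> K * real (card A) \<Longrightarrow> B \<subseteq> A \<Longrightarrow> C \<subseteq> A \<Longrightarrow> B \<noteq> {} \<Longrightarrow> C \<noteq> {} \<Longrightarrow>
      phi CARD('n) (real (card B)) (real (card C)) \<le> real (G B C) + E * real (card A) powr (1 - \<tau>)"
    and \<epsilon>: "\<epsilon> = 1 / (16 * K\<^sup>2)" and \<sigma>: "0 < \<sigma>" "\<sigma> \<le> \<tau>" "\<tau> < 1" and pow: "(2 * K) powr \<sigma> \<le> 1 + \<epsilon>"
    and D: "4 * K\<^sup>2 * E \<le> \<epsilon> * D" "2 * K \<le> D" and E: "E > 0"
begin

definition err :: "nat \<Rightarrow> real" where "err n = D * real n powr (1 - \<sigma>)"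

definition good :: "real \<Rightarrow> (rat^'n) set \<Rightarrow> bool" where
  "good \<theta> A \<longleftrightarrow> real (G A A) \<ge> K * real (card A) - \<theta> * err (card A)"

definition IH :: "nat \<Rightarrow> bool" where "IH n \<longleftrightarrow> (\<forall>B. finite B \<longrightarrow> card B < n \<longrightarrow> good 1 B)"

lemma eps_bounds: "\<epsilon> > 0" "\<epsilon> \<le> 1 / 16" "4 * \<epsilon> * (2 * K) \<le> 1 / (2 * K)" "5 * \<epsilon> \<le> 1 / (2 * K)"
proof -
  have K2: "K\<^sup>2 \<ge> 1" using K1 by simp
  show "\<epsilon> > 0" unfolding \<epsilon> using K1 by simp
  show "\<epsilon> \<le> 1 / 16" unfolding \<epsilon> using K2 by (intro divide_left_mono) auto
  show "4 * \<epsilon> * (2 * K) \<le> 1 / (2 * K)" unfolding \<epsilon> using K1 by (simp add: field_simps power2_eq_square)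
  have "K \<le> K\<^sup>2" using K1 by (simp add: power2_eq_square)
  then show "5 * \<epsilon> \<le> 1 / (2 * K)" unfolding \<epsilon> using K1 by (simp add: field_simps power2_eq_square)
qed

lemma D_pos: "D > 0" using D(2) K1 by linarith

lemma err_nonneg: "err n \<ge> 0" unfolding err_def using D_pos by simp

lemma err_mono: "m \<le> n \<Longrightarrow> err m \<le> err n"
  unfolding err_def using D_pos \<sigma> by (intro mult_left_mono powr_mono2) auto

lemma good_trivial: "K * real (card A) \<le> \<theta> * err (card A) \<Longrightarrow> good \<theta> A"
  unfolding good_def by (smt (verit) of_nat_0_le_iff)

lemma IH_mono: "IH n \<Longrightarrow> m \<le> n \<Longrightarrow> IH m" unfolding IH_def by auto

text \<open>Puts a putative counterexample in the regime where proportional gains dominate the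
  error.\<close>

lemma not_good_bounds:
  assumes "finite A" "\<not> good \<theta> A" "\<theta> \<ge> 1 / 2"
  shows "err (card A) < 2 * K * real (card A)" "card A \<ge> 2"
proof -
  have n: "\<not> K * real (card A) \<le> \<theta> * err (card A)" using good_trivial assms(2) by blast
  have "(1 / 2) * err (card A) \<le> \<theta> * err (card A)" using assms(3) err_nonneg by (intro mult_right_mono) auto
  then show e: "err (card A) < 2 * K * real (card A)" using n by linarith
  show "card A \<ge> 2"
  proof (rule ccontr)
    assume "\<not> card A \<ge> 2"
    then consider "card A = 0" | "card A = 1" by linarith
    then show False using e D(2) by cases (auto simp: err_def)
  qed
qed

text \<open>The deficit \<open>1 + \<epsilon> - \<theta>\<close> is at most
  \<open>4 \<epsilon>\<close>, and \<open>4 \<epsilon> * 2 K = 1 / (2 K)\<close>.\<close>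

lemma good_of_gain:
  assumes g: "real (G A A) \<ge> K * real (card A) - (1 + \<epsilon>) * err (card A) + real (card A) / (2 * K)"
    and \<theta>: "\<theta> \<ge> 1 - 3 * \<epsilon>" and e: "err (card A) < 2 * K * real (card A)"
  shows "good \<theta> A"
proof -
  have "(1 + \<epsilon> - \<theta>) * err (card A) \<le> (4 * \<epsilon>) * err (card A)" using \<theta> err_nonneg by (intro mult_right_mono) auto
  also have "\<dots> \<le> (4 * \<epsilon>) * (2 * K * real (card A))" using e eps_bounds by (intro mult_left_mono) auto
  also have "\<dots> = (4 * \<epsilon> * (2 * K)) * real (card A)" by simp
  also have "\<dots> \<le> (1 / (2 * K)) * real (card A)" using eps_bounds by (intro mult_right_mono) auto
  finally have "(1 + \<epsilon>) * err (card A) - \<theta> * err (card A) \<le> real (card A) / (2 * K)" by (simp add: algebra_simps)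
  then show ?thesis using g unfolding good_def by linarith
qed

lemma sum_err_classes:
  assumes H: "addgroup H" and fin: "finite A" and ne: "A \<noteq> {}" and c: "real (card (classes L H A)) \<le> 2 * K"
  shows "(\<Sum>P\<in>classes L H A. err (card P)) \<le> (1 + \<epsilon>) * err (card A)"
proof -
  have neC: "classes L H A \<noteq> {}" using ne by (simp add: classes_def)
  have pos: "real (card P) > 0" if "P \<in> classes L H A" for P
    using classes_nonempty[OF H that] finite_subset[OF classes_subset[OF that] fin] by (simp add: card_gt_0_iff)
  have "(\<Sum>P\<in>classes L H A. real (card P) powr (1 - \<sigma>)) \<le>
      real (card (classes L H A)) powr \<sigma> * (\<Sum>P\<in>classes L H A. real (card P)) powr (1 - \<sigma>)"
    using fin neC pos \<sigma> by (intro sum_powr_le) auto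
  also have "\<dots> \<le> (1 + \<epsilon>) * real (card A) powr (1 - \<sigma>)"
  proof -
    have "real (card (classes L H A)) powr \<sigma> \<le> (2 * K) powr \<sigma>" using c \<sigma> by (intro powr_mono2) auto
    then have "real (card (classes L H A)) powr \<sigma> \<le> 1 + \<epsilon>" using pow by linarith
    then show ?thesis unfolding sum_card_classes_real[OF H fin] by (intro mult_right_mono) auto
  qed
  finally have "D * (\<Sum>P\<in>classes L H A. real (card P) powr (1 - \<sigma>)) \<le> D * ((1 + \<epsilon>) * real (card A) powr (1 - \<sigma>))"
    using D_pos by (intro mult_left_mono) auto
  then show ?thesis unfolding err_def by (simp add: sum_distrib_left algebra_simps)
qed

lemma card_classes_le:
  assumes H: "addgroup H" and fin: "finite A" and ne: "A \<noteq> {}"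
    and big: "\<And>P. P \<in> classes L H A \<Longrightarrow> real (card P) \<ge> real (card A) / (2 * K)"
  shows "real (card (classes L H A)) \<le> 2 * K"
proof -
  have "real (card (classes L H A)) * (real (card A) / (2 * K)) \<le> (\<Sum>P\<in>classes L H A. real (card P))"
    using sum_mono[of "classes L H A" "\<lambda>_. real (card A) / (2 * K)" "\<lambda>P. real (card P)"] big by simp
  also have "\<dots> = real (card A)" by (rule sum_card_classes_real[OF H fin])
  finally have "real (card (classes L H A)) * real (card A) \<le> (2 * K) * real (card A)" using K1 by (simp add: field_simps)
  then show ?thesis using fin ne by (simp add: card_gt_0_iff mult_le_cancel_right_pos)
qed

text \<open>Remove \<open>P\<close>. The part \<open>L1 P + L2 A\<close> has at least
  \<open>|A|\<close> elements in cosets that the sumset of the rest misses, whereas the main term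
  drops by \<open>K |P|\<close>, less than \<open>|A| / 2\<close>.\<close>

lemma good_of_small_class:
  assumes IH: "IH (card A)" and fin: "finite A" and H: "addgroup H"
    and H2: "\<And>x y. x \<in> A \<Longrightarrow> y \<in> A \<Longrightarrow> L2 *v (x - y) \<in> H"
    and P: "P \<in> classes L1 H A" and small: "real (card P) < real (card A) / (2 * K)"
    and \<theta>: "\<theta> \<ge> 1 - 3 * \<epsilon>" and e: "err (card A) < 2 * K * real (card A)"
  shows "good \<theta> A"
proof -
  define A' where "A' = A - P"
  have PA: "P \<subseteq> A" by (rule classes_subset[OF P])
  have finP: "finite P" "finite A'" using finite_subset[OF PA fin] fin by (auto simp: A'_def)
  have Pne: "P \<noteq> {}" by (rule classes_nonempty[OF H P])
  have cA': "card A' = card A - card P" unfolding A'_def using finP PA by (intro card_Diff_subset)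
  have cP: "0 < card P" "card P \<le> card A" using Pne finP PA fin by (auto simp: card_gt_0_iff intro: card_mono)
  have disj: "sumset ((*v) L1 ` A') ((*v) L2 ` A') \<inter> sumset ((*v) L1 ` P) ((*v) L2 ` A) = {}"
  proof (rule equals0I)
    fix z assume "z \<in> sumset ((*v) L1 ` A') ((*v) L2 ` A') \<inter> sumset ((*v) L1 ` P) ((*v) L2 ` A)"
    then obtain x c y c' where h: "x \<in> A'" "c \<in> A'" "y \<in> P" "c' \<in> A" "L1 *v x + L2 *v c = L1 *v y + L2 *v c'"
      by (auto elim!: sumsetE)
    have "L1 *v (x - y) = L2 *v (c' - c)" using h(5) by (simp add: matrix_vector_mult_diff_distrib algebra_simps)
    then have "L1 *v (x - y) \<in> H" using H2[of c' c] h by (simp add: A'_def)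
    then have "x \<in> P" using h(1) by (intro classes_closed[OF H P h(3)]) (auto simp: A'_def)
    then show False using h(1) by (simp add: A'_def)
  qed
  have "G A' A' + G P A = card (sumset ((*v) L1 ` A') ((*v) L2 ` A') \<union> sumset ((*v) L1 ` P) ((*v) L2 ` A))"
    unfolding G_def using finP fin disj by (intro card_Un_disjoint[symmetric]) auto
  also have "\<dots> \<le> G A A" unfolding G_def using fin PA
    by (intro card_mono Un_least sumset_mono) (auto simp: A'_def)
  finally have "G A' A' + card A \<le> G A A" using G_ge_card(1)[OF finP(1) fin Pne] by linarith
  then have 1: "real (G A' A') + real (card A) \<le> real (G A A)" by linarith
  have "good 1 A'" using IH finP(2) cA' cP unfolding IH_def by auto
  then have 2: "real (G A' A') \<ge> K * real (card A') - err (card A')" by (simp add: good_def)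
  have 3: "err (card A') \<le> err (card A)" using cA' by (intro err_mono) simp
  have 4: "K * real (card A') = K * real (card A) - K * real (card P)" using cA' cP by (simp add: of_nat_diff algebra_simps)
  have 5: "K * real (card P) \<le> real (card A) / 2"
  proof -
    have "K * real (card P) \<le> K * (real (card A) / (2 * K))" using small K1 by (intro mult_left_mono) auto
    then show ?thesis using K1 by simp
  qed
  have 6: "real (card A) / (2 * K) \<le> real (card A) / 2" using K1 by (intro divide_left_mono) auto
  have 7: "err (card A) \<le> (1 + \<epsilon>) * err (card A)" using eps_bounds(1) err_nonneg[of "card A"] by (simp add: algebra_simps)
  show ?thesis
  proof (rule good_of_gain[OF _ \<theta> e])
    show "K * real (card A) - (1 + \<epsilon>) * err (card A) + real (card A) / (2 * K) \<le> real (G A A)"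
      using 1 2 3 4 5 6 7 by linarith
  qed
qed

text \<open>All assumptions are symmetric, so every lemma of the locale is also available with
  \<open>L1\<close> and \<open>L2\<close> exchanged.\<close>

lemma swap_setup: "ind_setup L2 L1 K D \<sigma> \<epsilon> E \<tau>"
proof -
  interpret sw: coprime_lin_pair L2 L1 by (rule coprime_lin_pair_swap)
  show ?thesis
  proof unfold_locales
    show "K = phi CARD('n) (of_rat \<bar>det L2\<bar>) (of_rat \<bar>det L1\<bar>)" unfolding K by (rule phi_commute)
    show "phi CARD('n) (real (card B)) (real (card C)) \<le> real (lin_pair.G L2 L1 B C) + E * real (card A) powr (1 - \<tau>)"
      if "finite A" "real (lin_pair.G L2 L1 A A) \<le> K * real (card A)" "B \<subseteq> A" "C \<subseteq> A" "B \<noteq> {}" "C \<noteq> {}" for A B C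
      using BM[of A C B] that unfolding G_swap by (subst phi_commute) simp
  qed (use K1 \<epsilon> \<sigma> pow D E in auto)
qed

lemma good_swap: "ind_setup.good L2 L1 K D \<sigma> \<theta> A \<longleftrightarrow> good \<theta> A"
proof -
  interpret sw: ind_setup L2 L1 K D \<sigma> \<epsilon> E \<tau> by (rule swap_setup)
  show ?thesis unfolding sw.good_def good_def sw.err_def err_def G_swap ..
qed

lemma IH_swap: "ind_setup.IH L2 L1 K D \<sigma> n \<longleftrightarrow> IH n"
proof -
  interpret sw: ind_setup L2 L1 K D \<sigma> \<epsilon> E \<tau> by (rule swap_setup)
  show ?thesis unfolding sw.IH_def IH_def good_swap ..
qed

text \<open>
  Here \<open>\<alpha>\<close> measures how evenly \<open>A\<close> is distributed among the classes. For \<open>\<alpha>\<close> close to 1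
  Brunn--Minkowski is applied to all pairs of classes, otherwise only to the row of the smallest class
  \<open>P0\<close>, the other rows being covered by the induction hypothesis.
\<close>

lemma good_of_index_bounds_min:
  assumes IH: "IH (card A)" and fin: "finite A" and ne: "A \<noteq> {}" and GK: "real (G A A) \<le> K * real (card A)"
    and H: "addgroup H1" "addgroup H2"
    and h1: "\<And>x y. x \<in> A \<Longrightarrow> y \<in> A \<Longrightarrow> L1 *v (x - y) \<in> H1"
    and h2: "\<And>x y. x \<in> A \<Longrightarrow> y \<in> A \<Longrightarrow> L2 *v (x - y) \<in> H2"
    and cP: "of_rat \<bar>det L2\<bar> \<le> real (card (classes L1 H2 A))" "real (card (classes L1 H2 A)) \<le> 2 * K"
    and cQ: "of_rat \<bar>det L1\<bar> \<le> real (card (classes L2 H1 A))" "real (card (classes L2 H1 A)) \<le> 2 * K"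
    and P0: "P0 \<in> classes L1 H2 A" and minP: "\<And>P. P \<in> classes L1 H2 A \<Longrightarrow> card P0 \<le> card P"
    and minQ: "\<And>Q. Q \<in> classes L2 H1 A \<Longrightarrow> card (classes L1 H2 A) * card P0 \<le> card (classes L2 H1 A) * card Q"
  shows "good (1 - 3 * \<epsilon>) A"
proof -
  define \<P> \<Q> where "\<P> = classes L1 H2 A" and "\<Q> = classes L2 H1 A"
  define n p q a where "n = real (card A)" and "p = real (card \<P>)" and "q = real (card \<Q>)" and "a = real (card P0)"
  define d where "d = CARD('n)"
  define F where "F = E * n powr (1 - \<tau>)"
  have d: "d > 0" by (simp add: d_def)
  have n1: "n \<ge> 1" using fin ne by (simp add: n_def Suc_le_eq card_gt_0_iff)
  have finPQ: "finite \<P>" "finite \<Q>" using fin by (simp_all add: \<P>_def \<Q>_def)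
  have "\<P> \<noteq> {}" "\<Q> \<noteq> {}" using ne by (simp_all add: \<P>_def \<Q>_def classes_def)
  then have pq: "p > 0" "q > 0" using finPQ by (simp_all add: p_def q_def card_gt_0_iff)
  have P0A: "P0 \<subseteq> A" by (rule classes_subset[OF P0])
  have P0ne: "P0 \<noteq> {}" by (rule classes_nonempty[OF H(2) P0])
  have a: "a > 0" using P0ne finite_subset[OF P0A fin] by (simp add: a_def card_gt_0_iff)
  define \<alpha> where "\<alpha> = p * a / n"
  have an: "a = \<alpha> * n / p" using pq n1 by (simp add: \<alpha>_def)
  have \<alpha>0: "\<alpha> > 0" unfolding \<alpha>_def using pq a n1 by simp
  have sumP: "(\<Sum>P\<in>\<P>. real (card P)) = n" unfolding \<P>_def n_def by (rule sum_card_classes_real[OF H(2) fin])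
  have sumQ: "(\<Sum>Q\<in>\<Q>. real (card Q)) = n" unfolding \<Q>_def n_def by (rule sum_card_classes_real[OF H(1) fin])
  have geP: "a \<le> real (card P)" if "P \<in> \<P>" for P using minP that unfolding a_def \<P>_def by simp
  \<comment> \<open>By \<open>minQ\<close>, the smallest class on either side is at least
    \<open>\<alpha>\<close> times the average class of that side.\<close>
  have geQ: "\<alpha> * n / q \<le> real (card Q)" if "Q \<in> \<Q>" for Q
  proof -
    have "p * a \<le> q * real (card Q)" using minQ that unfolding p_def q_def a_def \<P>_def \<Q>_def by (metis of_nat_le_iff of_nat_mult)
    then show ?thesis using pq n1 by (simp add: \<alpha>_def field_simps)
  qed
  have \<alpha>1: "\<alpha> \<le> 1"
  proof -
    have "p * a \<le> n" using sum_mono[of \<P> "\<lambda>_. a" "\<lambda>P. real (card P)"] geP sumP by (simp add: p_def)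
    then show ?thesis using n1 by (simp add: \<alpha>_def)
  qed
  have Kle: "K \<le> phi d q p" unfolding K d_def q_def p_def \<P>_def \<Q>_def
    using cP(1) cQ(1) by (intro phi_mono) auto
  have F0: "F \<ge> 0" using E by (simp add: F_def)
  have pqF: "p * q * F \<le> \<epsilon> * err (card A)"
  proof -
    have "p * q \<le> (2 * K) * (2 * K)" using cP(2) cQ(2) pq unfolding p_def q_def \<P>_def \<Q>_def by (intro mult_mono) auto
    then have "p * q * F \<le> (4 * K\<^sup>2) * F" using F0 by (intro mult_right_mono) (auto simp: power2_eq_square)
    also have "\<dots> = (4 * K\<^sup>2 * E) * n powr (1 - \<tau>)" by (simp add: F_def)
    also have "\<dots> \<le> (4 * K\<^sup>2 * E) * n powr (1 - \<sigma>)" using n1 \<sigma> E by (intro mult_left_mono powr_mono) auto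
    also have "\<dots> \<le> (\<epsilon> * D) * n powr (1 - \<sigma>)" using D(1) by (intro mult_right_mono) auto
    finally show ?thesis by (simp add: err_def n_def)
  qed
  have qF: "q * F \<le> \<epsilon> * err (card A)"
  proof -
    have "1 \<le> p" using pq(1) by (simp add: p_def)
    then have "1 * (q * F) \<le> p * (q * F)" using pq F0 by (intro mult_right_mono) auto
    then show ?thesis using pqF by simp
  qed
  have bm: "phi d (real (card P)) (real (card Q)) \<le> real (G P Q) + F" if "P \<in> \<P>" "Q \<in> \<Q>" for P Q
    unfolding d_def F_def n_def
  proof (rule BM[OF fin GK])
    show "P \<subseteq> A" "P \<noteq> {}" using that classes_subset classes_nonempty[OF H(2)] unfolding \<P>_def by blast+
    show "Q \<subseteq> A" "Q \<noteq> {}" using that classes_subset classes_nonempty[OF H(1)] unfolding \<Q>_def by blast+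
  qed
  have finP: "finite P" if "P \<in> \<P>" for P using that finite_subset[OF classes_subset fin] unfolding \<P>_def by blast
  have PA: "P \<subseteq> A" if "P \<in> \<P>" for P using that classes_subset unfolding \<P>_def by blast
  have GA: "G A A = (\<Sum>P\<in>\<P>. G P A)" unfolding \<P>_def using h2 by (intro G_split H fin) auto
  have GP: "G P A = (\<Sum>Q\<in>\<Q>. G P Q)" if P: "P \<in> \<P>" for P
    unfolding \<Q>_def using h1 PA[OF P] finP[OF P] by (intro G_split' H fin) blast+
  \<comment> \<open>By homogeneity the \<open>q\<close> pairs of minimal classes in a row give
    \<open>phi (q a) (p a) = a phi q p\<close>, hence at least \<open>K a\<close>.\<close>
  have base: "K * a \<le> q * phi d a (\<alpha> * n / q)"
  proof -
    have "q * phi d a (\<alpha> * n / q) = phi d (q * a) (q * (\<alpha> * n / q))" using pq a \<alpha>0 n1 d by (intro phi_scale[symmetric]) auto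
    also have "q * (\<alpha> * n / q) = a * p" using pq by (simp add: an)
    also have "phi d (q * a) (a * p) = a * phi d q p"
      unfolding mult.commute[of q a] using pq a d by (intro phi_scale) auto
    finally have "q * phi d a (\<alpha> * n / q) = a * phi d q p" .
    moreover have "a * K \<le> a * phi d q p" using Kle a by (intro mult_left_mono) auto
    ultimately show ?thesis by (simp add: mult.commute)
  qed
  show ?thesis
  proof (cases "K * (1 - \<alpha>) * n \<le> err (card A) / 2")
    case True
    \<comment> \<open>Every class counts with its guaranteed minimum only. Over all rows this loses
      \<open>K * (1 - \<alpha>) * n\<close>, in this case at most half the error.\<close>
    have row: "real (G P A) \<ge> K * a - q * F" if P: "P \<in> \<P>" for P
    proof -
      have "q * (phi d a (\<alpha> * n / q) - F) = (\<Sum>Q\<in>\<Q>. phi d a (\<alpha> * n / q) - F)" by (simp add: q_def)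
      also have "\<dots> \<le> (\<Sum>Q\<in>\<Q>. real (G P Q))"
      proof (rule sum_mono)
        fix Q assume Q: "Q \<in> \<Q>"
        have "phi d a (\<alpha> * n / q) \<le> phi d (real (card P)) (real (card Q))"
          using geP[OF P] geQ[OF Q] a \<alpha>0 n1 pq by (intro phi_mono) auto
        then show "phi d a (\<alpha> * n / q) - F \<le> real (G P Q)" using bm[OF P Q] by linarith
      qed
      also have "\<dots> = real (G P A)" unfolding GP[OF P] by simp
      finally have "q * phi d a (\<alpha> * n / q) - q * F \<le> real (G P A)" by (simp only: right_diff_distrib)
      then show ?thesis using base by linarith
    qed
    have "p * (K * a - q * F) = (\<Sum>P\<in>\<P>. K * a - q * F)" by (simp add: p_def)
    also have "\<dots> \<le> (\<Sum>P\<in>\<P>. real (G P A))" by (intro sum_mono row)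
    also have "\<dots> = real (G A A)" unfolding GA by simp
    finally have "p * (K * a) - p * q * F \<le> real (G A A)" by (simp only: right_diff_distrib mult.assoc)
    moreover have "p * (K * a) = K * n - K * (1 - \<alpha>) * n" using pq by (simp add: an algebra_simps)
    ultimately have G1: "real (G A A) \<ge> K * n - err (card A) / 2 - \<epsilon> * err (card A)" using pqF True by linarith
    have "(1 / 2 + \<epsilon>) * err (card A) \<le> (1 - 3 * \<epsilon>) * err (card A)"
      using eps_bounds(2) err_nonneg by (intro mult_right_mono) auto
    then show ?thesis using G1 unfolding good_def n_def by (simp add: algebra_simps)
  next
    case False
    \<comment> \<open>The row of \<open>P0\<close> keeps the true sizes of the classes
      \<open>Q\<close>; their excess over \<open>\<alpha> * n / q\<close> sums to
      \<open>(1 - \<alpha>) * n\<close>.\<close>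
    have "K * a + (1 - \<alpha>) * n - q * F \<le> q * phi d a (\<alpha> * n / q) + (1 - \<alpha>) * n - q * F" using base by simp
    also have "\<dots> = (\<Sum>Q\<in>\<Q>. phi d a (\<alpha> * n / q) + (real (card Q) - \<alpha> * n / q) - F)"
      unfolding sum_subtractf sum.distrib sumQ using pq by (simp add: q_def[symmetric] algebra_simps)
    also have "\<dots> \<le> (\<Sum>Q\<in>\<Q>. real (G P0 Q))"
    proof (rule sum_mono)
      fix Q assume Q: "Q \<in> \<Q>"
      have "phi d a (\<alpha> * n / q) + (real (card Q) - \<alpha> * n / q) \<le> phi d a (real (card Q))"
        using a \<alpha>0 n1 pq geQ[OF Q] d by (intro phi_increment) auto
      then show "phi d a (\<alpha> * n / q) + (real (card Q) - \<alpha> * n / q) - F \<le> real (G P0 Q)"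
        using bm[of P0 Q] P0 Q unfolding a_def \<P>_def by simp
    qed
    also have "\<dots> = real (G P0 A)" using GP[of P0] P0 unfolding \<P>_def by simp
    finally have row0: "K * a + (1 - \<alpha>) * n - q * F \<le> real (G P0 A)" .
    have row: "K * real (card P) - err (card P) \<le> real (G P A)" if P: "P \<in> \<P> - {P0}" for P
    proof -
      have "P \<inter> P0 = {}" using P P0 classes_disjoint[OF H(2)] unfolding \<P>_def by blast
      then have "P \<subset> A" using PA[of P] P P0A P0ne by blast
      then have "card P < card A" using fin by (rule psubset_card_mono[rotated])
      then have "good 1 P" using IH finP[of P] P unfolding IH_def by blast
      then have "K * real (card P) - err (card P) \<le> real (G P P)" by (simp add: good_def)
      also have "\<dots> \<le> real (G P A)" using G_mono[of P A P P] finP[of P] fin PA[of P] P by simp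
      finally show ?thesis .
    qed
    have "real (G A A) = (\<Sum>P\<in>\<P>. real (G P A))" unfolding GA by simp
    also have "\<dots> = real (G P0 A) + (\<Sum>P\<in>\<P>-{P0}. real (G P A))"
      using finPQ P0 unfolding \<P>_def by (intro sum.remove) auto
    finally have s1: "real (G A A) = real (G P0 A) + (\<Sum>P\<in>\<P>-{P0}. real (G P A))" .
    have s2: "(\<Sum>P\<in>\<P>-{P0}. K * real (card P) - err (card P)) \<le> (\<Sum>P\<in>\<P>-{P0}. real (G P A))" by (intro sum_mono row)
    have "(\<Sum>P\<in>\<P>-{P0}. real (card P)) = n - a"
      using sum.remove[of \<P> P0 "\<lambda>P. real (card P)"] finPQ P0 sumP unfolding \<P>_def a_def by simp
    then have s3: "(\<Sum>P\<in>\<P>-{P0}. K * real (card P) - err (card P)) = K * (n - a) - (\<Sum>P\<in>\<P>-{P0}. err (card P))"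
      by (simp add: sum_subtractf sum_distrib_left[symmetric])
    have G1: "real (G P0 A) + (K * (n - a) - (\<Sum>P\<in>\<P>-{P0}. err (card P))) \<le> real (G A A)"
      using s1 s2 s3 by linarith
    have "(\<Sum>P\<in>\<P>-{P0}. err (card P)) \<le> (\<Sum>P\<in>\<P>. err (card P))" using finPQ err_nonneg by (intro sum_mono2) auto
    also have "\<dots> \<le> (1 + \<epsilon>) * err (card A)" unfolding \<P>_def by (rule sum_err_classes[OF H(2) fin ne cP(2)])
    finally have G2: "(\<Sum>P\<in>\<P>-{P0}. err (card P)) \<le> (1 + \<epsilon>) * err (card A)" .
    have G3: "(1 - \<alpha>) * n \<ge> (1 / (2 * K)) * err (card A)" using False K1 by (simp add: field_simps)
    have G4: "(1 / (2 * K)) * err (card A) \<ge> (5 * \<epsilon>) * err (card A)" using eps_bounds(4) err_nonneg by (intro mult_right_mono) auto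
    have "K * (n - a) = K * n - K * a" by (simp add: algebra_simps)
    \<comment> \<open>The surplus is worth \<open>5 \<epsilon>\<close> errors, Brunn--Minkowski in
      the row of \<open>P0\<close> costs \<open>\<epsilon>\<close> and the other rows
      \<open>1 + \<epsilon>\<close>; the balance is the coefficient
      \<open>1 - 3 \<epsilon>\<close>.\<close>
    then have "real (G A A) \<ge> K * n + (5 * \<epsilon>) * err (card A) - \<epsilon> * err (card A) - (1 + \<epsilon>) * err (card A)"
      using G1 G2 G3 G4 row0 qF by linarith
    then show ?thesis unfolding good_def n_def by (simp add: algebra_simps)
  qed
qed

text \<open>In a counterexample no class is small, so there are at most \<open>2 K\<close> on each
  side.\<close>

lemma good_of_index_bounds:
  assumes IH: "IH (card A)" and fin: "finite A"
    and H: "addgroup H1" "addgroup H2"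
    and h1: "\<And>x y. x \<in> A \<Longrightarrow> y \<in> A \<Longrightarrow> L1 *v (x - y) \<in> H1"
    and h2: "\<And>x y. x \<in> A \<Longrightarrow> y \<in> A \<Longrightarrow> L2 *v (x - y) \<in> H2"
    and cP: "of_rat \<bar>det L2\<bar> \<le> real (card (classes L1 H2 A))"
    and cQ: "of_rat \<bar>det L1\<bar> \<le> real (card (classes L2 H1 A))"
  shows "good (1 - 3 * \<epsilon>) A"
proof (rule ccontr)
  assume ng: "\<not> good (1 - 3 * \<epsilon>) A"
  interpret sw: ind_setup L2 L1 K D \<sigma> \<epsilon> E \<tau> by (rule swap_setup)
  have th: "1 - 3 * \<epsilon> \<ge> 1 / 2" using eps_bounds(2) by linarith
  note reg = not_good_bounds[OF fin ng th]
  have ne: "A \<noteq> {}" using reg(2) by auto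
  have GK: "real (G A A) \<le> K * real (card A)"
  proof (rule ccontr)
    assume "\<not> ?thesis"
    moreover have "(1 - 3 * \<epsilon>) * err (card A) \<ge> 0" using th err_nonneg by (intro mult_nonneg_nonneg) auto
    ultimately show False using ng unfolding good_def by linarith
  qed
  have bigP: "real (card P) \<ge> real (card A) / (2 * K)" if "P \<in> classes L1 H2 A" for P
    using good_of_small_class[OF IH fin H(2) h2 that _ order_refl reg(1)] ng by (meson not_le)
  have bigQ: "real (card Q) \<ge> real (card A) / (2 * K)" if "Q \<in> classes L2 H1 A" for Q
    using sw.good_of_small_class[OF _ fin H(1) h1 that _ order_refl] reg(1) ng IH unfolding good_swap IH_swap
    by (metis not_le sw.err_def err_def)
  have leP: "real (card (classes L1 H2 A)) \<le> 2 * K" by (rule card_classes_le[OF H(2) fin ne bigP])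
  have leQ: "real (card (classes L2 H1 A)) \<le> 2 * K" by (rule card_classes_le[OF H(1) fin ne bigQ])
  have finC: "finite (card ` classes L1 H2 A)" "card ` classes L1 H2 A \<noteq> {}" "finite (card ` classes L2 H1 A)" "card ` classes L2 H1 A \<noteq> {}"
    using fin ne by (auto simp: classes_def)
  obtain P0 where P0: "P0 \<in> classes L1 H2 A" "\<And>P. P \<in> classes L1 H2 A \<Longrightarrow> card P0 \<le> card P"
    using Min_in[OF finC(1,2)] Min_le[OF finC(1)] by (metis (no_types, lifting) image_iff)
  obtain Q0 where Q0: "Q0 \<in> classes L2 H1 A" "\<And>Q. Q \<in> classes L2 H1 A \<Longrightarrow> card Q0 \<le> card Q"
    using Min_in[OF finC(3,4)] Min_le[OF finC(3)] by (metis (no_types, lifting) image_iff)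
  show False
  \<comment> \<open>Compares the ratios of smallest to average class on the two sides; the side with
    the smaller ratio supplies \<open>P0\<close>, after an exchange of \<open>L1\<close> and
    \<open>L2\<close> if necessary.\<close>
  proof (cases "card (classes L1 H2 A) * card P0 \<le> card (classes L2 H1 A) * card Q0")
    case True
    have "good (1 - 3 * \<epsilon>) A"
    proof (rule good_of_index_bounds_min[OF IH fin ne GK H h1 h2 cP leP cQ leQ P0])
      fix Q assume "Q \<in> classes L2 H1 A"
      then have "card (classes L2 H1 A) * card Q0 \<le> card (classes L2 H1 A) * card Q" using Q0(2) by (intro mult_left_mono) auto
      then show "card (classes L1 H2 A) * card P0 \<le> card (classes L2 H1 A) * card Q" using True by linarith
    qed
    then show False using ng by simp
  next
    case False
    have "sw.good (1 - 3 * \<epsilon>) A"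
    proof (rule sw.good_of_index_bounds_min[OF _ fin ne _ H(2,1) h2 h1 cQ leQ cP leP Q0])
      show "sw.IH (card A)" using IH by (simp add: IH_swap)
      show "real (lin_pair.G L2 L1 A A) \<le> K * real (card A)" using GK by (simp add: G_swap)
      fix P assume "P \<in> classes L1 H2 A"
      then have "card (classes L1 H2 A) * card P0 \<le> card (classes L1 H2 A) * card P" using P0(2) by (intro mult_left_mono) auto
      then show "card (classes L2 H1 A) * card Q0 \<le> card (classes L1 H2 A) * card P" using False by linarith
    qed
    then show False using ng by (simp add: good_swap)
  qed
qed

text \<open>Since \<open>L1 A\<close> lies in one coset of \<open>H\<close>, the sets
  \<open>L1 A + L2 Q\<close> are disjoint; each is bounded below by the sumset of \<open>Q\<close>
  alone, except that \<open>Q0\<close> also contributes its gain \<open>t\<close>.\<close>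

lemma G_lower_bound_of_classes:
  assumes fin: "finite A" and ne: "A \<noteq> {}" and H: "addgroup H"
    and h1: "\<And>x y. x \<in> A \<Longrightarrow> y \<in> A \<Longrightarrow> L1 *v (x - y) \<in> H"
    and c: "real (card (classes L2 H A)) \<le> 2 * K"
    and g: "\<And>Q. Q \<in> classes L2 H A \<Longrightarrow> good \<theta> Q" and \<theta>: "\<theta> \<ge> 0"
    and Q0: "Q0 \<in> classes L2 H A" and gain: "real (G Q0 Q0) + t \<le> real (G A Q0)"
  shows "real (G A A) \<ge> K * real (card A) - \<theta> * (1 + \<epsilon>) * err (card A) + t"
proof -
  define \<Q> where "\<Q> = classes L2 H A"
  have fin\<Q>: "finite \<Q>" using fin by (simp add: \<Q>_def)
  have QA: "Q \<subseteq> A" if "Q \<in> \<Q>" for Q using that classes_subset unfolding \<Q>_def by blast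
  have "(\<Sum>Q\<in>\<Q>. K * real (card Q) - \<theta> * err (card Q)) \<le> (\<Sum>Q\<in>\<Q>. real (G Q Q))"
    using g unfolding good_def \<Q>_def by (intro sum_mono) auto
  also have "\<dots> = real (G Q0 Q0) + (\<Sum>Q\<in>\<Q>-{Q0}. real (G Q Q))"
    using fin\<Q> Q0 unfolding \<Q>_def by (intro sum.remove) auto
  also have "\<dots> \<le> (real (G A Q0) - t) + (\<Sum>Q\<in>\<Q>-{Q0}. real (G A Q))"
  proof (intro add_mono sum_mono)
    fix Q assume "Q \<in> \<Q> - {Q0}"
    then show "real (G Q Q) \<le> real (G A Q)" using G_mono[of A Q Q Q] fin QA[of Q] finite_subset[OF QA[of Q] fin] by simp
  qed (use gain in simp)
  also have "\<dots> = (\<Sum>Q\<in>\<Q>. real (G A Q)) - t"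
    using sum.remove[of \<Q> Q0 "\<lambda>Q. real (G A Q)"] fin\<Q> Q0 unfolding \<Q>_def by simp
  also have "(\<Sum>Q\<in>\<Q>. real (G A Q)) = real (G A A)"
    using G_split'[OF H fin fin h1] unfolding \<Q>_def by simp
  finally have 1: "(\<Sum>Q\<in>\<Q>. K * real (card Q) - \<theta> * err (card Q)) \<le> real (G A A) - t" .
  have 2: "(\<Sum>Q\<in>\<Q>. K * real (card Q) - \<theta> * err (card Q)) = K * real (card A) - \<theta> * (\<Sum>Q\<in>\<Q>. err (card Q))"
    using sum_card_classes_real[OF H fin, of L2] unfolding \<Q>_def by (simp add: sum_subtractf sum_distrib_left[symmetric])
  have "\<theta> * (\<Sum>Q\<in>\<Q>. err (card Q)) \<le> \<theta> * ((1 + \<epsilon>) * err (card A))"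
    using sum_err_classes[OF H fin ne c] \<theta> unfolding \<Q>_def by (intro mult_left_mono) auto
  then show ?thesis using 1 2 by (simp add: mult.assoc)
qed

text \<open>The common shape of the two passes to classes. One gaining class pays for applying the
  induction hypothesis to all classes; without any gain, every class satisfies the stronger bound
  \<open>\<theta>'\<close>, which summation weakens to
  \<open>\<theta>' * (1 + \<epsilon>)\<close>.\<close>

lemma good_of_class_dichotomy:
  assumes IH: "IH (card A)" and fin: "finite A"
    and H: "addgroup H" and h1: "\<And>x y. x \<in> A \<Longrightarrow> y \<in> A \<Longrightarrow> L1 *v (x - y) \<in> H"
    and \<theta>: "\<theta> \<ge> 1 - 3 * \<epsilon>" "\<theta>' \<ge> 0" "\<theta>' * (1 + \<epsilon>) \<le> \<theta>"
    and alt: "\<And>Q. Q \<in> classes L2 H A \<Longrightarrow> card A \<ge> 2 \<Longrightarrow>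
      (\<exists>Q'\<in>classes L2 H A. G Q Q + card Q' \<le> G A Q) \<or> (IH (card Q) \<longrightarrow> good \<theta>' Q)"
  shows "good \<theta> A"
proof (rule ccontr)
  assume ng: "\<not> good \<theta> A"
  interpret sw: ind_setup L2 L1 K D \<sigma> \<epsilon> E \<tau> by (rule swap_setup)
  have th: "\<theta> \<ge> 1 / 2" using eps_bounds(2) \<theta>(1) by linarith
  note reg = not_good_bounds[OF fin ng th]
  have ne: "A \<noteq> {}" using reg(2) by auto
  have big: "real (card Q) \<ge> real (card A) / (2 * K)" if "Q \<in> classes L2 H A" for Q
    using sw.good_of_small_class[OF _ fin H h1 that _ \<theta>(1)] reg(1) ng IH unfolding good_swap IH_swap
    by (metis not_le sw.err_def err_def)
  have le: "real (card (classes L2 H A)) \<le> 2 * K" by (rule card_classes_le[OF H fin ne big])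
  have finQ: "finite Q" "card Q \<le> card A" if "Q \<in> classes L2 H A" for Q
    using finite_subset[OF classes_subset[OF that] fin] card_mono[OF fin classes_subset[OF that]] by auto
  have neQ: "card Q > 0" if "Q \<in> classes L2 H A" for Q
    using classes_nonempty[OF H that] finQ(1)[OF that] by (simp add: card_gt_0_iff)
  show False
  proof (cases "\<exists>Q\<in>classes L2 H A. \<exists>Q'\<in>classes L2 H A. G Q Q + card Q' \<le> G A Q")
    case True
    then obtain Q Q' where Q: "Q \<in> classes L2 H A" "Q' \<in> classes L2 H A" "G Q Q + card Q' \<le> G A Q" by blast
    \<comment> \<open>For \<open>Q = A\<close> the gain would be contradictory. So there are several
      classes, all of them proper subsets, to which the induction hypothesis applies.\<close>
    have "Q \<noteq> A" using Q(3) neQ[OF Q(2)] by auto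
    have g: "good 1 R" if R: "R \<in> classes L2 H A" for R
    proof -
      have "R \<noteq> A"
      proof
        assume "R = A"
        then have "Q \<inter> R = Q" using classes_subset[OF Q(1)] by blast
        then have "R = Q" using classes_disjoint[OF H R Q(1)] neQ[OF Q(1)] by (metis Int_commute card.empty less_irrefl)
        then show False using \<open>R = A\<close> \<open>Q \<noteq> A\<close> by simp
      qed
      then have "card R < card A" using classes_subset[OF R] fin by (intro psubset_card_mono) auto
      then show ?thesis using IH finQ(1)[OF R] unfolding IH_def by blast
    qed
    have "real (G Q Q) + real (card A) / (2 * K) \<le> real (G A Q)" using Q(3) big[OF Q(2)] by linarith
    from G_lower_bound_of_classes[OF fin ne H h1 le g _ Q(1) this]
    have "real (G A A) \<ge> K * real (card A) - (1 + \<epsilon>) * err (card A) + real (card A) / (2 * K)" by simp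
    then have "good \<theta> A" by (rule good_of_gain[OF _ \<theta>(1) reg(1)])
    then show False using ng by simp
  next
    case False
    \<comment> \<open>\<open>Q\<close> may be all of \<open>A\<close> here; the implication only
      asks for the bound on sets smaller than \<open>Q\<close>.\<close>
    have g: "good \<theta>' Q" if "Q \<in> classes L2 H A" for Q
      using alt[OF that reg(2)] False that IH_mono[OF IH finQ(2)[OF that]] by blast
    obtain Q0 where Q0: "Q0 \<in> classes L2 H A" using ne by (auto simp: classes_def)
    have "real (G Q0 Q0) + 0 \<le> real (G A Q0)"
      using G_mono[of A Q0 Q0 Q0] fin classes_subset[OF Q0] finQ(1)[OF Q0] by simp
    from G_lower_bound_of_classes[OF fin ne H h1 le g \<theta>(2) Q0 this]
    have "real (G A A) \<ge> K * real (card A) - \<theta>' * (1 + \<epsilon>) * err (card A)" by simp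
    moreover have "\<theta>' * (1 + \<epsilon>) * err (card A) \<le> \<theta> * err (card A)" using \<theta>(3) err_nonneg by (intro mult_right_mono)
    ultimately have "good \<theta> A" unfolding good_def by linarith
    then show False using ng by simp
  qed
qed

lemma two_points:
  assumes "finite A" "card A \<ge> 2" obtains a b where "a \<in> A" "b \<in> A" "a \<noteq> b"
  using assms by (metis card_le_Suc0_iff_eq not_less_eq_eq numeral_2_eq_2)

text \<open>The inner pass: a class without gain acquires the index bound for \<open>L1\<close> and
  inherits the one for \<open>L2\<close>, so that \<open>good_of_index_bounds\<close> applies to
  it.\<close>

lemma good_of_L2_index_bound:
  assumes IH: "IH (card A)" and fin: "finite A" and H2: "addgroup H2"
    and h2: "\<And>x y. x \<in> A \<Longrightarrow> y \<in> A \<Longrightarrow> L2 *v (x - y) \<in> H2"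
    and cP: "of_rat \<bar>det L2\<bar> \<le> real (card (classes L1 H2 A))"
  shows "good (1 - \<epsilon>) A"
proof (rule good_of_class_dichotomy[OF IH fin addgroup_\<Gamma>(2)])
  show "L1 *v (x - y) \<in> (*v) L1 ` \<Gamma> A" if "x \<in> A" "y \<in> A" for x y using diff_mem_\<Gamma>[OF that] by blast
  show "1 - 3 * \<epsilon> \<le> 1 - \<epsilon>" "0 \<le> 1 - 3 * \<epsilon>" using eps_bounds by linarith+
  have "\<epsilon> * \<epsilon> \<ge> 0" by simp
  then show "(1 - 3 * \<epsilon>) * (1 + \<epsilon>) \<le> 1 - \<epsilon>" using eps_bounds(1) by (simp add: algebra_simps)
  fix Q assume Q: "Q \<in> classes L2 ((*v) L1 ` \<Gamma> A) A" and "card A \<ge> 2"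
  then obtain a b where ab: "a \<in> A" "b \<in> A" "a \<noteq> b" using two_points[OF fin] by blast
  have QA: "Q \<subseteq> A" by (rule classes_subset[OF Q])
  have finQ: "finite Q" by (rule finite_subset[OF QA fin])
  show "(\<exists>Q'\<in>classes L2 ((*v) L1 ` \<Gamma> A) A. G Q Q + card Q' \<le> G A Q) \<or> (IH (card Q) \<longrightarrow> good (1 - 3 * \<epsilon>) Q)"
  proof (cases "\<exists>Q'\<in>classes L2 ((*v) L1 ` \<Gamma> A) A. G Q Q + card Q' \<le> G A Q")
    case False
    have cQ: "\<bar>det L1\<bar> \<le> of_nat (card (classes L2 ((*v) L1 ` \<Lambda> A) Q))"
      using class_gain_or_index[OF fin ab Q] False by blast
    have "real_of_rat \<bar>det L1\<bar> \<le> real_of_rat (of_nat (card (classes L2 ((*v) L1 ` \<Lambda> A) Q)))"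
      using cQ by (simp only: of_rat_less_eq)
    then have cQ': "real_of_rat \<bar>det L1\<bar> \<le> real (card (classes L2 ((*v) L1 ` \<Lambda> A) Q))" by simp
    \<comment> \<open>If \<open>Q\<close> missed the class of \<open>x\<close>, the translate
      \<open>L1 x + L2 Q\<close> would avoid the sumset of \<open>Q\<close> and be a gain of
      \<open>card Q\<close>.\<close>
    have hit: "\<exists>y\<in>Q. L1 *v (y - x) \<in> H2" if x: "x \<in> A" for x
    proof (rule ccontr)
      assume no: "\<not> ?thesis"
      define N where "N = (\<lambda>y. L1 *v x + L2 *v y) ` Q"
      have cN: "card N = card Q" unfolding N_def using inj_L(2) by (intro card_image) (auto simp: inj_on_def)
      have disj: "sumset ((*v) L1 ` Q) ((*v) L2 ` Q) \<inter> N = {}"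
      proof (rule equals0I)
        fix z assume "z \<in> sumset ((*v) L1 ` Q) ((*v) L2 ` Q) \<inter> N"
        then obtain u w y where h: "u \<in> Q" "w \<in> Q" "y \<in> Q" "L1 *v u + L2 *v w = L1 *v x + L2 *v y"
          by (auto simp: N_def elim!: sumsetE)
        have "L1 *v (u - x) = L2 *v (y - w)" using h(4) by (simp add: matrix_vector_mult_diff_distrib algebra_simps)
        then have "L1 *v (u - x) \<in> H2" using h2[of y w] h QA by auto
        then show False using no h(1) by blast
      qed
      have "G Q Q + card Q = card (sumset ((*v) L1 ` Q) ((*v) L2 ` Q) \<union> N)"
        unfolding G_def cN[symmetric] using finQ disj by (intro card_Un_disjoint[symmetric]) (auto simp: N_def)
      also have "\<dots> \<le> G A Q" unfolding G_def
      proof (rule card_mono)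
        show "finite (sumset ((*v) L1 ` A) ((*v) L2 ` Q))" using fin finQ by simp
        have "N \<subseteq> sumset ((*v) L1 ` A) ((*v) L2 ` Q)" unfolding N_def using x by (auto intro!: sumsetI)
        moreover have "sumset ((*v) L1 ` Q) ((*v) L2 ` Q) \<subseteq> sumset ((*v) L1 ` A) ((*v) L2 ` Q)"
          using QA by (intro sumset_mono) auto
        ultimately show "sumset ((*v) L1 ` Q) ((*v) L2 ` Q) \<union> N \<subseteq> sumset ((*v) L1 ` A) ((*v) L2 ` Q)" by blast
      qed
      finally show False using False Q by blast
    qed
    have "card (classes L1 H2 A) \<le> card (classes L1 H2 Q)" by (rule card_classes_subset_ge[OF H2 fin QA hit])
    then have cP': "of_rat \<bar>det L2\<bar> \<le> real (card (classes L1 H2 Q))" using cP by linarith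
    have "good (1 - 3 * \<epsilon>) Q" if "IH (card Q)"
    proof (rule good_of_index_bounds[OF that finQ addgroup_\<Lambda>(2) H2 _ _ cP' cQ'])
      show "L1 *v (x - y) \<in> (*v) L1 ` \<Lambda> A" if "x \<in> Q" "y \<in> Q" for x y using class_diff_\<Lambda>[OF Q that] by blast
      show "L2 *v (x - y) \<in> H2" if "x \<in> Q" "y \<in> Q" for x y using h2 QA that by blast
    qed
    then show ?thesis by blast
  qed blast
qed

lemma good_of_L1_index_bound:
  assumes IH: "IH (card A)" and fin: "finite A" and H1: "addgroup H1"
    and h1: "\<And>x y. x \<in> A \<Longrightarrow> y \<in> A \<Longrightarrow> L1 *v (x - y) \<in> H1"
    and cQ: "of_rat \<bar>det L1\<bar> \<le> real (card (classes L2 H1 A))"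
  shows "good (1 - \<epsilon>) A"
proof -
  interpret sw: ind_setup L2 L1 K D \<sigma> \<epsilon> E \<tau> by (rule swap_setup)
  show ?thesis using sw.good_of_L2_index_bound[OF _ fin H1 h1 cQ] IH unfolding good_swap IH_swap by blast
qed

text \<open>The outer pass: it provides only the index bound for \<open>L1\<close>, and leaves the
  classes without gain to \<open>good_of_L1_index_bound\<close>.\<close>

lemma good_of_IH:
  assumes IH: "IH (card A)" and fin: "finite A"
  shows "good 1 A"
proof (rule good_of_class_dichotomy[OF IH fin addgroup_\<Gamma>(2)])
  show "L1 *v (x - y) \<in> (*v) L1 ` \<Gamma> A" if "x \<in> A" "y \<in> A" for x y using diff_mem_\<Gamma>[OF that] by blast
  show "1 - 3 * \<epsilon> \<le> 1" "0 \<le> 1 - \<epsilon>" using eps_bounds by linarith+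
  have "\<epsilon> * \<epsilon> \<ge> 0" by simp
  then show "(1 - \<epsilon>) * (1 + \<epsilon>) \<le> 1" by (simp add: algebra_simps)
  fix Q assume Q: "Q \<in> classes L2 ((*v) L1 ` \<Gamma> A) A" and "card A \<ge> 2"
  then obtain a b where ab: "a \<in> A" "b \<in> A" "a \<noteq> b" using two_points[OF fin] by blast
  have finQ: "finite Q" by (rule finite_subset[OF classes_subset[OF Q] fin])
  show "(\<exists>Q'\<in>classes L2 ((*v) L1 ` \<Gamma> A) A. G Q Q + card Q' \<le> G A Q) \<or> (IH (card Q) \<longrightarrow> good (1 - \<epsilon>) Q)"
  proof (cases "\<exists>Q'\<in>classes L2 ((*v) L1 ` \<Gamma> A) A. G Q Q + card Q' \<le> G A Q")
    case False
    then have "\<bar>det L1\<bar> \<le> of_nat (card (classes L2 ((*v) L1 ` \<Lambda> A) Q))"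
      using class_gain_or_index[OF fin ab Q] by blast
    then have "real_of_rat \<bar>det L1\<bar> \<le> real_of_rat (of_nat (card (classes L2 ((*v) L1 ` \<Lambda> A) Q)))"
      by (simp only: of_rat_less_eq)
    then have cQ: "real_of_rat \<bar>det L1\<bar> \<le> real (card (classes L2 ((*v) L1 ` \<Lambda> A) Q))" by simp
    have "good (1 - \<epsilon>) Q" if "IH (card Q)"
    proof (rule good_of_L1_index_bound[OF that finQ addgroup_\<Lambda>(2) _ cQ])
      show "L1 *v (x - y) \<in> (*v) L1 ` \<Lambda> A" if "x \<in> Q" "y \<in> Q" for x y using class_diff_\<Lambda>[OF Q that] by blast
    qed
    then show ?thesis by blast
  qed blast
qed

theorem all_good: "finite A \<Longrightarrow> good 1 A"
proof (induction "card A" arbitrary: A rule: less_induct)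
  case less
  have "IH (card A)" unfolding IH_def using less.hyps by blast
  then show ?case using good_of_IH less.prems by blast
qed

end

lemma (in coprime_lin_pair) sumset_lower_bound:
  assumes d1: "\<bar>det L1\<bar> \<ge> 1"
  defines "K \<equiv> phi CARD('n) (of_rat \<bar>det L1\<bar>) (of_rat \<bar>det L2\<bar>)"
  obtains D \<sigma> :: real where "D > 0" "\<sigma> > 0"
    "\<And>A. finite A \<Longrightarrow> real (G A A) \<ge> K * real (card A) - D * real (card A) powr (1 - \<sigma>)"
proof -
  have K1: "K \<ge> 1"
  proof -
    have "1 = phi CARD('n) 1 0" by (simp add: phi_def)
    also have "\<dots> \<le> K" unfolding K_def using d1 by (intro phi_mono) (auto simp: of_rat_less_eq[of 1, simplified])
    finally show ?thesis .
  qed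
  obtain E \<tau> :: real where E: "E > 0" and \<tau>: "0 < \<tau>" "\<tau> < 1"
    and BM: "\<And>A B C. finite A \<Longrightarrow> real (G A A) \<le> K * real (card A) \<Longrightarrow> B \<subseteq> A \<Longrightarrow> C \<subseteq> A \<Longrightarrow> B \<noteq> {} \<Longrightarrow> C \<noteq> {} \<Longrightarrow>
      (real (card B) powr (1 / real CARD('n)) + real (card C) powr (1 / real CARD('n))) ^ CARD('n)
        \<le> real (G B C) + E * real (card A) powr (1 - \<tau>)"
    by (rule brunn_minkowski_pairs[OF K1]) (rule that; blast)
  define \<epsilon> where "\<epsilon> = 1 / (16 * K\<^sup>2)"
  have \<epsilon>0: "\<epsilon> > 0" unfolding \<epsilon>_def using K1 by simp
  have lnK: "ln (2 * K) > 0" using K1 by simp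
  \<comment> \<open>The logarithmic bound expresses
    \<open>(2 K) powr \<sigma> \<le> 1 + \<epsilon>\<close>; \<open>\<sigma> \<le> \<tau>\<close>
    lets the Brunn--Minkowski error be absorbed.\<close>
  define \<sigma> where "\<sigma> = min \<tau> (ln (1 + \<epsilon>) / ln (2 * K))"
  have \<sigma>: "0 < \<sigma>" "\<sigma> \<le> \<tau>" unfolding \<sigma>_def using \<tau> lnK \<epsilon>0 by auto
  have pow: "(2 * K) powr \<sigma> \<le> 1 + \<epsilon>"
  proof -
    have "\<sigma> * ln (2 * K) \<le> (ln (1 + \<epsilon>) / ln (2 * K)) * ln (2 * K)" unfolding \<sigma>_def using lnK by (intro mult_right_mono) auto
    then have "\<sigma> * ln (2 * K) \<le> ln (1 + \<epsilon>)" using lnK by simp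
    then have "exp (\<sigma> * ln (2 * K)) \<le> exp (ln (1 + \<epsilon>))" by simp
    then show ?thesis using K1 \<epsilon>0 by (simp add: powr_def)
  qed
  define D where "D = max (2 * K) (4 * K\<^sup>2 * E / \<epsilon>)"
  have D: "4 * K\<^sup>2 * E \<le> \<epsilon> * D" "2 * K \<le> D"
  proof -
    have "\<epsilon> * (4 * K\<^sup>2 * E / \<epsilon>) \<le> \<epsilon> * D" unfolding D_def using \<epsilon>0 by (intro mult_left_mono) auto
    then show "4 * K\<^sup>2 * E \<le> \<epsilon> * D" using \<epsilon>0 by simp
    show "2 * K \<le> D" unfolding D_def by simp
  qed
  interpret ind_setup L1 L2 K D \<sigma> \<epsilon> E \<tau>
  proof unfold_locales
    show "phi CARD('n) (real (card B)) (real (card C)) \<le> real (G B C) + E * real (card A) powr (1 - \<tau>)"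
      if "finite A" "real (G A A) \<le> K * real (card A)" "B \<subseteq> A" "C \<subseteq> A" "B \<noteq> {}" "C \<noteq> {}" for A B C
      unfolding phi_def by (rule BM[OF that])
  qed (use K1 \<epsilon>_def \<sigma> \<tau> pow D E in \<open>auto simp: K_def\<close>)
  show ?thesis
  proof (rule that[OF _ \<sigma>(1)])
    show "D > 0" using D(2) K1 by linarith
    show "real (G A A) \<ge> K * real (card A) - D * real (card A) powr (1 - \<sigma>)" if "finite A" for A
      using all_good[OF that] unfolding good_def err_def by simp
  qed
qed

section \<open>Passing from real to rational vectors\<close>

lemma det_to_rat_mat: "det (to_rat_mat L) = of_int (det L)"
  unfolding det_def to_rat_mat_def by simp

text \<open>Extend \<open>x\<close> to a basis of the reals over the rationals and prescribe the
  value 1 at \<open>x\<close>.\<close>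

lemma additive_real_rat_nonzero:
  fixes x :: real assumes "x \<noteq> 0"
  shows "\<exists>f :: real \<Rightarrow> rat. (\<forall>a b. f (a + b) = f a + f b) \<and> f x \<noteq> 0"
proof -
  interpret p: vector_space_pair "\<lambda>(q::rat) (x::real). of_rat q * x" "(*) :: rat \<Rightarrow> rat \<Rightarrow> rat"
    by unfold_locales (simp_all add: algebra_simps of_rat_add of_rat_mult)
  have "p.vs1.independent {x}" using assms by (simp add: p.vs1.independent_insert)
  from p.linear_independent_extend[OF this, of "\<lambda>_. 1"]
  obtain g where g: "Vector_Spaces.linear (\<lambda>(q::rat) (x::real). of_rat q * x) (*) g" "g x = (1::rat)" by auto
  interpret g: Vector_Spaces.linear "\<lambda>(q::rat) (x::real). of_rat q * x" "(*) :: rat \<Rightarrow> rat \<Rightarrow> rat" g by (rule g(1))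
  show ?thesis using g.add g(2) by (intro exI[of _ g]) auto
qed

lemma additive_of_int:
  fixes f :: "real \<Rightarrow> rat" assumes add: "\<And>a b. f (a + b) = f a + f b"
  shows "f (of_int k * x) = of_int k * f x"
proof -
  have zero: "f 0 = 0" using add[of 0 0] by simp
  have neg: "f (- y) = - f y" for y using add[of y "- y"] zero by (simp add: eq_neg_iff_add_eq_0 add.commute)
  have nat: "f (of_nat m * x) = of_nat m * f x" for m
    by (induction m) (simp_all add: zero distrib_right add)
  show ?thesis
  proof (cases "k \<ge> 0")
    case True then show ?thesis using nat[of "nat k"] by simp
  next
    case False then show ?thesis using nat[of "nat (- k)"] neg[of "of_nat (nat (- k)) * x"] by simp
  qed
qed

lemma additive_sum:
  fixes f :: "real \<Rightarrow> rat" assumes add: "\<And>a b. f (a + b) = f a + f b"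
  shows "finite I \<Longrightarrow> f (sum g I) = (\<Sum>i\<in>I. f (g i))"
proof (induction I rule: finite_induct)
  case empty then show ?case using add[of 0 0] by simp
qed (simp add: add)

text \<open>One additive map applied to every coordinate commutes with integer matrices, so it maps
  the real sumset onto the rational one. It is chosen nonzero on all nonzero coordinate differences
  of \<open>A\<close>, hence injective on \<open>A\<close>.\<close>

lemma exists_rational_model:
  fixes A :: "(real^'n) set"
  assumes fin: "finite A"
  obtains A' :: "(rat^'n) set" where "finite A'" "card A' = card A"
    "\<And>L1 L2. card (sumset ((*v) (to_rat_mat L1) ` A') ((*v) (to_rat_mat L2) ` A'))
      \<le> card (sumset ((*v) (to_real_mat L1) ` A) ((*v) (to_real_mat L2) ` A))"
proof -
  define X where "X = (\<lambda>(a, b, i). (a - b) $ i) ` (A \<times> A \<times> UNIV) - {0}"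
  have finX: "finite X" using fin by (auto simp: X_def)
  define \<F> where "\<F> = {f :: real \<Rightarrow> rat. \<forall>a b. f (a + b) = f a + f b}"
  have "\<exists>f\<in>\<F>. \<forall>x\<in>X. f x \<noteq> 0"
  proof (rule exists_nonvanishing_combination[OF finX])
    fix x assume "x \<in> X"
    then have "x \<noteq> 0" by (auto simp: X_def)
    then show "\<exists>g\<in>\<F>. g x \<noteq> 0" using additive_real_rat_nonzero[of x] unfolding \<F>_def by blast
  qed (auto simp: \<F>_def algebra_simps)
  then obtain f where "f \<in> \<F>" and nz: "\<And>x. x \<in> X \<Longrightarrow> f x \<noteq> 0" by blast
  then have add: "f (a + b) = f a + f b" for a b by (simp add: \<F>_def)
  have diff: "f (a - b) = f a - f b" for a b using add[of "a - b" b] by simp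
  define F :: "real^'n \<Rightarrow> rat^'n" where "F a = (\<chi> i. f (a $ i))" for a
  have Fadd: "F (a + b) = F a + F b" for a b by (simp add: F_def vec_eq_iff add)
  have Fmat: "F (to_real_mat L *v a) = to_rat_mat L *v F a" for L a
    by (simp add: F_def vec_eq_iff matrix_vector_mult_def to_real_mat_def to_rat_mat_def additive_sum[OF add] additive_of_int[OF add])
  have inj: "inj_on F A"
  proof (rule inj_onI, rule ccontr)
    fix a b assume ab: "a \<in> A" "b \<in> A" "F a = F b" "a \<noteq> b"
    then obtain i where i: "a $ i \<noteq> b $ i" by (auto simp: vec_eq_iff)
    then have "(a - b) $ i \<in> X" unfolding X_def using ab by (auto intro!: image_eqI[of _ _ "(a, b, i)"])
    then have "f (a $ i - b $ i) \<noteq> 0" using nz by fastforce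
    then have "F a $ i \<noteq> F b $ i" by (simp add: F_def diff)
    then show False using ab by simp
  qed
  show ?thesis
  proof (rule that[of "F ` A"])
    show "finite (F ` A)" using fin by simp
    show "card (F ` A) = card A" by (rule card_image[OF inj])
    fix L1 L2
    have "sumset ((*v) (to_rat_mat L1) ` F ` A) ((*v) (to_rat_mat L2) ` F ` A)
        \<subseteq> F ` sumset ((*v) (to_real_mat L1) ` A) ((*v) (to_real_mat L2) ` A)"
    proof
      fix z assume "z \<in> sumset ((*v) (to_rat_mat L1) ` F ` A) ((*v) (to_rat_mat L2) ` F ` A)"
      then obtain a b where ab: "a \<in> A" "b \<in> A" "z = to_rat_mat L1 *v F a + to_rat_mat L2 *v F b" by (auto elim!: sumsetE)
      then have "z = F (to_real_mat L1 *v a + to_real_mat L2 *v b)" by (simp add: Fadd Fmat)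
      then show "z \<in> F ` sumset ((*v) (to_real_mat L1) ` A) ((*v) (to_real_mat L2) ` A)" using ab by blast
    qed
    then have "card (sumset ((*v) (to_rat_mat L1) ` F ` A) ((*v) (to_rat_mat L2) ` F ` A))
        \<le> card (F ` sumset ((*v) (to_real_mat L1) ` A) ((*v) (to_real_mat L2) ` A))"
      using fin by (intro card_mono) auto
    also have "\<dots> \<le> card (sumset ((*v) (to_real_mat L1) ` A) ((*v) (to_real_mat L2) ` A))"
      using fin by (intro card_image_le) auto
    finally show "card (sumset ((*v) (to_rat_mat L1) ` F ` A) ((*v) (to_rat_mat L2) ` F ` A))
        \<le> card (sumset ((*v) (to_real_mat L1) ` A) ((*v) (to_real_mat L2) ` A))" .
  qed
qed

lemma coprime_lin_pair_of_pair:
  fixes L1 L2 :: "int^'n^'n"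
  assumes irr: "irreducible_pair L1 L2" and cop: "coprime_pair L1 L2" and d: "det L1 \<noteq> 0" "det L2 \<noteq> 0"
  shows "coprime_lin_pair (to_rat_mat L1) (to_rat_mat L2)"
proof
  show "invertible (to_rat_mat L1)" "invertible (to_rat_mat L2)" using d by (simp_all add: invertible_det_nz det_to_rat_mat)
  fix U V :: "(rat^'n) set"
  assume UV: "vec.subspace U" "vec.subspace V" "vec.dim U = vec.dim V"
    "(\<lambda>u. to_rat_mat L1 *v u) ` U \<subseteq> V" "(\<lambda>u. to_rat_mat L2 *v u) ` U \<subseteq> V"
  show "U = {0} \<or> U = UNIV"
  proof (rule ccontr)
    assume n: "\<not> ?thesis"
    have "V \<noteq> {0}"
    proof
      assume "V = {0}"
      then have "vec.dim U = 0" using UV(3) by simp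
      then have "U \<subseteq> {0}" by (simp add: vec.dim_eq_0)
      then show False using n vec.subspace_0[OF UV(1)] by blast
    qed
    moreover have "V \<noteq> UNIV"
    proof
      assume "V = UNIV"
      then have "U = V" using UV by (intro vec.subspace_dim_equal) auto
      then show False using n \<open>V = UNIV\<close> by simp
    qed
    ultimately show False using irr UV n unfolding irreducible_pair_def by blast
  qed
next
  fix P Q :: "rat^'n^'n"
  assume PQ: "invertible P" "invertible Q" "is_int_mat (P ** to_rat_mat L1 ** Q)" "is_int_mat (P ** to_rat_mat L2 ** Q)"
  have "0 < \<bar>det P * det Q\<bar>" using PQ by (simp add: invertible_det_nz)
  then show "1 \<le> \<bar>det P * det Q\<bar>" using cop PQ unfolding coprime_pair_def by (meson not_le)
qed

text \<open>A kernel vector \<open>u\<close> spans a line that both matrices map into a line, so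
  irreducibility forces dimension 1 and \<open>L1 = 0\<close>. Scaling by the inverse of
  \<open>L2\<close> would then violate coprimality if \<open>|det L2| > 1\<close>.\<close>

lemma singular_det_le_1:
  fixes L1 L2 :: "int^'n^'n"
  assumes irr: "irreducible_pair L1 L2" and cop: "coprime_pair L1 L2" and d: "det L1 = 0"
  shows "\<bar>det L2\<bar> \<le> 1"
proof -
  have "\<not> invertible (to_rat_mat L1)" using d by (simp add: invertible_det_nz det_to_rat_mat)
  then have "\<not> inj ((*v) (to_rat_mat L1))" using matrix_left_invertible_injective[of "to_rat_mat L1"] by (metis invertible_left_inverse)
  then obtain x y where xy: "to_rat_mat L1 *v x = to_rat_mat L1 *v y" "x \<noteq> y" by (auto simp: inj_def)
  define u where "u = x - y"
  have u: "u \<noteq> 0" "to_rat_mat L1 *v u = 0" using xy by (simp_all add: u_def matrix_vector_mult_diff_distrib)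
  \<comment> \<open>The fallback \<open>u\<close> keeps \<open>V\<close> one-dimensional when
    \<open>L2\<close> also kills \<open>u\<close>.\<close>
  define w where "w = (if to_rat_mat L2 *v u = 0 then u else to_rat_mat L2 *v u)"
  have w: "w \<noteq> 0" using u by (simp add: w_def)
  define U V where "U = vec.span {u}" and "V = vec.span {w}"
  have dimUV: "vec.dim U = 1" "vec.dim V = 1"
    using u(1) w by (simp_all add: U_def V_def vec.dim_eq_card_independent vec.independent_insert)
  have L2V: "to_rat_mat L2 *v u \<in> V"
    unfolding V_def w_def by (cases "to_rat_mat L2 *v u = 0") (auto intro: vec.span_base vec.span_zero)
  have im: "(\<lambda>u. L *v u) ` U \<subseteq> V" if Lu: "L *v u \<in> V" for L :: "rat^'n^'n"
  proof -
    have "(\<lambda>u. L *v u) ` U = vec.span ((\<lambda>u. L *v u) ` {u})" unfolding U_def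
      by (rule vec.linear_span_image[OF matrix_vector_mul_linear_gen, symmetric])
    also have "\<dots> \<subseteq> V" using Lu unfolding V_def by (intro vec.span_minimal) auto
    finally show ?thesis .
  qed
  have "0 \<in> V" by (simp add: V_def vec.span_zero)
  then have ims: "(\<lambda>u. to_rat_mat L1 *v u) ` U \<subseteq> V" "(\<lambda>u. to_rat_mat L2 *v u) ` U \<subseteq> V"
    using im[of "to_rat_mat L1"] im[of "to_rat_mat L2"] u(2) L2V by auto
  have sub: "vec.subspace U" "vec.subspace V" by (simp_all add: U_def V_def)
  have nz: "U \<noteq> {0}" "V \<noteq> {0}" using dimUV by auto
  have "U = UNIV \<or> V = UNIV"
  proof (rule ccontr)
    assume c: "\<not> ?thesis"
    have "vec.subspace U \<and> vec.subspace V \<and> vec.dim U = vec.dim V \<and>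
          U \<noteq> {0} \<and> U \<noteq> UNIV \<and> V \<noteq> {0} \<and> V \<noteq> UNIV \<and>
          (\<lambda>u. to_rat_mat L1 *v u) ` U \<subseteq> V \<and> (\<lambda>u. to_rat_mat L2 *v u) ` U \<subseteq> V"
      using sub nz ims dimUV c by metis
    then show False using irr unfolding irreducible_pair_def by (elim notE) (rule exI, rule exI)
  qed
  then have "vec.dim (UNIV :: (rat^'n) set) = 1" using dimUV by auto
  then have card1: "CARD('n) = 1" by (simp only: vec_dim_card)
  then obtain i :: 'n where i: "UNIV = {i}" by (metis card_1_singletonE)
  have all_i: "j = i" for j using i by blast
  have "u $ i \<noteq> 0"
  proof
    assume "u $ i = 0"
    then have "u = 0" unfolding vec_eq_iff using all_i by (metis zero_index)
    then show False using u(1) by simp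
  qed
  moreover have "to_rat_mat L1 $ i $ i * u $ i = 0"
    using arg_cong[OF u(2), of "\<lambda>v. v $ i"] by (simp add: matrix_vector_mult_def i)
  ultimately have "to_rat_mat L1 $ i $ i = 0" by simp
  then have L1z: "to_rat_mat L1 = 0" unfolding vec_eq_iff using all_i by (metis zero_index)
  show ?thesis
  proof (rule ccontr)
    assume big: "\<not> ?thesis"
    then have "det L2 \<noteq> 0" by auto
    then have inv: "invertible (to_rat_mat L2)" by (simp add: invertible_det_nz det_to_rat_mat)
    define P where "P = matrix_inv (to_rat_mat L2)"
    have P: "P ** to_rat_mat L2 = mat 1" "to_rat_mat L2 ** P = mat 1" unfolding P_def using matrix_inv_both[OF inv] by auto
    have "invertible P" using P unfolding invertible_def by blast
    moreover have "invertible (mat 1 :: rat^'n^'n)" unfolding invertible_def by (intro exI[of _ "mat 1"]) simp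
    moreover have "det P * of_int (det L2) = 1" using arg_cong[OF P(1), of det] by (simp add: det_mul det_to_rat_mat)
    then have dP: "\<bar>det P\<bar> * of_int \<bar>det L2\<bar> = 1" by (metis abs_mult abs_one of_int_abs)
    then have "0 < \<bar>det P\<bar>" by auto
    moreover have "\<bar>det P\<bar> < 1"
    proof (rule ccontr)
      assume "\<not> \<bar>det P\<bar> < 1"
      then have "1 * (2::rat) \<le> \<bar>det P\<bar> * of_int \<bar>det L2\<bar>" using big by (intro mult_mono) auto
      then show False using dP by simp
    qed
    moreover have "is_int_mat (P ** to_rat_mat L1 ** mat 1)" unfolding L1z is_int_mat_def
      by (simp add: matrix_matrix_mult_def)
    moreover have "is_int_mat (P ** to_rat_mat L2 ** mat 1)" unfolding P is_int_mat_def matrix_mul_rid by (simp add: mat_def)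
    ultimately have "invertible P \<and> invertible (mat 1 :: rat^'n^'n) \<and> 0 < \<bar>det P * det (mat 1 :: rat^'n^'n)\<bar> \<and>
        \<bar>det P * det (mat 1 :: rat^'n^'n)\<bar> < 1 \<and> is_int_mat (P ** to_rat_mat L1 ** mat 1) \<and> is_int_mat (P ** to_rat_mat L2 ** mat 1)"
      by simp
    then show False using cop unfolding coprime_pair_def by (elim notE) (rule exI, rule exI)
  qed
qed

lemma card_le_sumset_of_det_1:
  fixes L1 L2 :: "int^'n^'n"
  assumes fin: "finite A" and d: "\<bar>det L2\<bar> \<le> 1"
  shows "real_of_int \<bar>det L2\<bar> * real (card A) \<le> real (card (sumset ((*v) (to_real_mat L1) ` A) ((*v) (to_real_mat L2) ` A)))"
proof (cases "det L2 = 0 \<or> A = {}")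
  case False
  have "det (to_real_mat L2) = of_int (det L2)" unfolding det_def to_real_mat_def by simp
  then have "invertible (to_real_mat L2)" using False by (simp add: invertible_det_nz)
  then have "inj ((*v) (to_real_mat L2))" by (rule inj_matrix_vector_mult)
  then have "card A = card ((*v) (to_real_mat L2) ` A)" by (intro card_image[symmetric]) (rule inj_on_subset, auto)
  also have "\<dots> \<le> card (sumset ((*v) (to_real_mat L1) ` A) ((*v) (to_real_mat L2) ` A))"
    using fin False by (intro card_sumset_ge_right) auto
  moreover have "real_of_int \<bar>det L2\<bar> * real (card A) \<le> 1 * real (card A)" using d by (intro mult_right_mono) auto
  ultimately show ?thesis by linarith
qed auto

lemma irreducible_pair_commute: "irreducible_pair L1 L2 \<Longrightarrow> irreducible_pair L2 L1"
  unfolding irreducible_pair_def by blast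

lemma coprime_pair_commute: "coprime_pair L1 L2 \<Longrightarrow> coprime_pair L2 L1"
  unfolding coprime_pair_def by blast

theorem theorem6p1:
  fixes L1 L2 :: "int^'n^'n"
  assumes "irreducible_pair L1 L2" and "coprime_pair L1 L2"
  shows "\<exists>D::real. \<exists>\<sigma>::real. D > 0 \<and> \<sigma> > 0 \<and>
    (\<forall>A :: (real^'n) set. finite A \<longrightarrow>
      real (card (sumset ((\<lambda>a. to_real_mat L1 *v a) ` A) ((\<lambda>a. to_real_mat L2 *v a) ` A)))
        \<ge> (\<bar>real_of_int (det L1)\<bar> powr (1 / real CARD('n))
           + \<bar>real_of_int (det L2)\<bar> powr (1 / real CARD('n))) ^ CARD('n) * real (card A)
          - D * real (card A) powr (1 - \<sigma>))"
proof (cases "det L1 = 0 \<or> det L2 = 0")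
  case True
  \<comment> \<open>One of the two roots vanishes, so the power reduces to the other
    determinant.\<close>
  have K: "(\<bar>real_of_int (det L1)\<bar> powr (1 / real CARD('n)) + \<bar>real_of_int (det L2)\<bar> powr (1 / real CARD('n))) ^ CARD('n)
      = real_of_int \<bar>det L1\<bar> + real_of_int \<bar>det L2\<bar>"
    using True by (auto simp: powr_inverse_power)
  have "(real_of_int \<bar>det L1\<bar> + real_of_int \<bar>det L2\<bar>) * real (card A)
      \<le> real (card (sumset ((*v) (to_real_mat L1) ` A) ((*v) (to_real_mat L2) ` A)))" if fin: "finite A" for A :: "(real^'n) set"
  proof (cases "det L1 = 0")
    case z: True
    show ?thesis using card_le_sumset_of_det_1[OF fin singular_det_le_1[OF assms z], of L1] z by simp
  next
    case False
    then have z: "det L2 = 0" using True by simp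
    show ?thesis
      using card_le_sumset_of_det_1[OF fin singular_det_le_1[OF irreducible_pair_commute[OF assms(1)] coprime_pair_commute[OF assms(2)] z], of L2] z
      by (simp add: sumset_commute)
  qed
  \<comment> \<open>The bound holds without error term here; \<open>D = 1\<close> and
    \<open>\<sigma> = 1\<close> are defaults.\<close>
  then have "(real_of_int \<bar>det L1\<bar> + real_of_int \<bar>det L2\<bar>) * real (card A) - 1 * real (card A) powr (1 - 1)
      \<le> real (card (sumset ((*v) (to_real_mat L1) ` A) ((*v) (to_real_mat L2) ` A)))" if fin: "finite A" for A :: "(real^'n) set"
    using that by (smt (verit) powr_ge_zero)
  then show ?thesis unfolding K by (intro exI[of _ 1]) auto
next
  case False
  then interpret cp: coprime_lin_pair "to_rat_mat L1" "to_rat_mat L2" using coprime_lin_pair_of_pair[OF assms] by blast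
  have "\<bar>det L1\<bar> \<ge> 1" using False by linarith
  then have "1 \<le> \<bar>rat_of_int (det L1)\<bar>" by linarith
  then have d1: "\<bar>det (to_rat_mat L1)\<bar> \<ge> 1" by (simp add: det_to_rat_mat)
  obtain D \<sigma> :: real where D: "D > 0" "\<sigma> > 0"
    and bound: "\<And>A. finite A \<Longrightarrow> real (cp.G A A) \<ge> phi CARD('n) (of_rat \<bar>det (to_rat_mat L1)\<bar>) (of_rat \<bar>det (to_rat_mat L2)\<bar>) * real (card A)
      - D * real (card A) powr (1 - \<sigma>)"
    by (rule cp.sumset_lower_bound[OF d1]) (rule that; blast)
  have dr: "real_of_rat \<bar>det (to_rat_mat L)\<bar> = \<bar>real_of_int (det L)\<bar>" for L :: "int^'n^'n"
    unfolding det_to_rat_mat by (metis of_int_abs of_rat_of_int_eq)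
  have "real (card (sumset ((\<lambda>a. to_real_mat L1 *v a) ` A) ((\<lambda>a. to_real_mat L2 *v a) ` A)))
        \<ge> (\<bar>real_of_int (det L1)\<bar> powr (1 / real CARD('n))
           + \<bar>real_of_int (det L2)\<bar> powr (1 / real CARD('n))) ^ CARD('n) * real (card A)
          - D * real (card A) powr (1 - \<sigma>)" if fin: "finite A" for A :: "(real^'n) set"
  proof -
    obtain A' :: "(rat^'n) set" where A': "finite A'" "card A' = card A"
      "\<And>L1 L2. card (sumset ((*v) (to_rat_mat L1) ` A') ((*v) (to_rat_mat L2) ` A'))
        \<le> card (sumset ((*v) (to_real_mat L1) ` A) ((*v) (to_real_mat L2) ` A))"
      using exists_rational_model[OF fin] by metis
    have "real (cp.G A' A') \<le> real (card (sumset ((*v) (to_real_mat L1) ` A) ((*v) (to_real_mat L2) ` A)))"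
      unfolding cp.G_def using A'(3) by (simp only: of_nat_le_iff)
    then show ?thesis using bound[OF A'(1)] unfolding A'(2) dr phi_def by linarith
  qed
  then show ?thesis using D by blast
qed

end
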